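(* The tensor product $M\,\underline{\circledcirc}\,N$ of square groups $M,N$ is such that $(\mathsf{SG},\underline{\circledcirc},\mathbb Z_{\mathrm{nil}})$ is a symmetric monoidal category. Moreover, if $M$ and $N$ are abelian groups (regarded as square groups with trivial $ee$-level), then $M\,\underline{\circledcirc}\,N=M\otimes N$, the usual tensor product of abelian groups.
   Context: Groups are written additively. A map $f:G\to A$ from a group to an abelian group is quadratic if its cross-effect $(x|y)_f:=f(x+y)-f(x)-f(y)$ is linear in $x$ and in $y$. A square group $M=(M_e\xrightarrow{H}M_{ee}\xrightarrow{P}M_e)$ consists of a group $M_e$, an abelian group $M_{ee}$, a homomorphism $P$ and a quadratic map $H$ such that for all $x,y\in M_e$, $a,b\in M_{ee}$: $(Pa|y)_H=0=(x|Pb)_H$, $P(x|y)_H=-x-y+x+y$, $PHP(a)=2P(a)$. Morphisms are pairs of homomorphisms $(f_e,f_{ee})$ commuting with $H$ and $P$; the category is $\mathsf{SG}$. In a square group $\mathrm{Im}(P)$ is central and contains all commutators, so $\mathrm{Coker}(P)$ is an abelian group; $\bar x$ is the class of $x\in M_e$. The cross-effect induces a homomorphism $(-|-)_H:\mathrm{Coker}(P)\otimes\mathrm{Coker}(P)\to M_{ee}$; there is a homomorphism $\Delta:\mathrm{Coker}(P)\to M_{ee}$, $\Delta(\bar x)=HPH(x)+H(x+x)-4H(x)$ (also written $\Delta(x)$); and $T:=HP-\mathrm{Id}:M_{ee}\to M_{ee}$ is a homomorphism with $T^2=\mathrm{Id}$. $\mathbb Z_{\mathrm{nil}}$ is the square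 group with both levels $\mathbb Z$, $H(n)=\binom n2$, $P=0$. The category $\mathsf{Ab}$ of abelian groups is identified with the full subcategory of square groups with $M_{ee}=0$. Tensor product: $(M\underline{\circledcirc}N)_{ee}=M_{ee}\otimes N_{ee}$, and $(M\underline{\circledcirc}N)_e$ is the group with generators $x\underline{\circledcirc}y$ ($x\in M_e,y\in N_e$) and $a\bar\otimes b$ ($a\in M_{ee},b\in N_{ee}$) and relations: (1) $a\bar\otimes b$ is bilinear and central; (2) $x\underline{\circledcirc}(y_1+y_2)=x\underline{\circledcirc}y_1+x\underline{\circledcirc}y_2$; (3) $(x_1+x_2)\underline{\circledcirc}y=x_1\underline{\circledcirc}y+x_2\underline{\circledcirc}y+(x_2|x_1)_H\bar\otimes H(y)$; (4) $x\underline{\circledcirc}P(b)=(x|x)_H\bar\otimes b$; (5) $P(a)\underline{\circledcirc}y=a\bar\otimes\Delta(y)$; (6) $T(a)\bar\otimes T(b)=-a\bar\otimes b$. The homomorphism $P$ is $P(a\otimes b)=a\bar\otimes b$, so that $\mathrm{Coker}(P^{M\underline{\circledcirc}N})=\mathrm{Coker}(P^M)\otimes\mathrm{Coker}(P^N)$, and $H$ is the unique quadratic map with cross-effect induced by $(\bar x\otimes\bar y)\otimes(\bar x'\otimes\bar y')\mapsto(x|x')_H\otimes(y|y')_H$ and with $H(x\underline{\circledcirc}y)=(x|x)_H\otimes H(y)+H(x)\otimes\Delta(y)$, $H(a\bar\otimes b)=a\otimes b-T(a)\otimes T(b)$. *)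

theory Defs
  imports "HOL-Algebra.Elementary_Groups"
begin

section \<open>Symmetric monoidal categories\<close>

record ('o, 'm) cat =
  Obj :: "'o set"
  Hom :: "'o \<Rightarrow> 'o \<Rightarrow> 'm set"
  Id :: "'o \<Rightarrow> 'm"
  Comp :: "'m \<Rightarrow> 'm \<Rightarrow> 'm"  (infixr \<open>\<cdot>\<index>\<close> 75)

locale category =
  fixes C :: "('o, 'm) cat" (structure)
  assumes id_in_Hom: "X \<in> Obj C \<Longrightarrow> Id C X \<in> Hom C X X"
    and comp_in_Hom:
      "\<lbrakk>X \<in> Obj C; Y \<in> Obj C; Z \<in> Obj C; f \<in> Hom C X Y; g \<in> Hom C Y Z\<rbrakk> \<Longrightarrow> g \<cdot> f \<in> Hom C X Z"
    and comp_id: "\<lbrakk>X \<in> Obj C; Y \<in> Obj C; f \<in> Hom C X Y\<rbrakk> \<Longrightarrow> f \<cdot> Id C X = f"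
    and id_comp: "\<lbrakk>X \<in> Obj C; Y \<in> Obj C; f \<in> Hom C X Y\<rbrakk> \<Longrightarrow> Id C Y \<cdot> f = f"
    and comp_assoc:
      "\<lbrakk>W \<in> Obj C; X \<in> Obj C; Y \<in> Obj C; Z \<in> Obj C;
        f \<in> Hom C W X; g \<in> Hom C X Y; h \<in> Hom C Y Z\<rbrakk> \<Longrightarrow> (h \<cdot> g) \<cdot> f = h \<cdot> (g \<cdot> f)"

definition cat_iso :: "('o, 'm) cat \<Rightarrow> 'o \<Rightarrow> 'o \<Rightarrow> 'm set" where
  "cat_iso C X Y = {f \<in> Hom C X Y. \<exists>g \<in> Hom C Y X. g \<cdot>\<^bsub>C\<^esub> f = Id C X \<and> f \<cdot>\<^bsub>C\<^esub> g = Id C Y}"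

text \<open>The product is \<open>tens\<close> on objects and \<open>tensm\<close> on morphisms; \<open>asc\<close>, \<open>lun\<close>, \<open>run\<close>
  and \<open>brd\<close> are the associativity, left unit, right unit and symmetry constraints.\<close>

locale symmetric_monoidal_category = category C
  for C :: "('o, 'm) cat" (structure) +
  fixes tens :: "'o \<Rightarrow> 'o \<Rightarrow> 'o" (infixr \<open>\<odot>\<close> 80)
    and tensm :: "'m \<Rightarrow> 'm \<Rightarrow> 'm" (infixr \<open>\<boxdot>\<close> 80)
    and I :: 'o
    and asc :: "'o \<Rightarrow> 'o \<Rightarrow> 'o \<Rightarrow> 'm"
    and lun run :: "'o \<Rightarrow> 'm"
    and brd :: "'o \<Rightarrow> 'o \<Rightarrow> 'm"
  assumes tens_obj: "\<lbrakk>X \<in> Obj C; Y \<in> Obj C\<rbrakk> \<Longrightarrow> X \<odot> Y \<in> Obj C"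
    and unit_obj: "I \<in> Obj C"
    and tensm_in_Hom:
      "\<lbrakk>X \<in> Obj C; X' \<in> Obj C; Y \<in> Obj C; Y' \<in> Obj C; f \<in> Hom C X X'; g \<in> Hom C Y Y'\<rbrakk>
        \<Longrightarrow> f \<boxdot> g \<in> Hom C (X \<odot> Y) (X' \<odot> Y')"
    and tensm_id: "\<lbrakk>X \<in> Obj C; Y \<in> Obj C\<rbrakk> \<Longrightarrow> Id C X \<boxdot> Id C Y = Id C (X \<odot> Y)"
    and tensm_comp:
      "\<lbrakk>X \<in> Obj C; X' \<in> Obj C; X'' \<in> Obj C; Y \<in> Obj C; Y' \<in> Obj C; Y'' \<in> Obj C;
        f \<in> Hom C X X'; f' \<in> Hom C X' X''; g \<in> Hom C Y Y'; g' \<in> Hom C Y' Y''\<rbrakk>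
        \<Longrightarrow> (f' \<cdot> f) \<boxdot> (g' \<cdot> g) = (f' \<boxdot> g') \<cdot> (f \<boxdot> g)"
    and asc_iso:
      "\<lbrakk>X \<in> Obj C; Y \<in> Obj C; Z \<in> Obj C\<rbrakk> \<Longrightarrow> asc X Y Z \<in> cat_iso C ((X \<odot> Y) \<odot> Z) (X \<odot> (Y \<odot> Z))"
    and asc_natural:
      "\<lbrakk>X \<in> Obj C; X' \<in> Obj C; Y \<in> Obj C; Y' \<in> Obj C; Z \<in> Obj C; Z' \<in> Obj C;
        f \<in> Hom C X X'; g \<in> Hom C Y Y'; h \<in> Hom C Z Z'\<rbrakk>
        \<Longrightarrow> asc X' Y' Z' \<cdot> ((f \<boxdot> g) \<boxdot> h) = (f \<boxdot> (g \<boxdot> h)) \<cdot> asc X Y Z"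
    and lun_iso: "X \<in> Obj C \<Longrightarrow> lun X \<in> cat_iso C (I \<odot> X) X"
    and lun_natural:
      "\<lbrakk>X \<in> Obj C; X' \<in> Obj C; f \<in> Hom C X X'\<rbrakk> \<Longrightarrow> lun X' \<cdot> (Id C I \<boxdot> f) = f \<cdot> lun X"
    and run_iso: "X \<in> Obj C \<Longrightarrow> run X \<in> cat_iso C (X \<odot> I) X"
    and run_natural:
      "\<lbrakk>X \<in> Obj C; X' \<in> Obj C; f \<in> Hom C X X'\<rbrakk> \<Longrightarrow> run X' \<cdot> (f \<boxdot> Id C I) = f \<cdot> run X"
    and brd_iso: "\<lbrakk>X \<in> Obj C; Y \<in> Obj C\<rbrakk> \<Longrightarrow> brd X Y \<in> cat_iso C (X \<odot> Y) (Y \<odot> X)"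
    and brd_natural:
      "\<lbrakk>X \<in> Obj C; X' \<in> Obj C; Y \<in> Obj C; Y' \<in> Obj C; f \<in> Hom C X X'; g \<in> Hom C Y Y'\<rbrakk>
        \<Longrightarrow> brd X' Y' \<cdot> (f \<boxdot> g) = (g \<boxdot> f) \<cdot> brd X Y"
    and pentagon:
      "\<lbrakk>W \<in> Obj C; X \<in> Obj C; Y \<in> Obj C; Z \<in> Obj C\<rbrakk>
        \<Longrightarrow> (Id C W \<boxdot> asc X Y Z) \<cdot> asc W (X \<odot> Y) Z \<cdot> (asc W X Y \<boxdot> Id C Z)
          = asc W X (Y \<odot> Z) \<cdot> asc (W \<odot> X) Y Z"
    and triangle:
      "\<lbrakk>X \<in> Obj C; Y \<in> Obj C\<rbrakk> \<Longrightarrow> (Id C X \<boxdot> lun Y) \<cdot> asc X I Y = run X \<boxdot> Id C Y"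
    and hexagon:
      "\<lbrakk>X \<in> Obj C; Y \<in> Obj C; Z \<in> Obj C\<rbrakk>
        \<Longrightarrow> asc Y Z X \<cdot> brd X (Y \<odot> Z) \<cdot> asc X Y Z
          = (Id C Y \<boxdot> brd X Z) \<cdot> asc Y X Z \<cdot> (brd X Y \<boxdot> Id C Z)"
    and symmetry: "\<lbrakk>X \<in> Obj C; Y \<in> Obj C\<rbrakk> \<Longrightarrow> brd Y X \<cdot> brd X Y = Id C (X \<odot> Y)"


section \<open>Square groups\<close>

text \<open>Groups are those of HOL-Algebra, hence written multiplicatively: \<open>x \<otimes> y\<close> stands for the
  $x + y$, \<open>inv x\<close> for the $-x$ and \<open>\<one>\<close> for the $0$ of the additive notation.\<close>

record ('a, 'b) sq_group =
  lvl_e :: "'a monoid"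
  lvl_ee :: "'b monoid"
  Hmap :: "'a \<Rightarrow> 'b"
  Pmap :: "'b \<Rightarrow> 'a"

definition cross_effect :: "'a monoid \<Rightarrow> 'b monoid \<Rightarrow> ('a \<Rightarrow> 'b) \<Rightarrow> 'a \<Rightarrow> 'a \<Rightarrow> 'b" where
  "cross_effect G A f x y = f (x \<otimes>\<^bsub>G\<^esub> y) \<otimes>\<^bsub>A\<^esub> inv\<^bsub>A\<^esub> (f x) \<otimes>\<^bsub>A\<^esub> inv\<^bsub>A\<^esub> (f y)"

definition quadratic :: "'a monoid \<Rightarrow> 'b monoid \<Rightarrow> ('a \<Rightarrow> 'b) \<Rightarrow> bool" where
  "quadratic G A f \<longleftrightarrow>
     f \<in> carrier G \<rightarrow> carrier A \<and>
     (\<forall>y \<in> carrier G. (\<lambda>x. cross_effect G A f x y) \<in> hom G A) \<and>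
     (\<forall>x \<in> carrier G. (\<lambda>y. cross_effect G A f x y) \<in> hom G A)"

abbreviation crossH :: "('a, 'b) sq_group \<Rightarrow> 'a \<Rightarrow> 'a \<Rightarrow> 'b" where
  "crossH M \<equiv> cross_effect (lvl_e M) (lvl_ee M) (Hmap M)"

definition square_group :: "('a, 'b) sq_group \<Rightarrow> bool" where
  "square_group M \<longleftrightarrow>
     group (lvl_e M) \<and> comm_group (lvl_ee M) \<and>
     Pmap M \<in> hom (lvl_ee M) (lvl_e M) \<and>
     quadratic (lvl_e M) (lvl_ee M) (Hmap M) \<and>
     (\<forall>a \<in> carrier (lvl_ee M). \<forall>y \<in> carrier (lvl_e M). crossH M (Pmap M a) y = \<one>\<^bsub>lvl_ee M\<^esub>) \<and>
     (\<forall>x \<in> carrier (lvl_e M). \<forall>b \<in> carrier (lvl_ee M). crossH M x (Pmap M b) = \<one>\<^bsub>lvl_ee M\<^esub>) \<and>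
     (\<forall>x \<in> carrier (lvl_e M). \<forall>y \<in> carrier (lvl_e M).
        Pmap M (crossH M x y) = inv\<^bsub>lvl_e M\<^esub> x \<otimes>\<^bsub>lvl_e M\<^esub> inv\<^bsub>lvl_e M\<^esub> y \<otimes>\<^bsub>lvl_e M\<^esub> x \<otimes>\<^bsub>lvl_e M\<^esub> y) \<and>
     (\<forall>a \<in> carrier (lvl_ee M). Pmap M (Hmap M (Pmap M a)) = Pmap M a \<otimes>\<^bsub>lvl_e M\<^esub> Pmap M a)"

definition Delta :: "('a, 'b) sq_group \<Rightarrow> 'a \<Rightarrow> 'b" where
  "Delta M x = Hmap M (Pmap M (Hmap M x)) \<otimes>\<^bsub>lvl_ee M\<^esub> Hmap M (x \<otimes>\<^bsub>lvl_e M\<^esub> x)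
                 \<otimes>\<^bsub>lvl_ee M\<^esub> inv\<^bsub>lvl_ee M\<^esub> (Hmap M x [^]\<^bsub>lvl_ee M\<^esub> (4::nat))"

definition Tmap :: "('a, 'b) sq_group \<Rightarrow> 'b \<Rightarrow> 'b" where
  "Tmap M a = Hmap M (Pmap M a) \<otimes>\<^bsub>lvl_ee M\<^esub> inv\<^bsub>lvl_ee M\<^esub> a"

text \<open>A morphism carries its source and target; its two maps are \<open>extensional\<close>, that is, fixed
  off the carriers, so that equality of morphisms is equality of maps on the carriers.\<close>

record ('a, 'b, 'c, 'd) sg_mor =
  src :: "('a, 'b) sq_group"
  tgt :: "('c, 'd) sq_group"
  map_e :: "'a \<Rightarrow> 'c"
  map_ee :: "'b \<Rightarrow> 'd"

definition sg_hom ::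
  "('a, 'b) sq_group \<Rightarrow> ('c, 'd) sq_group \<Rightarrow> ('a, 'b, 'c, 'd) sg_mor set" where
  "sg_hom M N = {\<phi>. src \<phi> = M \<and> tgt \<phi> = N \<and>
     map_e \<phi> \<in> hom (lvl_e M) (lvl_e N) \<inter> extensional (carrier (lvl_e M)) \<and>
     map_ee \<phi> \<in> hom (lvl_ee M) (lvl_ee N) \<inter> extensional (carrier (lvl_ee M)) \<and>
     (\<forall>x \<in> carrier (lvl_e M). map_ee \<phi> (Hmap M x) = Hmap N (map_e \<phi> x)) \<and>
     (\<forall>a \<in> carrier (lvl_ee M). map_e \<phi> (Pmap M a) = Pmap N (map_ee \<phi> a))}"

definition sg_id :: "('a, 'b) sq_group \<Rightarrow> ('a, 'b, 'a, 'b) sg_mor" where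
  "sg_id M = \<lparr>src = M, tgt = M,
     map_e = (\<lambda>x \<in> carrier (lvl_e M). x), map_ee = (\<lambda>a \<in> carrier (lvl_ee M). a)\<rparr>"

definition sg_comp ::
  "('c, 'd, 'k, 'l) sg_mor \<Rightarrow> ('a, 'b, 'c, 'd) sg_mor \<Rightarrow> ('a, 'b, 'k, 'l) sg_mor" where
  "sg_comp \<psi> \<phi> = \<lparr>src = src \<phi>, tgt = tgt \<psi>,
     map_e = compose (carrier (lvl_e (src \<phi>))) (map_e \<psi>) (map_e \<phi>),
     map_ee = compose (carrier (lvl_ee (src \<phi>))) (map_ee \<psi>) (map_ee \<phi>)\<rparr>"

definition sg_iso ::
  "('a, 'b) sq_group \<Rightarrow> ('c, 'd) sq_group \<Rightarrow> ('a, 'b, 'c, 'd) sg_mor set" where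
  "sg_iso M N = {\<phi> \<in> sg_hom M N. \<exists>\<psi> \<in> sg_hom N M. sg_comp \<psi> \<phi> = sg_id M \<and> sg_comp \<phi> \<psi> = sg_id N}"

definition Z_nil :: "(int, int) sq_group" where
  "Z_nil = \<lparr>lvl_e = integer_group, lvl_ee = integer_group, Hmap = (\<lambda>n. n * (n - 1) div 2), Pmap = (\<lambda>_. 0)\<rparr>"

definition sg_of_ab :: "'a monoid \<Rightarrow> ('a, unit) sq_group" where
  "sg_of_ab A = \<lparr>lvl_e = A, lvl_ee = \<lparr>carrier = {()}, monoid.mult = (\<lambda>_ _. ()), one = ()\<rparr>,
     Hmap = (\<lambda>_. ()), Pmap = (\<lambda>_. \<one>\<^bsub>A\<^esub>)\<rparr>"


section \<open>Groups given by generators and relations\<close>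

text \<open>In a word, \<open>(True, g)\<close> is the generator \<open>g\<close> and \<open>(False, g)\<close> is its inverse.\<close>

type_synonym 'g word = "(bool \<times> 'g) list"

definition words :: "'g set \<Rightarrow> 'g word set" where
  "words S = lists (UNIV \<times> S)"

abbreviation gen :: "'g \<Rightarrow> bool \<times> 'g" where
  "gen g \<equiv> (True, g)"

abbreviation gen_inv :: "'g \<Rightarrow> bool \<times> 'g" where
  "gen_inv g \<equiv> (False, g)"

inductive word_eq :: "'g set \<Rightarrow> ('g word \<Rightarrow> 'g word \<Rightarrow> bool) \<Rightarrow> 'g word \<Rightarrow> 'g word \<Rightarrow> bool"
  for S R where
  rel: "\<lbrakk>R u v; u \<in> words S; v \<in> words S\<rbrakk> \<Longrightarrow> word_eq S R u v"
| cancel: "g \<in> S \<Longrightarrow> word_eq S R [(b, g), (\<not> b, g)] []"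
| append: "\<lbrakk>word_eq S R u u'; word_eq S R v v'\<rbrakk> \<Longrightarrow> word_eq S R (u @ v) (u' @ v')"
| refl: "u \<in> words S \<Longrightarrow> word_eq S R u u"
| sym: "word_eq S R u v \<Longrightarrow> word_eq S R v u"
| trans: "\<lbrakk>word_eq S R u v; word_eq S R v w\<rbrakk> \<Longrightarrow> word_eq S R u w"

definition word_class :: "'g set \<Rightarrow> ('g word \<Rightarrow> 'g word \<Rightarrow> bool) \<Rightarrow> 'g word \<Rightarrow> 'g word set" where
  "word_class S R u = {v. word_eq S R u v}"

lemma word_eq_words: "word_eq S R u v \<Longrightarrow> u \<in> words S \<and> v \<in> words S"
  by (induction rule: word_eq.induct) (auto simp: words_def)

lemma word_class_eq_iff:
  assumes "u \<in> words S"
  shows "word_class S R u = word_class S R v \<longleftrightarrow> word_eq S R u v"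
proof
  assume "word_class S R u = word_class S R v"
  moreover have "u \<in> word_class S R u"
    using assms by (simp add: word_class_def word_eq.refl)
  ultimately show "word_eq S R u v"
    by (auto simp: word_class_def intro: word_eq.sym)
next
  assume "word_eq S R u v"
  then show "word_class S R u = word_class S R v"
    by (auto simp: word_class_def intro: word_eq.sym word_eq.trans)
qed

definition presented_group :: "'g set \<Rightarrow> ('g word \<Rightarrow> 'g word \<Rightarrow> bool) \<Rightarrow> 'g word set monoid" where
  "presented_group S R =
     \<lparr>carrier = word_class S R ` words S,
      monoid.mult = (\<lambda>X Y. \<Union>u \<in> X. \<Union>v \<in> Y. word_class S R (u @ v)),
      one = word_class S R []\<rparr>"

lemma presented_group_mult:
  assumes "u \<in> words S" "v \<in> words S"
  shows "word_class S R u \<otimes>\<^bsub>presented_group S R\<^esub> word_class S R v = word_class S R (u @ v)"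
proof -
  have *: "word_class S R (u' @ v') = word_class S R (u @ v)"
    if "u' \<in> word_class S R u" "v' \<in> word_class S R v" for u' v'
  proof -
    have "word_eq S R (u @ v) (u' @ v')"
      using that by (simp add: word_class_def word_eq.append)
    moreover from this have "u @ v \<in> words S"
      using word_eq_words by blast
    ultimately show ?thesis
      using word_class_eq_iff by blast
  qed
  have u: "u \<in> word_class S R u" and v: "v \<in> word_class S R v"
    using assms by (simp_all add: word_class_def word_eq.refl)
  have "(\<Union>u' \<in> word_class S R u. \<Union>v' \<in> word_class S R v. word_class S R (u' @ v'))
      = (\<Union>u' \<in> word_class S R u. \<Union>v' \<in> word_class S R v. word_class S R (u @ v))"
    by (intro SUP_cong HOL.refl *)
  also have "\<dots> = word_class S R (u @ v)"
    using u v by auto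
  finally show ?thesis
    by (simp add: presented_group_def)
qed

lemma group_presented_group: "group (presented_group S R)"
proof (rule groupI)
  let ?G = "presented_group S R"
  have car: "carrier ?G = word_class S R ` words S" and one: "\<one>\<^bsub>?G\<^esub> = word_class S R []"
    by (simp_all add: presented_group_def)
  have app: "u @ v \<in> words S \<longleftrightarrow> u \<in> words S \<and> v \<in> words S" for u v
    by (auto simp: words_def)
  have nil: "[] \<in> words S"
    by (simp add: words_def)
  show "x \<otimes>\<^bsub>?G\<^esub> y \<in> carrier ?G" if "x \<in> carrier ?G" "y \<in> carrier ?G" for x y
    using that by (auto simp: car presented_group_mult app)
  show "\<one>\<^bsub>?G\<^esub> \<in> carrier ?G"
    by (simp add: car one nil)
  show "x \<otimes>\<^bsub>?G\<^esub> y \<otimes>\<^bsub>?G\<^esub> z = x \<otimes>\<^bsub>?G\<^esub> (y \<otimes>\<^bsub>?G\<^esub> z)"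
    if "x \<in> carrier ?G" "y \<in> carrier ?G" "z \<in> carrier ?G" for x y z
    using that by (auto simp: car presented_group_mult app)
  show "\<one>\<^bsub>?G\<^esub> \<otimes>\<^bsub>?G\<^esub> x = x" if "x \<in> carrier ?G" for x
    using that by (auto simp: car one presented_group_mult nil)
  have left_inv: "\<exists>v \<in> words S. word_eq S R (v @ u) []" if "u \<in> words S" for u
    using that
  proof (induction u)
    case Nil
    then show ?case by (intro bexI[of _ "[]"]) (auto intro: word_eq.refl simp: nil)
  next
    case (Cons p u)
    obtain b g where p: "p = (b, g)" by (cases p)
    have g: "g \<in> S" and u: "u \<in> words S"
      using Cons.prems by (auto simp: p words_def)
    obtain v where v: "v \<in> words S" "word_eq S R (v @ u) []"
      using Cons.IH u by blast
    have "word_eq S R [(\<not> b, g), (b, g)] []"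
      using word_eq.cancel[OF g, of R "\<not> b"] by simp
    then have "word_eq S R (v @ [(\<not> b, g), (b, g)] @ u) (v @ [] @ u)"
      using v u by (intro word_eq.append word_eq.refl) auto
    then have "word_eq S R ((v @ [(\<not> b, g)]) @ p # u) []"
      using v by (auto simp: p intro: word_eq.trans)
    then show ?case
      using v g by (intro bexI[of _ "v @ [(\<not> b, g)]"]) (auto simp: words_def)
  qed
  show "\<exists>y \<in> carrier ?G. y \<otimes>\<^bsub>?G\<^esub> x = \<one>\<^bsub>?G\<^esub>" if "x \<in> carrier ?G" for x
  proof -
    obtain u where u: "u \<in> words S" "x = word_class S R u"
      using \<open>x \<in> carrier ?G\<close> by (auto simp: car)
    then obtain v where v: "v \<in> words S" "word_eq S R (v @ u) []"
      using left_inv by blast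
    then have "word_class S R v \<otimes>\<^bsub>?G\<^esub> x = \<one>\<^bsub>?G\<^esub>"
      using u by (simp add: one presented_group_mult word_class_eq_iff app)
    then show ?thesis
      using v by (auto simp: car)
  qed
qed


section \<open>The tensor product of abelian groups\<close>

inductive ab_rel :: "'a monoid \<Rightarrow> 'b monoid \<Rightarrow> ('a \<times> 'b) word \<Rightarrow> ('a \<times> 'b) word \<Rightarrow> bool"
  for A B where
  left: "\<lbrakk>a \<in> carrier A; a' \<in> carrier A; b \<in> carrier B\<rbrakk>
    \<Longrightarrow> ab_rel A B [gen (a \<otimes>\<^bsub>A\<^esub> a', b)] [gen (a, b), gen (a', b)]"
| right: "\<lbrakk>a \<in> carrier A; b \<in> carrier B; b' \<in> carrier B\<rbrakk>
    \<Longrightarrow> ab_rel A B [gen (a, b \<otimes>\<^bsub>B\<^esub> b')] [gen (a, b), gen (a, b')]"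
| comm: "\<lbrakk>g \<in> carrier A \<times> carrier B; h \<in> carrier A \<times> carrier B\<rbrakk>
    \<Longrightarrow> ab_rel A B [gen g, gen h] [gen h, gen g]"

definition ab_tensor :: "'a monoid \<Rightarrow> 'b monoid \<Rightarrow> ('a \<times> 'b) word set monoid" where
  "ab_tensor A B = presented_group (carrier A \<times> carrier B) (ab_rel A B)"

definition ab_pure :: "'a monoid \<Rightarrow> 'b monoid \<Rightarrow> 'a \<Rightarrow> 'b \<Rightarrow> ('a \<times> 'b) word set" where
  "ab_pure A B a b = word_class (carrier A \<times> carrier B) (ab_rel A B) [gen (a, b)]"


section \<open>The tensor product of square groups\<close>

datatype ('a, 'b, 'c, 'd) sg_gen = Circ 'a 'c | Bar 'b 'd

definition sg_gens ::
  "('a, 'b) sq_group \<Rightarrow> ('c, 'd) sq_group \<Rightarrow> ('a, 'b, 'c, 'd) sg_gen set" where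
  "sg_gens M N = {Circ x y | x y. x \<in> carrier (lvl_e M) \<and> y \<in> carrier (lvl_e N)} \<union>
                 {Bar a b | a b. a \<in> carrier (lvl_ee M) \<and> b \<in> carrier (lvl_ee N)}"

inductive sg_rel ::
  "('a, 'b) sq_group \<Rightarrow> ('c, 'd) sq_group \<Rightarrow>
     ('a, 'b, 'c, 'd) sg_gen word \<Rightarrow> ('a, 'b, 'c, 'd) sg_gen word \<Rightarrow> bool"
  for M N where
  bar_left: "\<lbrakk>a \<in> carrier (lvl_ee M); a' \<in> carrier (lvl_ee M); b \<in> carrier (lvl_ee N)\<rbrakk>
    \<Longrightarrow> sg_rel M N [gen (Bar (a \<otimes>\<^bsub>lvl_ee M\<^esub> a') b)] [gen (Bar a b), gen (Bar a' b)]"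
| bar_right: "\<lbrakk>a \<in> carrier (lvl_ee M); b \<in> carrier (lvl_ee N); b' \<in> carrier (lvl_ee N)\<rbrakk>
    \<Longrightarrow> sg_rel M N [gen (Bar a (b \<otimes>\<^bsub>lvl_ee N\<^esub> b'))] [gen (Bar a b), gen (Bar a b')]"
| bar_central: "\<lbrakk>a \<in> carrier (lvl_ee M); b \<in> carrier (lvl_ee N); g \<in> sg_gens M N\<rbrakk>
    \<Longrightarrow> sg_rel M N [gen (Bar a b), gen g] [gen g, gen (Bar a b)]"
| circ_right: "\<lbrakk>x \<in> carrier (lvl_e M); y \<in> carrier (lvl_e N); y' \<in> carrier (lvl_e N)\<rbrakk>
    \<Longrightarrow> sg_rel M N [gen (Circ x (y \<otimes>\<^bsub>lvl_e N\<^esub> y'))] [gen (Circ x y), gen (Circ x y')]"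
| circ_left: "\<lbrakk>x \<in> carrier (lvl_e M); x' \<in> carrier (lvl_e M); y \<in> carrier (lvl_e N)\<rbrakk>
    \<Longrightarrow> sg_rel M N [gen (Circ (x \<otimes>\<^bsub>lvl_e M\<^esub> x') y)]
          [gen (Circ x y), gen (Circ x' y), gen (Bar (crossH M x' x) (Hmap N y))]"
| circ_P: "\<lbrakk>x \<in> carrier (lvl_e M); b \<in> carrier (lvl_ee N)\<rbrakk>
    \<Longrightarrow> sg_rel M N [gen (Circ x (Pmap N b))] [gen (Bar (crossH M x x) b)]"
| P_circ: "\<lbrakk>a \<in> carrier (lvl_ee M); y \<in> carrier (lvl_e N)\<rbrakk>
    \<Longrightarrow> sg_rel M N [gen (Circ (Pmap M a) y)] [gen (Bar a (Delta N y))]"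
| bar_T: "\<lbrakk>a \<in> carrier (lvl_ee M); b \<in> carrier (lvl_ee N)\<rbrakk>
    \<Longrightarrow> sg_rel M N [gen (Bar (Tmap M a) (Tmap N b))] [gen_inv (Bar a b)]"

definition tens_e ::
  "('a, 'b) sq_group \<Rightarrow> ('c, 'd) sq_group \<Rightarrow> ('a, 'b, 'c, 'd) sg_gen word set monoid" where
  "tens_e M N = presented_group (sg_gens M N) (sg_rel M N)"

definition tens_ee :: "('a, 'b) sq_group \<Rightarrow> ('c, 'd) sq_group \<Rightarrow> ('b \<times> 'd) word set monoid" where
  "tens_ee M N = ab_tensor (lvl_ee M) (lvl_ee N)"

definition circ ::
  "('a, 'b) sq_group \<Rightarrow> ('c, 'd) sq_group \<Rightarrow> 'a \<Rightarrow> 'c \<Rightarrow> ('a, 'b, 'c, 'd) sg_gen word set" where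
  "circ M N x y = word_class (sg_gens M N) (sg_rel M N) [gen (Circ x y)]"

definition bar ::
  "('a, 'b) sq_group \<Rightarrow> ('c, 'd) sq_group \<Rightarrow> 'b \<Rightarrow> 'd \<Rightarrow> ('a, 'b, 'c, 'd) sg_gen word set" where
  "bar M N a b = word_class (sg_gens M N) (sg_rel M N) [gen (Bar a b)]"

abbreviation pure_ee ::
  "('a, 'b) sq_group \<Rightarrow> ('c, 'd) sq_group \<Rightarrow> 'b \<Rightarrow> 'd \<Rightarrow> ('b \<times> 'd) word set" where
  "pure_ee M N \<equiv> ab_pure (lvl_ee M) (lvl_ee N)"

definition tens_P ::
  "('a, 'b) sq_group \<Rightarrow> ('c, 'd) sq_group \<Rightarrow> ('b \<times> 'd) word set \<Rightarrow> ('a, 'b, 'c, 'd) sg_gen word set"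
  where
  "tens_P M N = (THE p. p \<in> hom (tens_ee M N) (tens_e M N) \<inter> extensional (carrier (tens_ee M N)) \<and>
     (\<forall>a \<in> carrier (lvl_ee M). \<forall>b \<in> carrier (lvl_ee N). p (pure_ee M N a b) = bar M N a b))"

text \<open>The cross-effect of the map \<open>H\<close> of the tensor product is bilinear, so it is induced from the
  cokernel of \<open>P\<close> (whose image is generated by the elements \<open>bar M N a b\<close>) as soon as it vanishes
  on these elements, and it is then determined by its values on the elements \<open>circ M N x y\<close>.\<close>

definition tens_H ::
  "('a, 'b) sq_group \<Rightarrow> ('c, 'd) sq_group \<Rightarrow> ('a, 'b, 'c, 'd) sg_gen word set \<Rightarrow> ('b \<times> 'd) word set"
  where
  "tens_H M N = (THE h. quadratic (tens_e M N) (tens_ee M N) h \<and>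
     h \<in> extensional (carrier (tens_e M N)) \<and>
     (\<forall>x \<in> carrier (lvl_e M). \<forall>y \<in> carrier (lvl_e N).
      \<forall>x' \<in> carrier (lvl_e M). \<forall>y' \<in> carrier (lvl_e N).
        cross_effect (tens_e M N) (tens_ee M N) h (circ M N x y) (circ M N x' y')
          = pure_ee M N (crossH M x x') (crossH N y y')) \<and>
     (\<forall>u \<in> carrier (tens_e M N). \<forall>a \<in> carrier (lvl_ee M). \<forall>b \<in> carrier (lvl_ee N).
        cross_effect (tens_e M N) (tens_ee M N) h u (bar M N a b) = \<one>\<^bsub>tens_ee M N\<^esub> \<and>
        cross_effect (tens_e M N) (tens_ee M N) h (bar M N a b) u = \<one>\<^bsub>tens_ee M N\<^esub>) \<and>
     (\<forall>x \<in> carrier (lvl_e M). \<forall>y \<in> carrier (lvl_e N).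
        h (circ M N x y) = pure_ee M N (crossH M x x) (Hmap N y)
                             \<otimes>\<^bsub>tens_ee M N\<^esub> pure_ee M N (Hmap M x) (Delta N y)) \<and>
     (\<forall>a \<in> carrier (lvl_ee M). \<forall>b \<in> carrier (lvl_ee N).
        h (bar M N a b) = pure_ee M N a b
                            \<otimes>\<^bsub>tens_ee M N\<^esub> inv\<^bsub>tens_ee M N\<^esub> pure_ee M N (Tmap M a) (Tmap N b)))"

definition sg_tensor ::
  "('a, 'b) sq_group \<Rightarrow> ('c, 'd) sq_group \<Rightarrow>
     (('a, 'b, 'c, 'd) sg_gen word set, ('b \<times> 'd) word set) sq_group" where
  "sg_tensor M N = \<lparr>lvl_e = tens_e M N, lvl_ee = tens_ee M N, Hmap = tens_H M N, Pmap = tens_P M N\<rparr>"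

definition sg_tensor_map ::
  "('a, 'b, 'a1, 'b1) sg_mor \<Rightarrow> ('c, 'd, 'c1, 'd1) sg_mor \<Rightarrow>
     (('a, 'b, 'c, 'd) sg_gen word set, ('b \<times> 'd) word set,
      ('a1, 'b1, 'c1, 'd1) sg_gen word set, ('b1 \<times> 'd1) word set) sg_mor" where
  "sg_tensor_map f g =
     (let M = src f; N = src g; M' = tgt f; N' = tgt g in
      THE \<phi>. \<phi> \<in> sg_hom (sg_tensor M N) (sg_tensor M' N') \<and>
        (\<forall>x \<in> carrier (lvl_e M). \<forall>y \<in> carrier (lvl_e N).
           map_e \<phi> (circ M N x y) = circ M' N' (map_e f x) (map_e g y)) \<and>
        (\<forall>a \<in> carrier (lvl_ee M). \<forall>b \<in> carrier (lvl_ee N).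
           map_e \<phi> (bar M N a b) = bar M' N' (map_ee f a) (map_ee g b) \<and>
           map_ee \<phi> (pure_ee M N a b) = pure_ee M' N' (map_ee f a) (map_ee g b)))"


section \<open>The category of square groups\<close>

text \<open>The elements of \<open>sg_tensor M N\<close> have another type than those of \<open>M\<close> and \<open>N\<close>. To have a single
  category closed under tensor products, square groups are taken with elements in the type
  \<open>'x elt\<close>, for an arbitrary type \<open>'x\<close>: it contains \<open>'x\<close>, the integers, and the words in generators
  built from its own elements. Structures on other types are transported to it along injections; a
  class of words is replaced by a chosen word in it. The injections only matter up to
  isomorphism.\<close>

datatype 'x elt =
    Atom 'x
  | Num int
  | Word_e "('x elt, 'x elt, 'x elt, 'x elt) sg_gen word"
  | Word_ee "('x elt \<times> 'x elt) word"

definition transport_group :: "('a \<Rightarrow> 'c) \<Rightarrow> 'a monoid \<Rightarrow> 'c monoid" where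
  "transport_group f G =
     \<lparr>carrier = f ` carrier G,
      monoid.mult = (\<lambda>x y. f (inv_into (carrier G) f x \<otimes>\<^bsub>G\<^esub> inv_into (carrier G) f y)),
      one = f \<one>\<^bsub>G\<^esub>\<rparr>"

definition transport_sg ::
  "('a \<Rightarrow> 'c) \<Rightarrow> ('b \<Rightarrow> 'd) \<Rightarrow> ('a, 'b) sq_group \<Rightarrow> ('c, 'd) sq_group" where
  "transport_sg f g M =
     \<lparr>lvl_e = transport_group f (lvl_e M), lvl_ee = transport_group g (lvl_ee M),
      Hmap = (\<lambda>x. g (Hmap M (inv_into (carrier (lvl_e M)) f x))),
      Pmap = (\<lambda>a. f (Pmap M (inv_into (carrier (lvl_ee M)) g a)))\<rparr>"

definition transport_mor ::
  "('a \<Rightarrow> 'c) \<Rightarrow> ('b \<Rightarrow> 'd) \<Rightarrow> ('a1 \<Rightarrow> 'c1) \<Rightarrow> ('b1 \<Rightarrow> 'd1) \<Rightarrow>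
     ('a, 'b, 'a1, 'b1) sg_mor \<Rightarrow> ('c, 'd, 'c1, 'd1) sg_mor" where
  "transport_mor f g f' g' \<phi> =
     \<lparr>src = transport_sg f g (src \<phi>), tgt = transport_sg f' g' (tgt \<phi>),
      map_e = (\<lambda>x \<in> f ` carrier (lvl_e (src \<phi>)).
                 f' (map_e \<phi> (inv_into (carrier (lvl_e (src \<phi>))) f x))),
      map_ee = (\<lambda>a \<in> g ` carrier (lvl_ee (src \<phi>)).
                 g' (map_ee \<phi> (inv_into (carrier (lvl_ee (src \<phi>))) g a)))\<rparr>"

definition code_e :: "('x elt, 'x elt, 'x elt, 'x elt) sg_gen word set \<Rightarrow> 'x elt" where
  "code_e c = Word_e (SOME w. w \<in> c)"

definition code_ee :: "('x elt \<times> 'x elt) word set \<Rightarrow> 'x elt" where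
  "code_ee c = Word_ee (SOME w. w \<in> c)"

lemma some_word_inject:
  assumes c: "c \<in> carrier (presented_group S R)" and c': "c' \<in> carrier (presented_group S R)"
    and eq: "(SOME w. w \<in> c) = (SOME w. w \<in> c')"
  shows "c = c'"
proof -
  have *: "d = word_class S R (SOME w. w \<in> d)"
    if d: "d \<in> carrier (presented_group S R)" for d
  proof -
    obtain u where u: "u \<in> words S" "d = word_class S R u"
      using d by (auto simp: presented_group_def)
    define w where "w = (SOME w. w \<in> d)"
    have "u \<in> d"
      using u by (simp add: word_class_def word_eq.refl)
    then have "w \<in> d"
      unfolding w_def by (rule someI)
    then have "d = word_class S R w"
      using u word_class_eq_iff[of u S R w] by (simp add: word_class_def)
    then show ?thesis
      unfolding w_def .
  qed
  show ?thesis
    using *[OF c] *[OF c'] eq by argo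
qed

lemma inj_on_code:
  "inj_on code_e (carrier (presented_group S R))"
  "inj_on code_ee (carrier (presented_group S' R'))"
  by (auto simp: inj_on_def code_e_def code_ee_def dest: some_word_inject)

text \<open>Transport along injections does not change the isomorphism class.\<close>

lemma transport_sg_iso:
  assumes K: "square_group K"
    and f: "inj_on f (carrier (lvl_e K))" and g: "inj_on g (carrier (lvl_ee K))"
  shows "\<lparr>src = K, tgt = transport_sg f g K,
           map_e = restrict f (carrier (lvl_e K)), map_ee = restrict g (carrier (lvl_ee K))\<rparr>
         \<in> sg_iso K (transport_sg f g K)" (is "?\<phi> \<in> _")
proof -
  let ?L = "transport_sg f g K"
  let ?f' = "inv_into (carrier (lvl_e K)) f" and ?g' = "inv_into (carrier (lvl_ee K)) g"
  let ?\<psi> = "\<lparr>src = ?L, tgt = K,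
     map_e = restrict ?f' (f ` carrier (lvl_e K)), map_ee = restrict ?g' (g ` carrier (lvl_ee K))\<rparr>"
  interpret E: group "lvl_e K" using K by (simp add: square_group_def)
  interpret EE: comm_group "lvl_ee K" using K by (simp add: square_group_def)
  have H: "Hmap K x \<in> carrier (lvl_ee K)" if "x \<in> carrier (lvl_e K)" for x
    using K that by (auto simp: square_group_def quadratic_def)
  have P: "Pmap K a \<in> carrier (lvl_e K)" if "a \<in> carrier (lvl_ee K)" for a
    using K that by (auto simp: square_group_def hom_def)
  have L: "carrier (lvl_e ?L) = f ` carrier (lvl_e K)"
    "carrier (lvl_ee ?L) = g ` carrier (lvl_ee K)"
    by (simp_all add: transport_sg_def transport_group_def)
  note simps = transport_sg_def transport_group_def H P inv_into_f_f[OF f] inv_into_f_f[OF g]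
  have 1: "?\<phi> \<in> sg_hom K ?L"
    by (auto simp: sg_hom_def hom_def simps)
  have 2: "?\<psi> \<in> sg_hom ?L K"
    by (auto simp: sg_hom_def hom_def simps)
  have 3: "sg_comp ?\<psi> ?\<phi> = sg_id K"
    by (simp add: sg_comp_def sg_id_def compose_def inv_into_f_f[OF f] inv_into_f_f[OF g]
        cong: restrict_cong)
  have 4: "sg_comp ?\<phi> ?\<psi> = sg_id ?L"
    by (simp add: sg_comp_def sg_id_def compose_def L f_inv_into_f inv_into_into
        cong: restrict_cong)
  show ?thesis
    unfolding sg_iso_def by (intro CollectI conjI bexI[of _ ?\<psi>] 1 2 3 4)
qed

type_synonym 'x sgU = "('x elt, 'x elt) sq_group"
type_synonym 'x morU = "('x elt, 'x elt, 'x elt, 'x elt) sg_mor"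

definition SG :: "('x sgU, 'x morU) cat" where
  "SG = \<lparr>Obj = {M. square_group M}, Hom = sg_hom, Id = sg_id, Comp = sg_comp\<rparr>"

definition SG_tensor :: "'x sgU \<Rightarrow> 'x sgU \<Rightarrow> 'x sgU" where
  "SG_tensor M N = transport_sg code_e code_ee (sg_tensor M N)"

corollary SG_tensor_iso:
  assumes "square_group (sg_tensor M N)"
  shows "\<exists>\<phi>. \<phi> \<in> sg_iso (sg_tensor M N) (SG_tensor M N)"
proof -
  have "inj_on code_e (carrier (lvl_e (sg_tensor M N)))"
    "inj_on code_ee (carrier (lvl_ee (sg_tensor M N)))"
    by (simp_all add: sg_tensor_def tens_e_def tens_ee_def ab_tensor_def inj_on_code)
  from transport_sg_iso[OF assms this] show ?thesis
    unfolding SG_tensor_def by (rule exI)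
qed

definition SG_tensor_map :: "'x morU \<Rightarrow> 'x morU \<Rightarrow> 'x morU" where
  "SG_tensor_map f g = transport_mor code_e code_ee code_e code_ee (sg_tensor_map f g)"

definition SG_unit :: "'x sgU" where
  "SG_unit = transport_sg Num Num Z_nil"

end

theory Submission
  imports Defs
begin

text \<open>A quadratic map out of a group given by generators and relations can be prescribed by its values
  and its cross-effects on the generators, provided that both respect the relations. This yields \<open>H\<close> on
  the tensor product, where \<open>T (a \<otimes> b) = - T a \<otimes> T b\<close> and \<open>\<Delta> (x \<circledcirc> y) = \<Delta> x \<otimes> \<Delta> y\<close>. Morphisms out
  of \<open>M \<circledcirc> N\<close> are the pairs of maps on \<open>M\<^sub>e \<times> N\<^sub>e\<close> and \<open>M\<^sub>e\<^sub>e \<times> N\<^sub>e\<^sub>e\<close> that satisfy the equations \<open>sg_bimor\<close>.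
  Two morphisms agree as soon as they agree on elements that generate the \<open>ee\<close>-level and that generate,
  with the image of \<open>P\<close>, the \<open>e\<close>-level; hence every coherence diagram only has to be checked on elements
  such as \<open>(x \<circledcirc> y) \<circledcirc> z\<close>. There the associativity constraint is the evident one, the symmetry is
  \<open>x \<circledcirc> y \<mapsto> y \<circledcirc> x + P (T (H y) \<otimes> H x)\<close>, and the left unit constraint is
  \<open>n \<circledcirc> y \<mapsto> n y + binomial n 2 P (H y)\<close>, that is, \<open>1 \<circledcirc> y \<mapsto> y\<close>. For abelian groups all \<open>a \<otimes> b\<close> vanish
  and the elements \<open>x \<circledcirc> y\<close> commute, so the relations become those of the usual tensor product.\<close>

section \<open>Groups given by generators and relations\<close>

text \<open>The two factors play different roles: \<open>x \<circledcirc> y\<close> is additive in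
  \<open>y\<close> but only quadratic in \<open>x\<close>, and the \<open>e\<close>-level is not
  commutative. Formulas that are evident for abelian groups therefore hold only up to terms in the
  image of \<open>P\<close>, and most of the work is to find these terms and to see them cancel.
  Three facts make this manageable: the image of \<open>P\<close> is central, so the terms can be
  collected; cross-effects and \<open>Delta\<close> vanish on it, so they do not breed further
  terms; and \<open>P T = P\<close> gives
  \<open>P (a \<otimes> b) = - P (T a \<otimes> T b)\<close>, by which they cancel. A second
  obstacle is that \<open>tens_P\<close>, \<open>tens_H\<close> and \<open>sg_tensor_map\<close> are
  definite descriptions: nothing is known about them before existence and uniqueness are proved, and
  for \<open>H\<close> this means controlling a quadratic map on words with inverse letters. Once
  the universal property, the generators and the action on morphisms have been transported to
  \<open>SG_tensor\<close>, neither words nor their codes are opened again.\<close>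

lemma hom_eq_on_generate:
  assumes G: "group G" and H: "group H" and f: "f \<in> hom G H" and g: "g \<in> hom G H"
    and S: "S \<subseteq> carrier G" and eq: "\<And>x. x \<in> S \<Longrightarrow> f x = g x"
    and x: "x \<in> generate G S"
  shows "f x = g x"
proof -
  interpret F: group_hom G H f using G H f by (simp add: group_hom_def group_hom_axioms_def)
  interpret K: group_hom G H g using G H g by (simp add: group_hom_def group_hom_axioms_def)
  show ?thesis
    using x
  proof (induction rule: generate.induct)
    case (eng h1 h2)
    then show ?case using F.G.generate_in_carrier[OF S] by simp
  qed (use S eq in auto)
qed

lemma generate_eq_carrierI:
  assumes "group G" "S \<subseteq> carrier G" "carrier G \<subseteq> generate G S"
  shows "generate G S = carrier G"
  using assms group.generate_incl by blast

lemma generate_subset_carrier: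
  assumes "group G" "S \<subseteq> generate G S'" "S' \<subseteq> carrier G" "generate G S = carrier G"
  shows "generate G S' = carrier G"
proof -
  interpret group G by fact
  have "generate G S \<subseteq> generate G S'"
    using assms generate_is_subgroup by (intro generate_subgroup_incl) auto
  then show ?thesis using assms generate_incl by blast
qed

section \<open>Evaluation of words and maps out of presented groups\<close>

definition letter_val :: "('a, 'm) monoid_scheme \<Rightarrow> ('g \<Rightarrow> 'a) \<Rightarrow> bool \<times> 'g \<Rightarrow> 'a" where
  "letter_val G f l = (if fst l then f (snd l) else inv\<^bsub>G\<^esub> f (snd l))"

definition word_val :: "('a, 'm) monoid_scheme \<Rightarrow> ('g \<Rightarrow> 'a) \<Rightarrow> 'g word \<Rightarrow> 'a" where
  "word_val G f w = foldr (\<lambda>l z. letter_val G f l \<otimes>\<^bsub>G\<^esub> z) w \<one>\<^bsub>G\<^esub>"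

lemma letter_val_simps [simp]:
  "letter_val G f (True, g) = f g"
  "letter_val G f (False, g) = inv\<^bsub>G\<^esub> f g"
  by (simp_all add: letter_val_def)

lemma word_val_simps [simp]:
  "word_val G f [] = \<one>\<^bsub>G\<^esub>"
  "word_val G f (l # w) = letter_val G f l \<otimes>\<^bsub>G\<^esub> word_val G f w"
  by (simp_all add: word_val_def)

lemma words_simps [simp]:
  "[] \<in> words S"
  "(b, g) # w \<in> words S \<longleftrightarrow> g \<in> S \<and> w \<in> words S"
  "u @ v \<in> words S \<longleftrightarrow> u \<in> words S \<and> v \<in> words S"
  by (auto simp: words_def)

lemma words_Cons: "l # w \<in> words S \<longleftrightarrow> snd l \<in> S \<and> w \<in> words S"
  by (cases l) simp

context group
begin

lemma letter_val_closed: "f \<in> S \<rightarrow> carrier G \<Longrightarrow> snd l \<in> S \<Longrightarrow> letter_val G f l \<in> carrier G"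
  by (auto simp: letter_val_def)

lemma word_val_closed: "f \<in> S \<rightarrow> carrier G \<Longrightarrow> w \<in> words S \<Longrightarrow> word_val G f w \<in> carrier G"
  by (induction w) (auto simp: words_Cons letter_val_closed)

lemma word_val_append:
  "f \<in> S \<rightarrow> carrier G \<Longrightarrow> u \<in> words S \<Longrightarrow> v \<in> words S \<Longrightarrow>
    word_val G f (u @ v) = word_val G f u \<otimes> word_val G f v"
  by (induction u) (simp_all add: words_Cons m_assoc letter_val_closed[of f S] word_val_closed[of f S])

lemma word_val_word_eq:
  assumes f: "f \<in> S \<rightarrow> carrier G"
    and rel: "\<And>u v. R u v \<Longrightarrow> u \<in> words S \<Longrightarrow> v \<in> words S \<Longrightarrow> word_val G f u = word_val G f v"
    and uv: "word_eq S R u v"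
  shows "word_val G f u = word_val G f v"
  using uv
proof (induction rule: word_eq.induct)
  case (cancel g b)
  then have "f g \<in> carrier G" using f by auto
  then show ?case by (cases b) auto
next
  case (append u u' v v')
  then show ?case
    using word_eq_words[of S R u u'] word_eq_words[of S R v v'] by (simp add: word_val_append[OF f])
qed (simp_all add: rel)

end

text \<open>A class is evaluated at a chosen representative. Only invariance of \<open>F\<close> is
  asked, so the same statement serves homomorphisms, quadratic maps and, with functions as values,
  cross-effects.\<close>

lemma presented_group_extend:
  assumes inv: "\<And>u v. word_eq S R u v \<Longrightarrow> F u = F v"
  shows "\<exists>h. \<forall>w \<in> words S. h (word_class S R w) = F w"
proof (intro exI ballI)
  fix w assume w: "w \<in> words S"
  have "w \<in> word_class S R w" using w by (simp add: word_class_def word_eq.refl)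
  then have "(SOME v. v \<in> word_class S R w) \<in> word_class S R w" by (rule someI)
  then show "F (SOME v. v \<in> word_class S R w) = F w"
    using inv[of w "SOME v. v \<in> word_class S R w"] by (simp add: word_class_def)
qed

lemma carrier_presented_group: "carrier (presented_group S R) = word_class S R ` words S"
  by (simp add: presented_group_def)

lemma one_presented_group: "\<one>\<^bsub>presented_group S R\<^esub> = word_class S R []"
  by (simp add: presented_group_def)

abbreviation gen_class :: "'g set \<Rightarrow> ('g word \<Rightarrow> 'g word \<Rightarrow> bool) \<Rightarrow> 'g \<Rightarrow> 'g word set" where
  "gen_class S R g \<equiv> word_class S R [gen g]"

lemma gen_class_closed [simp]: "g \<in> S \<Longrightarrow> gen_class S R g \<in> carrier (presented_group S R)"
  by (auto simp: carrier_presented_group)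

lemma word_class_gen_inv:
  assumes "g \<in> S"
  shows "word_class S R [gen_inv g] = inv\<^bsub>presented_group S R\<^esub> gen_class S R g"
proof -
  interpret group "presented_group S R" by (rule group_presented_group)
  have "word_class S R [gen_inv g] \<otimes>\<^bsub>presented_group S R\<^esub> gen_class S R g = \<one>\<^bsub>presented_group S R\<^esub>"
    using assms word_eq.cancel[of g S R False]
    by (simp add: presented_group_mult one_presented_group word_class_eq_iff)
  then show ?thesis
    using assms by (intro inv_equality[symmetric]) (auto simp: carrier_presented_group)
qed

lemma word_class_eq_word_val:
  "w \<in> words S \<Longrightarrow> word_class S R w = word_val (presented_group S R) (gen_class S R) w"
proof (induction w)
  case Nil
  show ?case by (simp add: one_presented_group)
next
  case (Cons l w)
  have "word_class S R (l # w) = word_class S R [l] \<otimes>\<^bsub>presented_group S R\<^esub> word_class S R w"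
    using Cons.prems by (subst presented_group_mult) (auto simp: words_Cons)
  moreover have "word_class S R [l] = letter_val (presented_group S R) (gen_class S R) l"
    using Cons.prems by (cases l; cases "fst l") (auto simp: words_Cons word_class_gen_inv)
  ultimately show ?case using Cons by (simp add: words_Cons)
qed

text \<open>A class of words is the product of its letters (\<open>word_class_eq_word_val\<close>),
  so a relation between words becomes an equation between elements. The relations of both tensor
  products are read off in this form.\<close>

lemma presented_group_rel:
  assumes "R u v" "u \<in> words S" "v \<in> words S"
  shows "word_val (presented_group S R) (gen_class S R) u = word_val (presented_group S R) (gen_class S R) v"
  using assms word_eq.rel[of R u v S] word_class_eq_iff[of u S R v] by (simp flip: word_class_eq_word_val)

lemma presented_group_generate:
  "generate (presented_group S R) (gen_class S R ` S) = carrier (presented_group S R)"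
proof (rule generate_eq_carrierI)
  show gr: "group (presented_group S R)" by (rule group_presented_group)
  show "gen_class S R ` S \<subseteq> carrier (presented_group S R)" by auto
  have "word_val (presented_group S R) (gen_class S R) w \<in> generate (presented_group S R) (gen_class S R ` S)"
    if "w \<in> words S" for w
    using that
  proof (induction w)
    case (Cons l w)
    then have "letter_val (presented_group S R) (gen_class S R) l \<in> generate (presented_group S R) (gen_class S R ` S)"
      by (cases l; cases "fst l") (auto simp: words_Cons intro: generate.incl generate.inv)
    then show ?case using Cons by (auto simp: words_Cons intro: generate.eng)
  qed (simp add: generate.one)
  then have "word_class S R w \<in> generate (presented_group S R) (gen_class S R ` S)" if "w \<in> words S" for w
    using that word_class_eq_word_val[of w S R] by metis
  then show "carrier (presented_group S R) \<subseteq> generate (presented_group S R) (gen_class S R ` S)"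
    by (auto simp: carrier_presented_group)
qed

text \<open>This is von Dyck's theorem: evaluation of words descends to classes because it respects
  the relations.\<close>

lemma presented_group_hom:
  assumes G: "group G" and f: "f \<in> S \<rightarrow> carrier G"
    and rel: "\<And>u v. R u v \<Longrightarrow> u \<in> words S \<Longrightarrow> v \<in> words S \<Longrightarrow> word_val G f u = word_val G f v"
  shows "\<exists>h \<in> hom (presented_group S R) G. \<forall>g \<in> S. h (gen_class S R g) = f g"
proof -
  interpret group G by fact
  obtain h where h: "\<And>w. w \<in> words S \<Longrightarrow> h (word_class S R w) = word_val G f w"
    using presented_group_extend[of S R "word_val G f"] word_val_word_eq[OF f rel] by metis
  have "h \<in> hom (presented_group S R) G"
    using f by (auto simp: hom_def carrier_presented_group presented_group_mult h word_val_append[OF f] word_val_closed[OF f])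
  moreover have "h (gen_class S R g) = f g" if "g \<in> S" for g
  proof -
    have "f g \<in> carrier G" using f that by auto
    then show ?thesis using that by (simp add: h)
  qed
  ultimately show ?thesis by blast
qed

lemma (in comm_group) mult_inv_cancel:
  assumes "a \<in> carrier G" "b \<in> carrier G" "c \<in> carrier G"
  shows "a \<otimes> b \<otimes> (c \<otimes> inv a \<otimes> inv b) = c" "a \<otimes> b \<otimes> c \<otimes> inv a \<otimes> inv b = c"
proof -
  have "a \<otimes> b \<otimes> (c \<otimes> inv a \<otimes> inv b) = (a \<otimes> inv a) \<otimes> ((b \<otimes> inv b) \<otimes> c)"
    using assms by (simp add: m_ac del: r_inv l_inv)
  then show *: "a \<otimes> b \<otimes> (c \<otimes> inv a \<otimes> inv b) = c" using assms by simp
  have "a \<otimes> b \<otimes> c \<otimes> inv a \<otimes> inv b = a \<otimes> b \<otimes> (c \<otimes> inv a \<otimes> inv b)"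
    using assms by (simp add: m_assoc)
  then show "a \<otimes> b \<otimes> c \<otimes> inv a \<otimes> inv b = c" using * by simp
qed

section \<open>Quadratic maps and their cross-effects\<close>

lemma quadratic_mult:
  assumes "quadratic G A q" "group G" "comm_group A" "x \<in> carrier G" "y \<in> carrier G"
  shows "q (x \<otimes>\<^bsub>G\<^esub> y) = q x \<otimes>\<^bsub>A\<^esub> q y \<otimes>\<^bsub>A\<^esub> cross_effect G A q x y"
proof -
  interpret G: group G by fact
  interpret A: comm_group A by fact
  have "q x \<in> carrier A" "q y \<in> carrier A" "q (x \<otimes>\<^bsub>G\<^esub> y) \<in> carrier A"
    using assms by (auto simp: quadratic_def)
  then show ?thesis
    unfolding cross_effect_def
    by (simp add: A.mult_inv_cancel)
qed

lemma cross_effect_eqI: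
  assumes A: "comm_group A" and "q x \<in> carrier A" "q y \<in> carrier A" "c \<in> carrier A"
    and "q (x \<otimes>\<^bsub>G\<^esub> y) = q x \<otimes>\<^bsub>A\<^esub> q y \<otimes>\<^bsub>A\<^esub> c"
  shows "cross_effect G A q x y = c"
proof -
  interpret A: comm_group A by fact
  show ?thesis
    unfolding cross_effect_def using assms(2-)
    by (simp add: A.mult_inv_cancel)
qed

text \<open>The cross-effect is determined by the deviation from additivity, so a biadditive
  \<open>c\<close> that accounts for this deviation is the cross-effect. This avoids computing with
  the inverses in \<open>cross_effect\<close>.\<close>

lemma quadraticI:
  assumes A: "comm_group A" and q: "\<And>x. x \<in> carrier G \<Longrightarrow> q x \<in> carrier A"
    and c1: "\<And>y. y \<in> carrier G \<Longrightarrow> (\<lambda>x. c x y) \<in> hom G A"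
    and c2: "\<And>x. x \<in> carrier G \<Longrightarrow> c x \<in> hom G A"
    and "group G"
    and eq: "\<And>x y. x \<in> carrier G \<Longrightarrow> y \<in> carrier G \<Longrightarrow> q (x \<otimes>\<^bsub>G\<^esub> y) = q x \<otimes>\<^bsub>A\<^esub> q y \<otimes>\<^bsub>A\<^esub> c x y"
  shows "quadratic G A q"
    and "\<And>x y. x \<in> carrier G \<Longrightarrow> y \<in> carrier G \<Longrightarrow> cross_effect G A q x y = c x y"
proof -
  interpret G: group G by fact
  show ce: "cross_effect G A q x y = c x y" if "x \<in> carrier G" "y \<in> carrier G" for x y
    using that c2 by (intro cross_effect_eqI[where c = "c x y", OF A q q _ eq]) (auto simp: hom_def)
  have "(\<lambda>x. cross_effect G A q x y) \<in> hom G A" if "y \<in> carrier G" for y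
    using that by (intro G.hom_eq[OF c1[OF that]]) (simp add: ce)
  moreover have "(\<lambda>y. cross_effect G A q x y) \<in> hom G A" if "x \<in> carrier G" for x
    using that by (intro G.hom_eq[OF c2[OF that]]) (simp add: ce)
  ultimately show "quadratic G A q" using q by (auto simp: quadratic_def)
qed

lemma (in group) word_val_cong:
  "(\<And>g. g \<in> S \<Longrightarrow> f g = f' g) \<Longrightarrow> w \<in> words S \<Longrightarrow> word_val G f w = word_val G f' w"
  by (induction w) (auto simp: words_Cons letter_val_def)

lemma (in comm_group) word_val_mult:
  "f \<in> S \<rightarrow> carrier G \<Longrightarrow> f' \<in> S \<rightarrow> carrier G \<Longrightarrow> w \<in> words S \<Longrightarrow>
    word_val G (\<lambda>g. f g \<otimes> f' g) w = word_val G f w \<otimes> word_val G f' w"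
proof (induction w)
  case (Cons l w)
  have "letter_val G (\<lambda>g. f g \<otimes> f' g) l = letter_val G f l \<otimes> letter_val G f' l"
    using Cons.prems by (cases l; cases "fst l") (auto simp: words_Cons Pi_iff inv_mult)
  then show ?case
    using Cons word_val_closed[of f S w] word_val_closed[of f' S w]
      letter_val_closed[of f S l] letter_val_closed[of f' S l]
    by (simp add: words_Cons m_ac)
qed auto

lemma (in comm_group) word_val_one: "word_val G (\<lambda>g. \<one>) w = \<one>"
  by (induction w) (auto simp: letter_val_def)

text \<open>The value on a word of the quadratic map with values \<open>q\<close> and cross-effects \<open>b\<close> on the generators.\<close>

primrec quad_val :: "'a monoid \<Rightarrow> ('g \<Rightarrow> 'a) \<Rightarrow> ('g \<Rightarrow> 'g \<Rightarrow> 'a) \<Rightarrow> 'g word \<Rightarrow> 'a" where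
  "quad_val A q b [] = \<one>\<^bsub>A\<^esub>"
| "quad_val A q b (l # w) =
    (if fst l then q (snd l) \<otimes>\<^bsub>A\<^esub> quad_val A q b w \<otimes>\<^bsub>A\<^esub> word_val A (b (snd l)) w
     else inv\<^bsub>A\<^esub> q (snd l) \<otimes>\<^bsub>A\<^esub> b (snd l) (snd l) \<otimes>\<^bsub>A\<^esub> quad_val A q b w \<otimes>\<^bsub>A\<^esub> inv\<^bsub>A\<^esub> word_val A (b (snd l)) w)"

text \<open>On words, \<open>B\<close> is the biadditive extension of \<open>b\<close>, and
  \<open>Q\<close> is built so that \<open>Q (u @ v) = Q u + Q v + B u v\<close>. The congruence is
  generated by relations placed inside longer words; this formula reduces the invariance of
  \<open>Q\<close> to the relations themselves, once \<open>B\<close> is invariant in either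
  argument.\<close>

lemma presented_group_quadratic:
  assumes A: "comm_group A" and q: "q \<in> S \<rightarrow> carrier A"
    and b: "\<And>g g'. g \<in> S \<Longrightarrow> g' \<in> S \<Longrightarrow> b g g' \<in> carrier A"
    and b1: "\<And>u v g. R u v \<Longrightarrow> u \<in> words S \<Longrightarrow> v \<in> words S \<Longrightarrow> g \<in> S \<Longrightarrow>
       word_val A (\<lambda>g'. b g' g) u = word_val A (\<lambda>g'. b g' g) v"
    and b2: "\<And>u v g. R u v \<Longrightarrow> u \<in> words S \<Longrightarrow> v \<in> words S \<Longrightarrow> g \<in> S \<Longrightarrow>
       word_val A (b g) u = word_val A (b g) v"
    and rel: "\<And>u v. R u v \<Longrightarrow> u \<in> words S \<Longrightarrow> v \<in> words S \<Longrightarrow> quad_val A q b u = quad_val A q b v"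
  shows "\<exists>h. quadratic (presented_group S R) A h \<and>
    (\<forall>g \<in> S. h (gen_class S R g) = q g) \<and>
    (\<forall>g \<in> S. \<forall>g' \<in> S. cross_effect (presented_group S R) A h (gen_class S R g) (gen_class S R g') = b g g')"
proof -
  interpret A: comm_group A by fact
  interpret P: group "presented_group S R" by (rule group_presented_group)
  define B where "B = (\<lambda>u v. word_val A (\<lambda>g. word_val A (b g) v) u)"
  define Q where "Q = quad_val A q b"
  have Q_Nil: "Q [] = \<one>\<^bsub>A\<^esub>"
    and Q_gen: "Q (gen g # w) = q g \<otimes>\<^bsub>A\<^esub> Q w \<otimes>\<^bsub>A\<^esub> word_val A (b g) w"
    and Q_inv: "Q (gen_inv g # w) = inv\<^bsub>A\<^esub> q g \<otimes>\<^bsub>A\<^esub> b g g \<otimes>\<^bsub>A\<^esub> Q w \<otimes>\<^bsub>A\<^esub> inv\<^bsub>A\<^esub> word_val A (b g) w" for g w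
    by (simp_all add: Q_def)
  have bG: "b g \<in> S \<rightarrow> carrier A" if "g \<in> S" for g using b that by auto
  have bw: "(\<lambda>g. word_val A (b g) v) \<in> S \<rightarrow> carrier A" if "v \<in> words S" for v
    using bG that by (auto intro: A.word_val_closed)
  have B_closed [simp]: "B u v \<in> carrier A" if "u \<in> words S" "v \<in> words S" for u v
    using that bw unfolding B_def by (simp add: A.word_val_closed[of _ S])
  have B_app1: "B (u @ u') v = B u v \<otimes>\<^bsub>A\<^esub> B u' v" if "u \<in> words S" "u' \<in> words S" "v \<in> words S" for u u' v
    using that bw unfolding B_def by (simp add: A.word_val_append[of _ S])
  have B_app2: "B u (v @ v') = B u v \<otimes>\<^bsub>A\<^esub> B u v'" if "u \<in> words S" "v \<in> words S" "v' \<in> words S" for u v v'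
  proof -
    have "B u (v @ v') = word_val A (\<lambda>g. word_val A (b g) v \<otimes>\<^bsub>A\<^esub> word_val A (b g) v') u"
      unfolding B_def using that by (intro A.word_val_cong[of S]) (auto simp: A.word_val_append[OF bG])
    also have "\<dots> = B u v \<otimes>\<^bsub>A\<^esub> B u v'"
      unfolding B_def using that by (intro A.word_val_mult[OF bw bw])
    finally show ?thesis .
  qed
  have B_eq2: "B u v = B u v'" if "u \<in> words S" "word_eq S R v v'" for u v v'
    unfolding B_def using that A.word_val_word_eq[OF bG b2 that(2)]
    by (intro A.word_val_cong[of S]) auto
  have B_gen: "B [gen g] v = word_val A (b g) v" "B [gen_inv g] v = inv\<^bsub>A\<^esub> word_val A (b g) v"
    if "g \<in> S" "v \<in> words S" for g v
    using that A.word_val_closed[OF bG] by (simp_all add: B_def)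
  have B_rel1: "B u v = B u' v" if "R u u'" "u \<in> words S" "u' \<in> words S" "v \<in> words S" for u u' v
    using that(4)
  proof (induction v)
    case Nil
    then show ?case by (simp add: B_def A.word_val_one)
  next
    case (Cons l v)
    \<comment> \<open>When the second word is a single letter, the two orders of evaluating the
      double sum agree. This brings \<open>B w [l]\<close> into the form in which \<open>b1\<close>
      speaks about it.\<close>
    have *: "B w [l] = letter_val A (\<lambda>g. word_val A (\<lambda>g'. b g' g) w) l"
      if w: "w \<in> words S" for w
      using w
    proof (induction w)
      case Nil
      then show ?case by (auto simp: B_def letter_val_def)
    next
      case (Cons k w)
      have "snd l \<in> S" using \<open>l # v \<in> words S\<close> by (simp add: words_Cons)
      moreover have "snd k \<in> S" using Cons.prems by (simp add: words_Cons)
      moreover have "word_val A (\<lambda>g'. b g' (snd l)) w \<in> carrier A"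
        using b \<open>snd l \<in> S\<close> Cons.prems by (intro A.word_val_closed[of _ S]) (auto simp: words_Cons)
      moreover have "B (k # w) [l] = B [k] [l] \<otimes>\<^bsub>A\<^esub> B w [l]"
        using B_app1[of "[k]" w "[l]"] \<open>snd l \<in> S\<close> Cons.prems by (simp add: words_Cons)
      moreover have "B [k] [l] = letter_val A (\<lambda>g. letter_val A (\<lambda>g'. b g' g) k) l"
        using b \<open>snd l \<in> S\<close> calculation(2) by (simp add: B_def letter_val_def)
      ultimately show ?case
        using Cons b by (simp add: words_Cons letter_val_def A.inv_mult)
    qed
    have "B u [l] = B u' [l]"
      using b1[OF that(1-3)] Cons.prems by (simp add: * that letter_val_def words_Cons)
    moreover have "B w (l # v) = B w [l] \<otimes>\<^bsub>A\<^esub> B w v" if "w \<in> words S" for w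
      using B_app2[OF that, of "[l]" v] Cons.prems by (simp add: words_Cons)
    ultimately show ?case using Cons that by (simp add: words_Cons)
  qed
  have B_eq1: "B u v = B u' v" if "word_eq S R u u'" "v \<in> words S" for u u' v
    unfolding B_def using B_rel1 that(2)
    by (intro A.word_val_word_eq[OF bw _ that(1)]) (auto simp: B_def)
  have Q_closed [simp]: "Q w \<in> carrier A" if "w \<in> words S" for w
    using that
  proof (induction w)
    case (Cons l w)
    then show ?case using q b A.word_val_closed[OF bG, of "snd l" w]
      by (cases l; cases "fst l") (auto simp: Q_gen Q_inv words_Cons Pi_iff)
  qed (simp add: Q_Nil)
  have Q_app: "Q (u @ v) = Q u \<otimes>\<^bsub>A\<^esub> Q v \<otimes>\<^bsub>A\<^esub> B u v" if "u \<in> words S" "v \<in> words S" for u v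
    using that(1)
  proof (induction u)
    case Nil
    then show ?case using that(2) by (simp add: Q_Nil B_def)
  next
    case (Cons l u)
    obtain c g where l: "l = (c, g)" by force
    have g: "g \<in> S" "u \<in> words S" using Cons.prems l by auto
    have "q g \<in> carrier A" "b g g \<in> carrier A" using q b g by auto
    moreover have "B (l # u) v = B [l] v \<otimes>\<^bsub>A\<^esub> B u v"
      using B_app1[of "[l]" u v] g that(2) by (simp add: l)
    moreover have "word_val A (b g) (u @ v) = word_val A (b g) u \<otimes>\<^bsub>A\<^esub> word_val A (b g) v"
      using g that(2) by (intro A.word_val_append[OF bG])
    ultimately show ?case
      using g that(2) Cons.IH bG[OF g(1)] unfolding l
      by (cases c) (simp_all add: Q_gen Q_inv B_gen A.m_ac A.inv_mult A.word_val_closed[OF bG])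
  qed
  have Q_eq: "Q u = Q v" if "word_eq S R u v" for u v
    using that
  proof (induction rule: word_eq.induct)
    \<comment> \<open>An inverse letter contributes \<open>- q g + b g g\<close>, the value that
      makes \<open>g\<close> followed by its inverse, in either order, evaluate to zero.\<close>
    case (cancel g c)
    have "q g \<in> carrier A" "b g g \<in> carrier A" using q b cancel by auto
    then show ?case
      using A.mult_inv_cancel(2)[of "q g" "b g g" "\<one>\<^bsub>A\<^esub>"]
      by (cases c) (simp_all add: Q_gen Q_inv Q_Nil A.m_ac A.inv_mult)
  next
    case (append u u' v v')
    then have "u \<in> words S" "u' \<in> words S" "v \<in> words S" "v' \<in> words S"
      using word_eq_words by blast+
    moreover have "B u v = B u' v'"
      using append B_eq1 B_eq2 calculation by metis
    ultimately show ?case using append by (simp add: Q_app)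
  qed (simp_all add: rel[folded Q_def])
  obtain h where h: "\<And>w. w \<in> words S \<Longrightarrow> h (word_class S R w) = Q w"
    using presented_group_extend[of S R Q] Q_eq by metis
  \<comment> \<open>Both arguments of \<open>B\<close> have to descend to classes: the first through
    \<open>presented_group_extend\<close> with functions as values, restricted to
    \<open>words S\<close> because \<open>B\<close> is invariant there, the second through a
    representative.\<close>
  obtain c1 where c1: "\<And>u. u \<in> words S \<Longrightarrow> c1 (word_class S R u) = (\<lambda>v\<in>words S. B u v)"
    using presented_group_extend[of S R "\<lambda>u. (\<lambda>v\<in>words S. B u v)"] B_eq1
    by (metis (mono_tags, lifting) restrict_ext)
  define c where "c = (\<lambda>X Y. c1 X (SOME v. v \<in> Y))"
  have c: "c (word_class S R u) (word_class S R v) = B u v" if "u \<in> words S" "v \<in> words S" for u v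
  proof -
    have "v \<in> word_class S R v" using that by (simp add: word_class_def word_eq.refl)
    then have "(SOME w. w \<in> word_class S R v) \<in> word_class S R v" by (rule someI)
    then have "word_eq S R v (SOME w. w \<in> word_class S R v)" by (simp add: word_class_def)
    then show ?thesis using that B_eq2[of u v] word_eq_words[of S R v] by (simp add: c_def c1)
  qed
  have quad: "quadratic (presented_group S R) A h"
    and cross: "\<And>x y. x \<in> carrier (presented_group S R) \<Longrightarrow> y \<in> carrier (presented_group S R) \<Longrightarrow>
      cross_effect (presented_group S R) A h x y = c x y"
  proof -
    have 1: "h x \<in> carrier A" if "x \<in> carrier (presented_group S R)" for x
      using that by (auto simp: carrier_presented_group h)
    have 2: "(\<lambda>x. c x y) \<in> hom (presented_group S R) A" if "y \<in> carrier (presented_group S R)" for y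
      using that by (auto simp: hom_def carrier_presented_group presented_group_mult c B_app1)
    have 3: "c x \<in> hom (presented_group S R) A" if "x \<in> carrier (presented_group S R)" for x
      using that by (auto simp: hom_def carrier_presented_group presented_group_mult c B_app2)
    have 4: "h (x \<otimes>\<^bsub>presented_group S R\<^esub> y) = h x \<otimes>\<^bsub>A\<^esub> h y \<otimes>\<^bsub>A\<^esub> c x y"
      if "x \<in> carrier (presented_group S R)" "y \<in> carrier (presented_group S R)" for x y
      using that by (auto simp: carrier_presented_group presented_group_mult c h Q_app)
    show "quadratic (presented_group S R) A h"
      by (rule quadraticI(1)[OF A 1 2 3 group_presented_group 4])
    show "cross_effect (presented_group S R) A h x y = c x y"
      if "x \<in> carrier (presented_group S R)" "y \<in> carrier (presented_group S R)" for x y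
      by (rule quadraticI(2)[OF A 1 2 3 group_presented_group 4 that])
  qed
  have qc: "q g \<in> carrier A" if "g \<in> S" for g using q that by auto
  show ?thesis
    using quad cross qc b by (intro exI[of _ h]) (simp add: c h Q_gen Q_Nil B_gen)
qed

lemma quadratic_one:
  assumes "quadratic G A q" "group G" "comm_group A"
  shows "q \<one>\<^bsub>G\<^esub> = \<one>\<^bsub>A\<^esub>"
proof -
  interpret G: group G by fact
  interpret A: comm_group A by fact
  have h: "cross_effect G A q \<one>\<^bsub>G\<^esub> \<in> hom G A" and q: "q \<one>\<^bsub>G\<^esub> \<in> carrier A"
    using assms(1) G.one_closed by (auto simp: quadratic_def)
  have "cross_effect G A q \<one>\<^bsub>G\<^esub> \<one>\<^bsub>G\<^esub> = \<one>\<^bsub>A\<^esub>"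
    using hom_one[OF h] G.group_axioms A.group_axioms by simp
  then have "q \<one>\<^bsub>G\<^esub> = q \<one>\<^bsub>G\<^esub> \<otimes>\<^bsub>A\<^esub> q \<one>\<^bsub>G\<^esub>"
    using quadratic_mult[OF assms G.one_closed G.one_closed] q by simp
  then show ?thesis using q by (metis A.l_cancel_one)
qed

text \<open>Cross-effects that agree on generators agree everywhere by biadditivity. The values then
  spread along sums, and the value at an inverse is forced by the value zero at the neutral
  element.\<close>

lemma quadratic_eqI:
  assumes q: "quadratic G A q" and q': "quadratic G A q'" and G: "group G" and A: "comm_group A"
    and S: "S \<subseteq> carrier G" "generate G S = carrier G"
    and eq: "\<And>x. x \<in> S \<Longrightarrow> q x = q' x"
    and ceq: "\<And>x y. x \<in> S \<Longrightarrow> y \<in> S \<Longrightarrow> cross_effect G A q x y = cross_effect G A q' x y"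
    and x: "x \<in> carrier G"
  shows "q x = q' x"
proof -
  interpret G: group G by fact
  interpret A: comm_group A by fact
  have c1: "cross_effect G A q x y = cross_effect G A q' x y" if "x \<in> S" "y \<in> carrier G" for x y
    using q q' that S ceq
    by (intro hom_eq_on_generate[OF G A.group_axioms, of "cross_effect G A q x" "cross_effect G A q' x" S y])
      (auto simp: quadratic_def)
  have c: "cross_effect G A q x y = cross_effect G A q' x y" if "x \<in> carrier G" "y \<in> carrier G" for x y
    using q q' that S c1
    by (intro hom_eq_on_generate[OF G A.group_axioms, of "\<lambda>x. cross_effect G A q x y" "\<lambda>x. cross_effect G A q' x y" S x])
      (auto simp: quadratic_def)
  have clo: "q x \<in> carrier A" "q' x \<in> carrier A" if "x \<in> carrier G" for x
    using q q' that by (auto simp: quadratic_def)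
  have cl: "cross_effect G A q' x y \<in> carrier A" if "x \<in> carrier G" "y \<in> carrier G" for x y
    using q' that by (auto simp: quadratic_def hom_def)
  have "x \<in> generate G S" using x S by simp
  then show ?thesis
  proof (induction rule: generate.induct)
    case one
    show ?case using quadratic_one[OF q G A] quadratic_one[OF q' G A] by simp
  next
    case (incl h)
    then show ?case by (rule eq)
  next
    case (inv h)
    then have h: "h \<in> carrier G" using S by auto
    have "q h \<otimes>\<^bsub>A\<^esub> q (inv\<^bsub>G\<^esub> h) \<otimes>\<^bsub>A\<^esub> cross_effect G A q' h (inv\<^bsub>G\<^esub> h)
        = q' h \<otimes>\<^bsub>A\<^esub> q' (inv\<^bsub>G\<^esub> h) \<otimes>\<^bsub>A\<^esub> cross_effect G A q' h (inv\<^bsub>G\<^esub> h)"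
      using quadratic_mult[OF q G A h, of "inv\<^bsub>G\<^esub> h"] quadratic_mult[OF q' G A h, of "inv\<^bsub>G\<^esub> h"] h
        quadratic_one[OF q G A] quadratic_one[OF q' G A] c by simp
    then show ?case using h eq[OF inv] clo cl by simp
  next
    case (eng x y)
    then have "x \<in> carrier G" "y \<in> carrier G" using S by auto
    then show ?case
      using eng quadratic_mult[OF q G A] quadratic_mult[OF q' G A] c by simp
  qed
qed

lemma quadratic_hom_comp:
  assumes q: "quadratic G A q" and f: "f \<in> hom A B" and A: "comm_group A" and B: "comm_group B"
    and G: "group G"
  shows "quadratic G B (\<lambda>x. f (q x))"
    and "\<And>x y. x \<in> carrier G \<Longrightarrow> y \<in> carrier G \<Longrightarrow>
      cross_effect G B (\<lambda>x. f (q x)) x y = f (cross_effect G A q x y)"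
proof -
  interpret G: group G by fact
  interpret A: comm_group A by fact
  have cl: "q x \<in> carrier A" if "x \<in> carrier G" for x using q that by (auto simp: quadratic_def)
  have c1: "(\<lambda>x. f (cross_effect G A q x y)) \<in> hom G B" if "y \<in> carrier G" for y
    using hom_compose[OF _ f, of "\<lambda>x. cross_effect G A q x y"] q that by (auto simp: quadratic_def comp_def)
  have c2: "(\<lambda>y. f (cross_effect G A q x y)) \<in> hom G B" if "x \<in> carrier G" for x
    using hom_compose[OF _ f, of "\<lambda>y. cross_effect G A q x y"] q that by (auto simp: quadratic_def comp_def)
  have cc: "cross_effect G A q x y \<in> carrier A" if "x \<in> carrier G" "y \<in> carrier G" for x y
    using q that by (auto simp: quadratic_def hom_def)
  have eq: "f (q (x \<otimes>\<^bsub>G\<^esub> y)) = f (q x) \<otimes>\<^bsub>B\<^esub> f (q y) \<otimes>\<^bsub>B\<^esub> f (cross_effect G A q x y)"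
    if "x \<in> carrier G" "y \<in> carrier G" for x y
    using f that cl cc by (simp add: quadratic_mult[OF q G A] hom_mult)
  have "f (q x) \<in> carrier B" if "x \<in> carrier G" for x using f cl that by (auto simp: hom_def)
  from quadraticI[OF B this c1 c2 G eq]
  show "quadratic G B (\<lambda>x. f (q x))"
    and "\<And>x y. x \<in> carrier G \<Longrightarrow> y \<in> carrier G \<Longrightarrow>
      cross_effect G B (\<lambda>x. f (q x)) x y = f (cross_effect G A q x y)" by auto
qed

lemma hom_quadratic_comp:
  assumes q: "quadratic G A q" and f: "f \<in> hom H G" and A: "comm_group A"
    and G: "group G" and H: "group H"
  shows "quadratic H A (\<lambda>x. q (f x))"
    and "\<And>x y. x \<in> carrier H \<Longrightarrow> y \<in> carrier H \<Longrightarrow>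
      cross_effect H A (\<lambda>x. q (f x)) x y = cross_effect G A q (f x) (f y)"
proof -
  interpret H: group H by fact
  interpret A: comm_group A by fact
  have cl: "f x \<in> carrier G" if "x \<in> carrier H" for x using f that by (auto simp: hom_def)
  have c1: "(\<lambda>x. cross_effect G A q (f x) (f y)) \<in> hom H A" if "y \<in> carrier H" for y
    using hom_compose[OF f, of "\<lambda>x. cross_effect G A q x (f y)" A] q that cl by (auto simp: quadratic_def comp_def)
  have c2: "(\<lambda>y. cross_effect G A q (f x) (f y)) \<in> hom H A" if "x \<in> carrier H" for x
    using hom_compose[OF f, of "cross_effect G A q (f x)" A] q that cl by (auto simp: quadratic_def comp_def)
  have eq: "q (f (x \<otimes>\<^bsub>H\<^esub> y)) = q (f x) \<otimes>\<^bsub>A\<^esub> q (f y) \<otimes>\<^bsub>A\<^esub> cross_effect G A q (f x) (f y)"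
    if "x \<in> carrier H" "y \<in> carrier H" for x y
    using that f cl by (simp add: hom_mult quadratic_mult[OF q G A])
  have "q (f x) \<in> carrier A" if "x \<in> carrier H" for x using q cl that by (auto simp: quadratic_def)
  from quadraticI[OF A this c1 c2 H eq]
  show "quadratic H A (\<lambda>x. q (f x))"
    and "\<And>x y. x \<in> carrier H \<Longrightarrow> y \<in> carrier H \<Longrightarrow>
      cross_effect H A (\<lambda>x. q (f x)) x y = cross_effect G A q (f x) (f y)" by auto
qed

section \<open>Commutation and commutators spread from generators\<close>

lemma (in group) commute_on_generate:
  assumes S: "S \<subseteq> carrier G" and z: "z \<in> carrier G"
    and comm: "\<And>s. s \<in> S \<Longrightarrow> z \<otimes> s = s \<otimes> z" and u: "u \<in> generate G S"
  shows "z \<otimes> u = u \<otimes> z"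
  using u
proof (induction rule: generate.induct)
  case (inv s)
  then have s: "s \<in> carrier G" using S by auto
  have "inv s \<otimes> z = inv s \<otimes> (z \<otimes> s) \<otimes> inv s" using s z by (simp add: m_assoc)
  also have "\<dots> = inv s \<otimes> (s \<otimes> z) \<otimes> inv s" using comm inv by simp
  also have "\<dots> = z \<otimes> inv s" using s z by (simp flip: m_assoc)
  finally show ?case ..
next
  case (eng x y)
  then have xy: "x \<in> carrier G" "y \<in> carrier G" using S generate_in_carrier by auto
  have "z \<otimes> (x \<otimes> y) = x \<otimes> (z \<otimes> y)" using xy z eng.IH(1) by (simp flip: m_assoc)
  then show ?case using xy z eng.IH(2) by (simp add: m_assoc)
qed (use z comm in auto)

text \<open>A bimultiplicative central map that computes the commutators of generators computes all of them;
  this is the step in one variable.\<close>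

lemma (in group) commutator_on_generate:
  assumes S: "S \<subseteq> carrier G" and v: "v \<in> carrier G" and c: "c \<in> hom G G"
    and central: "\<And>x y. x \<in> carrier G \<Longrightarrow> y \<in> carrier G \<Longrightarrow> c x \<otimes> y = y \<otimes> c x"
    and comm: "\<And>s. s \<in> S \<Longrightarrow> s \<otimes> v = v \<otimes> s \<otimes> c s" and u: "u \<in> generate G S"
  shows "u \<otimes> v = v \<otimes> u \<otimes> c u"
  using u
proof (induction rule: generate.induct)
  case one
  show ?case using v hom_one[OF c] by simp
next
  case (inv s)
  then have s: "s \<in> carrier G" using S by auto
  have cs: "c s \<in> carrier G" using c s by (auto simp: hom_def)
  have ci: "c (inv s) = inv (c s)" using c s group_hom.hom_inv[of G G c] by (simp add: group_hom_def group_hom_axioms_def)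
  have "inv s \<otimes> (s \<otimes> v) \<otimes> inv s \<otimes> inv (c s) = inv s \<otimes> (v \<otimes> s \<otimes> c s) \<otimes> inv s \<otimes> inv (c s)"
    using comm inv by simp
  also have "\<dots> = inv s \<otimes> v \<otimes> (s \<otimes> (c s \<otimes> inv s)) \<otimes> inv (c s)"
    using s v cs by (simp add: m_assoc)
  also have "\<dots> = inv s \<otimes> v \<otimes> (s \<otimes> inv s) \<otimes> (c s \<otimes> inv (c s))"
    using s v cs central[of s "inv s"] by (simp only: m_assoc m_closed inv_closed)
  finally show ?case using s v cs ci by (simp flip: m_assoc)
next
  case (eng x y)
  then have xy: "x \<in> carrier G" "y \<in> carrier G" using S generate_in_carrier by auto
  then have cx: "c x \<in> carrier G" "c y \<in> carrier G" using c by (auto simp: hom_def)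
  have "x \<otimes> y \<otimes> v = x \<otimes> v \<otimes> (y \<otimes> c y)" using xy v cx eng.IH(2) by (simp add: m_assoc)
  also have "\<dots> = v \<otimes> x \<otimes> c x \<otimes> (y \<otimes> c y)" using eng.IH(1) by simp
  also have "\<dots> = v \<otimes> x \<otimes> (c x \<otimes> y) \<otimes> c y" using xy v cx by (simp add: m_assoc)
  also have "\<dots> = v \<otimes> x \<otimes> (y \<otimes> c x) \<otimes> c y" using xy by (simp only: central)
  finally show ?case using xy v cx c by (simp add: m_assoc hom_mult)
qed (use comm in auto)

section \<open>Calculus in square groups\<close>

abbreviation car_e :: "('a, 'b) sq_group \<Rightarrow> 'a set" where
  "car_e M \<equiv> carrier (lvl_e M)"

abbreviation car_ee :: "('a, 'b) sq_group \<Rightarrow> 'b set" where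
  "car_ee M \<equiv> carrier (lvl_ee M)"

abbreviation add_e :: "('a, 'b) sq_group \<Rightarrow> 'a \<Rightarrow> 'a \<Rightarrow> 'a"  (infixl \<open>\<boxplus>\<index>\<close> 65) where
  "x \<boxplus>\<^bsub>M\<^esub> y \<equiv> x \<otimes>\<^bsub>lvl_e M\<^esub> y"

abbreviation neg_e :: "('a, 'b) sq_group \<Rightarrow> 'a \<Rightarrow> 'a"  (\<open>\<boxminus>\<index> _\<close> [81] 80) where
  "\<boxminus>\<^bsub>M\<^esub> x \<equiv> inv\<^bsub>lvl_e M\<^esub> x"

abbreviation add_ee :: "('a, 'b) sq_group \<Rightarrow> 'b \<Rightarrow> 'b \<Rightarrow> 'b"  (infixl \<open>\<oplus>\<index>\<close> 65) where
  "a \<oplus>\<^bsub>M\<^esub> b \<equiv> a \<otimes>\<^bsub>lvl_ee M\<^esub> b"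

abbreviation neg_ee :: "('a, 'b) sq_group \<Rightarrow> 'b \<Rightarrow> 'b"  (\<open>\<ominus>\<index> _\<close> [81] 80) where
  "\<ominus>\<^bsub>M\<^esub> a \<equiv> inv\<^bsub>lvl_ee M\<^esub> a"

abbreviation zero_e :: "('a, 'b) sq_group \<Rightarrow> 'a"  (\<open>\<zero>\<^sub>e\<index>\<close>) where
  "\<zero>\<^sub>e\<^bsub>M\<^esub> \<equiv> \<one>\<^bsub>lvl_e M\<^esub>"

abbreviation zero_ee :: "('a, 'b) sq_group \<Rightarrow> 'b"  (\<open>\<zero>\<index>\<close>) where
  "\<zero>\<^bsub>M\<^esub> \<equiv> \<one>\<^bsub>lvl_ee M\<^esub>"

text \<open>Rewriting with \<open>sub_norm\<close> brings both sides of an equation into the form \<open>sub p n\<close> with \<open>p\<close> and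
  \<open>n\<close> free of inverses and then clears the differences, so that \<open>m_ac\<close> decides the equation.\<close>

definition sub :: "('a, 'm) monoid_scheme \<Rightarrow> 'a \<Rightarrow> 'a \<Rightarrow> 'a" where
  "sub G a b = a \<otimes>\<^bsub>G\<^esub> inv\<^bsub>G\<^esub> b"

context comm_group
begin

lemma sub_closed: "a \<in> carrier G \<Longrightarrow> b \<in> carrier G \<Longrightarrow> sub G a b \<in> carrier G"
  by (simp add: sub_def)

lemma sub_norm:
  "a \<in> carrier G \<Longrightarrow> inv a = sub G \<one> a"
  "a \<in> carrier G \<Longrightarrow> b \<in> carrier G \<Longrightarrow> c \<in> carrier G \<Longrightarrow> a \<otimes> sub G b c = sub G (a \<otimes> b) c"
  "a \<in> carrier G \<Longrightarrow> b \<in> carrier G \<Longrightarrow> c \<in> carrier G \<Longrightarrow> sub G a b \<otimes> c = sub G (a \<otimes> c) b"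
  "a \<in> carrier G \<Longrightarrow> b \<in> carrier G \<Longrightarrow> c \<in> carrier G \<Longrightarrow> sub G a (sub G b c) = sub G (a \<otimes> c) b"
  "a \<in> carrier G \<Longrightarrow> b \<in> carrier G \<Longrightarrow> c \<in> carrier G \<Longrightarrow> sub G (sub G a b) c = sub G a (b \<otimes> c)"
  "a \<in> carrier G \<Longrightarrow> b \<in> carrier G \<Longrightarrow> c \<in> carrier G \<Longrightarrow> sub G a b = c \<longleftrightarrow> a = c \<otimes> b"
  "a \<in> carrier G \<Longrightarrow> b \<in> carrier G \<Longrightarrow> c \<in> carrier G \<Longrightarrow> c = sub G a b \<longleftrightarrow> c \<otimes> b = a"
proof -
  show "inv a = sub G \<one> a" if "a \<in> carrier G" using that by (simp add: sub_def)
  assume *: "a \<in> carrier G" "b \<in> carrier G" "c \<in> carrier G"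
  show "a \<otimes> sub G b c = sub G (a \<otimes> b) c" "sub G a b \<otimes> c = sub G (a \<otimes> c) b"
    "sub G a (sub G b c) = sub G (a \<otimes> c) b" "sub G (sub G a b) c = sub G a (b \<otimes> c)"
    using * by (simp_all add: sub_def m_ac inv_mult)
  show "sub G a b = c \<longleftrightarrow> a = c \<otimes> b" "c = sub G a b \<longleftrightarrow> c \<otimes> b = a"
    using * unfolding sub_def by (metis inv_solve_right m_closed inv_closed)+
qed

end

lemma square_groupD:
  assumes "square_group M"
  shows square_group_e: "group (lvl_e M)"
    and square_group_ee: "comm_group (lvl_ee M)"
    and Pmap_hom: "Pmap M \<in> hom (lvl_ee M) (lvl_e M)"
    and quadratic_Hmap: "quadratic (lvl_e M) (lvl_ee M) (Hmap M)"
    and crossH_P_left [simp]: "a \<in> car_ee M \<Longrightarrow> y \<in> car_e M \<Longrightarrow> crossH M (Pmap M a) y = \<zero>\<^bsub>M\<^esub>"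
    and crossH_P_right [simp]: "x \<in> car_e M \<Longrightarrow> b \<in> car_ee M \<Longrightarrow> crossH M x (Pmap M b) = \<zero>\<^bsub>M\<^esub>"
    and P_crossH: "x \<in> car_e M \<Longrightarrow> y \<in> car_e M \<Longrightarrow>
       Pmap M (crossH M x y) = \<boxminus>\<^bsub>M\<^esub> x \<boxplus>\<^bsub>M\<^esub> \<boxminus>\<^bsub>M\<^esub> y \<boxplus>\<^bsub>M\<^esub> x \<boxplus>\<^bsub>M\<^esub> y"
    and PHP: "a \<in> car_ee M \<Longrightarrow> Pmap M (Hmap M (Pmap M a)) = Pmap M a \<boxplus>\<^bsub>M\<^esub> Pmap M a"
  using assms by (auto simp: square_group_def)

lemma square_group_ee': "square_group M \<Longrightarrow> group (lvl_ee M)"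
  by (simp add: square_group_ee comm_group.axioms)

lemmas e_simps [simp] =
  monoid.m_closed[OF group.is_monoid[OF square_group_e]]
  monoid.one_closed[OF group.is_monoid[OF square_group_e]]
  monoid.l_one[OF group.is_monoid[OF square_group_e]]
  monoid.r_one[OF group.is_monoid[OF square_group_e]]
  group.inv_closed[OF square_group_e]
  group.l_inv[OF square_group_e] group.r_inv[OF square_group_e]
  group.inv_inv[OF square_group_e]

lemmas e_assoc = monoid.m_assoc[OF group.is_monoid[OF square_group_e]]

lemmas ee_simps [simp] =
  monoid.m_closed[OF group.is_monoid[OF square_group_ee']]
  monoid.one_closed[OF group.is_monoid[OF square_group_ee']]
  monoid.l_one[OF group.is_monoid[OF square_group_ee']]
  monoid.r_one[OF group.is_monoid[OF square_group_ee']]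
  group.inv_closed[OF square_group_ee']
  group.l_inv[OF square_group_ee'] group.r_inv[OF square_group_ee']
  group.inv_inv[OF square_group_ee'] comm_group.sub_closed[OF square_group_ee]

lemmas ee_assoc = monoid.m_assoc[OF group.is_monoid[OF square_group_ee']]
lemmas ee_ac = comm_monoid.m_ac[OF comm_group.axioms(1)[OF square_group_ee]]
lemmas ee_neg_add = comm_group.inv_mult[OF square_group_ee]
lemmas ee_norm = comm_group.sub_norm[OF square_group_ee]

lemma ee_l_cancel:
  assumes "square_group M" "a \<in> car_ee M" "b \<in> car_ee M" "c \<in> car_ee M"
  shows "a \<oplus>\<^bsub>M\<^esub> b = a \<oplus>\<^bsub>M\<^esub> c \<longleftrightarrow> b = c"
proof -
  interpret group "lvl_ee M" using assms by (simp add: square_group_ee')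
  show ?thesis using assms by simp
qed

lemma inv_one_simps [simp]:
  "square_group M \<Longrightarrow> \<ominus>\<^bsub>M\<^esub> \<zero>\<^bsub>M\<^esub> = \<zero>\<^bsub>M\<^esub>"
  "square_group M \<Longrightarrow> \<boxminus>\<^bsub>M\<^esub> \<zero>\<^sub>e\<^bsub>M\<^esub> = \<zero>\<^sub>e\<^bsub>M\<^esub>"
  using square_group_e[of M] square_group_ee'[of M] group.is_monoid monoid.inv_one by metis+

lemma hom_inv:
  assumes "f \<in> hom G H" "group G" "group H" "x \<in> carrier G"
  shows "f (inv\<^bsub>G\<^esub> x) = inv\<^bsub>H\<^esub> f x"
  using assms group_hom.hom_inv[of G H f x] by (simp add: group_hom_def group_hom_axioms_def)

context
  fixes M :: "('a, 'b) sq_group"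
  assumes sq [simp]: "square_group M"
begin

lemma Hmap_closed [simp]: "x \<in> car_e M \<Longrightarrow> Hmap M x \<in> car_ee M"
  using quadratic_Hmap[OF sq] by (auto simp: quadratic_def)

lemma Pmap_closed [simp]: "a \<in> car_ee M \<Longrightarrow> Pmap M a \<in> car_e M"
  using Pmap_hom[OF sq] by (auto simp: hom_def)

lemma Pmap_add: "a \<in> car_ee M \<Longrightarrow> b \<in> car_ee M \<Longrightarrow> Pmap M (a \<oplus>\<^bsub>M\<^esub> b) = Pmap M a \<boxplus>\<^bsub>M\<^esub> Pmap M b"
  using Pmap_hom[OF sq] by (auto simp: hom_def)

lemma Pmap_zero [simp]: "Pmap M \<zero>\<^bsub>M\<^esub> = \<zero>\<^sub>e\<^bsub>M\<^esub>"
  by (rule hom_one[OF Pmap_hom]) (simp_all add: square_group_e square_group_ee')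

lemma Pmap_neg: "a \<in> car_ee M \<Longrightarrow> Pmap M (\<ominus>\<^bsub>M\<^esub> a) = \<boxminus>\<^bsub>M\<^esub> Pmap M a"
  by (rule hom_inv[OF Pmap_hom]) (simp_all add: square_group_e square_group_ee')

lemma crossH_hom_left: "y \<in> car_e M \<Longrightarrow> (\<lambda>x. crossH M x y) \<in> hom (lvl_e M) (lvl_ee M)"
  using quadratic_Hmap[OF sq] by (auto simp: quadratic_def)

lemma crossH_hom_right: "x \<in> car_e M \<Longrightarrow> crossH M x \<in> hom (lvl_e M) (lvl_ee M)"
  using quadratic_Hmap[OF sq] by (auto simp: quadratic_def)

lemma crossH_closed [simp]: "x \<in> car_e M \<Longrightarrow> y \<in> car_e M \<Longrightarrow> crossH M x y \<in> car_ee M"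
  using crossH_hom_right[of x] by (auto simp: hom_def)

lemma crossH_add:
  "x \<in> car_e M \<Longrightarrow> x' \<in> car_e M \<Longrightarrow> y \<in> car_e M \<Longrightarrow> crossH M (x \<boxplus>\<^bsub>M\<^esub> x') y = crossH M x y \<oplus>\<^bsub>M\<^esub> crossH M x' y"
  "x \<in> car_e M \<Longrightarrow> y \<in> car_e M \<Longrightarrow> y' \<in> car_e M \<Longrightarrow> crossH M x (y \<boxplus>\<^bsub>M\<^esub> y') = crossH M x y \<oplus>\<^bsub>M\<^esub> crossH M x y'"
  using crossH_hom_right[of x] crossH_hom_left[of y] by (auto simp: hom_def)

lemma crossH_zero [simp]:
  "y \<in> car_e M \<Longrightarrow> crossH M \<zero>\<^sub>e\<^bsub>M\<^esub> y = \<zero>\<^bsub>M\<^esub>"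
  "x \<in> car_e M \<Longrightarrow> crossH M x \<zero>\<^sub>e\<^bsub>M\<^esub> = \<zero>\<^bsub>M\<^esub>"
  using hom_one[OF crossH_hom_left] hom_one[OF crossH_hom_right] square_group_e[OF sq] square_group_ee'[OF sq]
  by auto

lemma Hmap_zero [simp]: "Hmap M \<zero>\<^sub>e\<^bsub>M\<^esub> = \<zero>\<^bsub>M\<^esub>"
  by (rule quadratic_one[OF quadratic_Hmap]) (simp_all add: square_group_e square_group_ee)

lemma Hmap_add:
  "x \<in> car_e M \<Longrightarrow> y \<in> car_e M \<Longrightarrow> Hmap M (x \<boxplus>\<^bsub>M\<^esub> y) = Hmap M x \<oplus>\<^bsub>M\<^esub> Hmap M y \<oplus>\<^bsub>M\<^esub> crossH M x y"
  by (rule quadratic_mult[OF quadratic_Hmap]) (simp_all add: square_group_e square_group_ee)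

lemma add_swap:
  assumes "x \<in> car_e M" "y \<in> car_e M"
  shows "x \<boxplus>\<^bsub>M\<^esub> y = y \<boxplus>\<^bsub>M\<^esub> x \<boxplus>\<^bsub>M\<^esub> Pmap M (crossH M x y)"
proof -
  interpret group "lvl_e M" by (rule square_group_e) simp
  have "y \<boxplus>\<^bsub>M\<^esub> x \<boxplus>\<^bsub>M\<^esub> (\<boxminus>\<^bsub>M\<^esub> x \<boxplus>\<^bsub>M\<^esub> \<boxminus>\<^bsub>M\<^esub> y \<boxplus>\<^bsub>M\<^esub> x \<boxplus>\<^bsub>M\<^esub> y) = y \<boxplus>\<^bsub>M\<^esub> (x \<boxplus>\<^bsub>M\<^esub> \<boxminus>\<^bsub>M\<^esub> x) \<boxplus>\<^bsub>M\<^esub> \<boxminus>\<^bsub>M\<^esub> y \<boxplus>\<^bsub>M\<^esub> x \<boxplus>\<^bsub>M\<^esub> y"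
    using assms by (simp only: m_assoc m_closed inv_closed)
  then show ?thesis using assms by (simp add: P_crossH)
qed

text \<open>The commutator of \<open>P a\<close> and \<open>y\<close> is \<open>P\<close> of their
  cross-effect, which vanishes.\<close>

lemma P_central:
  "a \<in> car_ee M \<Longrightarrow> y \<in> car_e M \<Longrightarrow> Pmap M a \<boxplus>\<^bsub>M\<^esub> y = y \<boxplus>\<^bsub>M\<^esub> Pmap M a"
  using add_swap[of "Pmap M a" y] by simp

text \<open>The image of \<open>P\<close> is central, so it can be collected at the right end of a sum.\<close>

lemma P_collect_right:
  assumes "x \<in> car_e M" "a \<in> car_ee M" "b \<in> car_ee M"
  shows "x \<boxplus>\<^bsub>M\<^esub> Pmap M a \<boxplus>\<^bsub>M\<^esub> Pmap M b = x \<boxplus>\<^bsub>M\<^esub> Pmap M (a \<oplus>\<^bsub>M\<^esub> b)"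
  using assms by (simp add: Pmap_add e_assoc)

lemma P_collect_add:
  assumes "x \<in> car_e M" "y \<in> car_e M" "a \<in> car_ee M" "b \<in> car_ee M"
  shows "x \<boxplus>\<^bsub>M\<^esub> Pmap M a \<boxplus>\<^bsub>M\<^esub> (y \<boxplus>\<^bsub>M\<^esub> Pmap M b) = x \<boxplus>\<^bsub>M\<^esub> y \<boxplus>\<^bsub>M\<^esub> Pmap M (a \<oplus>\<^bsub>M\<^esub> b)"
proof -
  have "x \<boxplus>\<^bsub>M\<^esub> Pmap M a \<boxplus>\<^bsub>M\<^esub> (y \<boxplus>\<^bsub>M\<^esub> Pmap M b) = x \<boxplus>\<^bsub>M\<^esub> (Pmap M a \<boxplus>\<^bsub>M\<^esub> y) \<boxplus>\<^bsub>M\<^esub> Pmap M b"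
    using assms by (simp add: e_assoc)
  also have "\<dots> = x \<boxplus>\<^bsub>M\<^esub> y \<boxplus>\<^bsub>M\<^esub> Pmap M a \<boxplus>\<^bsub>M\<^esub> Pmap M b"
    using assms by (simp only: P_central[of a y]) (simp add: e_assoc)
  finally show ?thesis
    using assms by (simp add: Pmap_add e_assoc)
qed

lemmas P_collect = P_collect_right P_collect_add

lemma HP_add: "a \<in> car_ee M \<Longrightarrow> b \<in> car_ee M \<Longrightarrow>
    Hmap M (Pmap M (a \<oplus>\<^bsub>M\<^esub> b)) = Hmap M (Pmap M a) \<oplus>\<^bsub>M\<^esub> Hmap M (Pmap M b)"
  by (simp add: Pmap_add Hmap_add)

lemma Tmap_closed [simp]: "a \<in> car_ee M \<Longrightarrow> Tmap M a \<in> car_ee M"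
  by (simp add: Tmap_def)

lemma HP_eq: "a \<in> car_ee M \<Longrightarrow> Hmap M (Pmap M a) = Tmap M a \<oplus>\<^bsub>M\<^esub> a"
  by (simp add: Tmap_def ee_assoc)

lemma Tmap_hom: "Tmap M \<in> hom (lvl_ee M) (lvl_ee M)"
  by (rule homI) (simp_all add: Tmap_def HP_add ee_neg_add ee_ac)

lemma Tmap_add: "a \<in> car_ee M \<Longrightarrow> b \<in> car_ee M \<Longrightarrow> Tmap M (a \<oplus>\<^bsub>M\<^esub> b) = Tmap M a \<oplus>\<^bsub>M\<^esub> Tmap M b"
  using Tmap_hom by (auto simp: hom_def)

lemma Tmap_neg: "a \<in> car_ee M \<Longrightarrow> Tmap M (\<ominus>\<^bsub>M\<^esub> a) = \<ominus>\<^bsub>M\<^esub> Tmap M a"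
  by (rule hom_inv[OF Tmap_hom]) (simp_all add: square_group_ee')

lemma Tmap_zero [simp]: "Tmap M \<zero>\<^bsub>M\<^esub> = \<zero>\<^bsub>M\<^esub>"
  by (rule hom_one[OF Tmap_hom]) (simp_all add: square_group_ee')

text \<open>This is \<open>P H P = 2 P\<close> in terms of \<open>T\<close>. In a tensor product it
  makes \<open>P\<close> of \<open>a \<otimes> b\<close> and of \<open>T a \<otimes> T b\<close>
  opposite.\<close>

lemma P_Tmap [simp]: "a \<in> car_ee M \<Longrightarrow> Pmap M (Tmap M a) = Pmap M a"
  by (simp add: Tmap_def Pmap_add Pmap_neg PHP e_assoc)

lemma Tmap_Tmap [simp]: "a \<in> car_ee M \<Longrightarrow> Tmap M (Tmap M a) = a"
  by (subst Tmap_def) (simp add: HP_eq ee_neg_add ee_norm ee_ac)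

text \<open>Apply \<open>H\<close> to both sides of \<open>x + y = y + x + P (x|y)\<close> and
  cancel; what remains is \<open>0 = (y|x) + T (x|y)\<close>.\<close>

lemma Tmap_crossH:
  assumes "x \<in> car_e M" "y \<in> car_e M"
  shows "Tmap M (crossH M x y) = \<ominus>\<^bsub>M\<^esub> crossH M y x"
proof -
  have "Hmap M (x \<boxplus>\<^bsub>M\<^esub> y) = Hmap M (y \<boxplus>\<^bsub>M\<^esub> x \<boxplus>\<^bsub>M\<^esub> Pmap M (crossH M x y))"
    by (simp flip: add_swap[OF assms])
  then have "Hmap M x \<oplus>\<^bsub>M\<^esub> Hmap M y \<oplus>\<^bsub>M\<^esub> crossH M x y =
      Hmap M x \<oplus>\<^bsub>M\<^esub> Hmap M y \<oplus>\<^bsub>M\<^esub> (crossH M y x \<oplus>\<^bsub>M\<^esub> Hmap M (Pmap M (crossH M x y)))"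
    using assms by (simp add: Hmap_add ee_ac)
  then have "crossH M x y = crossH M y x \<oplus>\<^bsub>M\<^esub> Hmap M (Pmap M (crossH M x y))"
    using assms by (subst (asm) ee_l_cancel) simp_all
  then have "crossH M x y \<oplus>\<^bsub>M\<^esub> \<zero>\<^bsub>M\<^esub> = crossH M x y \<oplus>\<^bsub>M\<^esub> (crossH M y x \<oplus>\<^bsub>M\<^esub> Tmap M (crossH M x y))"
    using assms by (simp add: HP_eq ee_ac)
  then show ?thesis
    using assms by (subst (asm) ee_l_cancel) (simp_all add: ee_norm ee_ac)
qed

text \<open>With \<open>H P = T + 1\<close> and \<open>H (x + x) = 2 H x + (x|x)\<close>, all but
  one of the four copies of \<open>H x\<close> that are subtracted cancel.\<close>

lemma Delta_eq:
  assumes "x \<in> car_e M"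
  shows "Delta M x = Tmap M (Hmap M x) \<oplus>\<^bsub>M\<^esub> \<ominus>\<^bsub>M\<^esub> Hmap M x \<oplus>\<^bsub>M\<^esub> crossH M x x"
proof -
  have "Hmap M x [^]\<^bsub>lvl_ee M\<^esub> (4::nat) = Hmap M x \<oplus>\<^bsub>M\<^esub> Hmap M x \<oplus>\<^bsub>M\<^esub> Hmap M x \<oplus>\<^bsub>M\<^esub> Hmap M x"
    using assms by (simp add: numeral_eq_Suc)
  then show ?thesis
    using assms by (simp add: Delta_def HP_eq Hmap_add ee_norm ee_ac)
qed

lemma Delta_closed [simp]: "x \<in> car_e M \<Longrightarrow> Delta M x \<in> car_ee M"
  by (simp add: Delta_eq)

text \<open>The cross-effect of \<open>H\<close> enters as
  \<open>T (x|y) - (x|y) + (x|y) + (y|x)\<close>, which is zero by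
  \<open>Tmap_crossH\<close>.\<close>

lemma Delta_add: "x \<in> car_e M \<Longrightarrow> y \<in> car_e M \<Longrightarrow> Delta M (x \<boxplus>\<^bsub>M\<^esub> y) = Delta M x \<oplus>\<^bsub>M\<^esub> Delta M y"
  by (simp add: Delta_eq Hmap_add Tmap_add Tmap_crossH crossH_add ee_neg_add ee_norm ee_ac)

lemma Delta_P [simp]: "a \<in> car_ee M \<Longrightarrow> Delta M (Pmap M a) = \<zero>\<^bsub>M\<^esub>"
  by (simp add: Delta_eq HP_eq Tmap_add ee_norm ee_ac)

lemma Tmap_Delta: "x \<in> car_e M \<Longrightarrow> Tmap M (Delta M x) = \<ominus>\<^bsub>M\<^esub> Delta M x"
  by (simp add: Delta_eq Tmap_add Tmap_neg Tmap_crossH ee_neg_add ee_ac)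

lemma P_Delta: "x \<in> car_e M \<Longrightarrow> Pmap M (Delta M x) = \<zero>\<^sub>e\<^bsub>M\<^esub>"
  by (simp add: Delta_eq Pmap_add Pmap_neg P_crossH e_assoc)

end

lemma sg_homD:
  assumes "\<phi> \<in> sg_hom M N"
  shows "src \<phi> = M" "tgt \<phi> = N"
    and "map_e \<phi> \<in> hom (lvl_e M) (lvl_e N)" "map_ee \<phi> \<in> hom (lvl_ee M) (lvl_ee N)"
    and "map_e \<phi> \<in> extensional (car_e M)" "map_ee \<phi> \<in> extensional (car_ee M)"
    and "x \<in> car_e M \<Longrightarrow> map_ee \<phi> (Hmap M x) = Hmap N (map_e \<phi> x)"
    and "a \<in> car_ee M \<Longrightarrow> map_e \<phi> (Pmap M a) = Pmap N (map_ee \<phi> a)"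
    and "x \<in> car_e M \<Longrightarrow> map_e \<phi> x \<in> car_e N"
    and "a \<in> car_ee M \<Longrightarrow> map_ee \<phi> a \<in> car_ee N"
    and "x \<in> car_e M \<Longrightarrow> y \<in> car_e M \<Longrightarrow> map_e \<phi> (x \<boxplus>\<^bsub>M\<^esub> y) = map_e \<phi> x \<boxplus>\<^bsub>N\<^esub> map_e \<phi> y"
    and "a \<in> car_ee M \<Longrightarrow> b \<in> car_ee M \<Longrightarrow> map_ee \<phi> (a \<oplus>\<^bsub>M\<^esub> b) = map_ee \<phi> a \<oplus>\<^bsub>N\<^esub> map_ee \<phi> b"
  using assms by (auto simp: sg_hom_def hom_def)

lemma sg_hom_pres:
  assumes \<phi>: "\<phi> \<in> sg_hom M N" and [simp]: "square_group M" "square_group N"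
  shows "a \<in> car_ee M \<Longrightarrow> map_ee \<phi> (\<ominus>\<^bsub>M\<^esub> a) = \<ominus>\<^bsub>N\<^esub> map_ee \<phi> a"
    and "x \<in> car_e M \<Longrightarrow> map_e \<phi> (\<boxminus>\<^bsub>M\<^esub> x) = \<boxminus>\<^bsub>N\<^esub> map_e \<phi> x"
    and "x \<in> car_e M \<Longrightarrow> y \<in> car_e M \<Longrightarrow> map_ee \<phi> (crossH M x y) = crossH N (map_e \<phi> x) (map_e \<phi> y)"
    and "a \<in> car_ee M \<Longrightarrow> map_ee \<phi> (Tmap M a) = Tmap N (map_ee \<phi> a)"
    and "x \<in> car_e M \<Longrightarrow> map_ee \<phi> (Delta M x) = Delta N (map_e \<phi> x)"
proof -
  show ne: "map_ee \<phi> (\<ominus>\<^bsub>M\<^esub> a) = \<ominus>\<^bsub>N\<^esub> map_ee \<phi> a" if "a \<in> car_ee M" for a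
    by (rule hom_inv[OF sg_homD(4)[OF \<phi>]]) (simp_all add: square_group_ee' that)
  show "map_e \<phi> (\<boxminus>\<^bsub>M\<^esub> x) = \<boxminus>\<^bsub>N\<^esub> map_e \<phi> x" if "x \<in> car_e M" for x
    by (rule hom_inv[OF sg_homD(3)[OF \<phi>]]) (simp_all add: square_group_e that)
  show cr: "map_ee \<phi> (crossH M x y) = crossH N (map_e \<phi> x) (map_e \<phi> y)"
    if "x \<in> car_e M" "y \<in> car_e M" for x y
    using that by (simp add: cross_effect_def ne sg_homD(7-)[OF \<phi>])
  show T: "map_ee \<phi> (Tmap M a) = Tmap N (map_ee \<phi> a)" if "a \<in> car_ee M" for a
    using that by (simp add: Tmap_def ne sg_homD(7-)[OF \<phi>])
  show "map_ee \<phi> (Delta M x) = Delta N (map_e \<phi> x)" if "x \<in> car_e M" for x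
    using that by (simp add: Delta_eq ne cr T sg_homD(7-)[OF \<phi>])
qed

section \<open>The tensor product of abelian groups\<close>

locale ab_groups = A: comm_group A + B: comm_group B
  for A :: "'a monoid" and B :: "'b monoid"
begin

abbreviation AB where "AB \<equiv> ab_tensor A B"

lemma ab_pure_closed [simp]: "a \<in> carrier A \<Longrightarrow> b \<in> carrier B \<Longrightarrow> ab_pure A B a b \<in> carrier AB"
  by (auto simp: ab_pure_def ab_tensor_def)

lemma group_ab_tensor: "group AB"
  by (simp add: ab_tensor_def group_presented_group)

lemma ab_tensor_rel:
  assumes "ab_rel A B u v" "u \<in> words (carrier A \<times> carrier B)" "v \<in> words (carrier A \<times> carrier B)"
  shows "word_val AB (\<lambda>(a, b). ab_pure A B a b) u = word_val AB (\<lambda>(a, b). ab_pure A B a b) v"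
proof -
  have "gen_class (carrier A \<times> carrier B) (ab_rel A B) = (\<lambda>(a, b). ab_pure A B a b)"
    by (auto simp: ab_pure_def)
  with presented_group_rel[where R = "ab_rel A B", OF assms] show ?thesis by (simp add: ab_tensor_def)
qed

lemma ab_pure_add_left:
  assumes "a \<in> carrier A" "a' \<in> carrier A" "b \<in> carrier B"
  shows "ab_pure A B (a \<otimes>\<^bsub>A\<^esub> a') b = ab_pure A B a b \<otimes>\<^bsub>AB\<^esub> ab_pure A B a' b"
proof -
  interpret group AB by (rule group_ab_tensor)
  show ?thesis using ab_tensor_rel[OF ab_rel.left[OF assms]] assms by simp
qed

lemma ab_pure_add_right:
  assumes "a \<in> carrier A" "b \<in> carrier B" "b' \<in> carrier B"
  shows "ab_pure A B a (b \<otimes>\<^bsub>B\<^esub> b') = ab_pure A B a b \<otimes>\<^bsub>AB\<^esub> ab_pure A B a b'"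
proof -
  interpret group AB by (rule group_ab_tensor)
  show ?thesis using ab_tensor_rel[OF ab_rel.right[OF assms]] assms by simp
qed

lemma ab_tensor_generate:
  "generate AB {ab_pure A B a b |a b. a \<in> carrier A \<and> b \<in> carrier B} = carrier AB"
proof -
  have "gen_class (carrier A \<times> carrier B) (ab_rel A B) ` (carrier A \<times> carrier B) =
      {ab_pure A B a b |a b. a \<in> carrier A \<and> b \<in> carrier B}"
    by (auto simp: ab_pure_def)
  then show ?thesis
    using presented_group_generate[of "carrier A \<times> carrier B" "ab_rel A B"] by (simp add: ab_tensor_def)
qed

lemma comm_group_ab_tensor: "comm_group AB"
proof -
  let ?S = "{ab_pure A B a b |a b. a \<in> carrier A \<and> b \<in> carrier B}"
  interpret group AB by (rule group_ab_tensor)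
  have S: "?S \<subseteq> carrier AB" by auto
  have 1: "s \<otimes>\<^bsub>AB\<^esub> t = t \<otimes>\<^bsub>AB\<^esub> s" if "s \<in> ?S" "t \<in> ?S" for s t
    using that ab_tensor_rel[OF ab_rel.comm] by fastforce
  \<comment> \<open>The relations only let generators commute with each other; this spreads to the
    whole group one factor at a time.\<close>
  have 2: "s \<otimes>\<^bsub>AB\<^esub> t = t \<otimes>\<^bsub>AB\<^esub> s" if "s \<in> ?S" "t \<in> carrier AB" for s t
    using commute_on_generate[OF S _ 1] that ab_tensor_generate S by blast
  have 3: "s \<otimes>\<^bsub>AB\<^esub> t = t \<otimes>\<^bsub>AB\<^esub> s" if "s \<in> carrier AB" "t \<in> carrier AB" for s t
    using commute_on_generate[OF S _ 2[symmetric]] that ab_tensor_generate by blast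
  show ?thesis by (rule group_comm_groupI) (rule 3)
qed

lemma ab_pure_hom_left: "b \<in> carrier B \<Longrightarrow> (\<lambda>a. ab_pure A B a b) \<in> hom A AB"
  by (rule homI) (simp_all add: ab_pure_add_left)

lemma ab_pure_hom_right: "a \<in> carrier A \<Longrightarrow> ab_pure A B a \<in> hom B AB"
  by (rule homI) (simp_all add: ab_pure_add_right)

lemma ab_pure_simps [simp]:
  "b \<in> carrier B \<Longrightarrow> ab_pure A B \<one>\<^bsub>A\<^esub> b = \<one>\<^bsub>AB\<^esub>"
  "a \<in> carrier A \<Longrightarrow> ab_pure A B a \<one>\<^bsub>B\<^esub> = \<one>\<^bsub>AB\<^esub>"
  "a \<in> carrier A \<Longrightarrow> b \<in> carrier B \<Longrightarrow> ab_pure A B (inv\<^bsub>A\<^esub> a) b = inv\<^bsub>AB\<^esub> ab_pure A B a b"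
  "a \<in> carrier A \<Longrightarrow> b \<in> carrier B \<Longrightarrow> ab_pure A B a (inv\<^bsub>B\<^esub> b) = inv\<^bsub>AB\<^esub> ab_pure A B a b"
  using hom_one[OF ab_pure_hom_left] hom_one[OF ab_pure_hom_right]
    hom_inv[OF ab_pure_hom_left] hom_inv[OF ab_pure_hom_right] group_ab_tensor by auto

lemma ab_tensor_hom:
  assumes C: "group C"
    and g: "\<And>a b. a \<in> carrier A \<Longrightarrow> b \<in> carrier B \<Longrightarrow> g a b \<in> carrier C"
    and g_left: "\<And>a a' b. a \<in> carrier A \<Longrightarrow> a' \<in> carrier A \<Longrightarrow> b \<in> carrier B \<Longrightarrow>
      g (a \<otimes>\<^bsub>A\<^esub> a') b = g a b \<otimes>\<^bsub>C\<^esub> g a' b"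
    and g_right: "\<And>a b b'. a \<in> carrier A \<Longrightarrow> b \<in> carrier B \<Longrightarrow> b' \<in> carrier B \<Longrightarrow>
      g a (b \<otimes>\<^bsub>B\<^esub> b') = g a b \<otimes>\<^bsub>C\<^esub> g a b'"
    and g_comm: "\<And>a a' b b'. a \<in> carrier A \<Longrightarrow> a' \<in> carrier A \<Longrightarrow> b \<in> carrier B \<Longrightarrow> b' \<in> carrier B \<Longrightarrow>
      g a b \<otimes>\<^bsub>C\<^esub> g a' b' = g a' b' \<otimes>\<^bsub>C\<^esub> g a b"
  shows "\<exists>h \<in> hom AB C. \<forall>a \<in> carrier A. \<forall>b \<in> carrier B. h (ab_pure A B a b) = g a b"
proof -
  interpret C: group C by fact
  have "word_val C (\<lambda>(a, b). g a b) u = word_val C (\<lambda>(a, b). g a b) v" if "ab_rel A B u v" for u v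
    using that by (cases rule: ab_rel.cases) (auto simp: g g_left g_right g_comm)
  then have "\<exists>h \<in> hom AB C. \<forall>x \<in> carrier A \<times> carrier B.
      h (gen_class (carrier A \<times> carrier B) (ab_rel A B) x) = (case x of (a, b) \<Rightarrow> g a b)"
    unfolding ab_tensor_def using g by (intro presented_group_hom[OF C]) auto
  then show ?thesis by (auto simp: ab_pure_def)
qed

end

text \<open>\<open>C\<close> is any group: the lemma is applied to \<open>p\<close>, with values in
  the \<open>ee\<close>-level, and to \<open>P\<close> after \<open>p\<close>, with values in the
  non-commutative \<open>e\<close>-level.\<close>

lemma biadditive_generate:
  assumes A: "group A" and B: "group B" and C: "group C"
    and left: "\<And>b. b \<in> carrier B \<Longrightarrow> (\<lambda>a. g a b) \<in> hom A C"
    and right: "\<And>a. a \<in> carrier A \<Longrightarrow> g a \<in> hom B C"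
    and U: "U \<subseteq> carrier A" "generate A U = carrier A"
    and V: "V \<subseteq> carrier B" "generate B V = carrier B"
    and W: "W \<subseteq> carrier C" "\<And>u v. u \<in> U \<Longrightarrow> v \<in> V \<Longrightarrow> g u v \<in> generate C W"
    and ab: "a \<in> carrier A" "b \<in> carrier B"
  shows "g a b \<in> generate C W"
proof -
  interpret A: group A by fact
  interpret B: group B by fact
  interpret C: group C by fact
  have 1: "g u b \<in> generate C W" if "u \<in> U" "b \<in> generate B V" for u b
    using that(2)
  proof (induction rule: generate.induct)
    case one
    then show ?case using hom_one[OF right, of u] that U B C by (auto simp: generate.one)
  next
    case (inv v)
    then show ?case
      using that U V W hom_inv[OF right, of u v] B C C.generate_m_inv_closed[OF W(1), of "g u v"]
      by (simp add: subset_iff)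
  next
    case (eng x y)
    then have "x \<in> carrier B" "y \<in> carrier B" using V by auto
    then show ?case
      using that U eng hom_mult[OF right, of u x y] by (simp add: subset_iff generate.eng)
  qed (use that W in auto)
  have "g a b \<in> generate C W" if "a \<in> generate A U" for a
    using that
  proof (induction rule: generate.induct)
    case one
    then show ?case using hom_one[OF left[OF ab(2)]] A C by (auto simp: generate.one)
  next
    case (inv v)
    then show ?case
      using U V 1[of v b] ab(2) hom_inv[OF left[OF ab(2)], of v] A C C.generate_m_inv_closed[OF W(1), of "g v b"]
      by (simp add: subset_iff)
  next
    case (eng x y)
    then have "x \<in> carrier A" "y \<in> carrier A" using U by auto
    then show ?case
      using eng hom_mult[OF left[OF ab(2)], of x y] by (simp add: generate.eng)
  qed (use 1 V ab in auto)
  then show ?thesis using ab U by auto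
qed

section \<open>The tensor product of square groups\<close>

locale sg_pair =
  fixes M :: "('a, 'b) sq_group" and N :: "('c, 'd) sq_group"
  assumes sqM [simp]: "square_group M" and sqN [simp]: "square_group N"
begin

abbreviation TE where "TE \<equiv> tens_e M N"
abbreviation TEE where "TEE \<equiv> tens_ee M N"
abbreviation TE_mult (infixl \<open>\<bullet>\<close> 70) where "u \<bullet> v \<equiv> u \<otimes>\<^bsub>TE\<^esub> v"
abbreviation tens_cross where "tens_cross \<equiv> cross_effect TE TEE (tens_H M N)"
abbreviation cir where "cir \<equiv> circ M N"
abbreviation br where "br \<equiv> bar M N"
abbreviation pu where "pu \<equiv> pure_ee M N"
abbreviation gens_e where "gens_e \<equiv>
  {cir x y |x y. x \<in> car_e M \<and> y \<in> car_e N} \<union> {br a b |a b. a \<in> car_ee M \<and> b \<in> car_ee N}"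
abbreviation gens_ee where "gens_ee \<equiv> {pu a b |a b. a \<in> car_ee M \<and> b \<in> car_ee N}"

sublocale ab: ab_groups "lvl_ee M" "lvl_ee N"
  by (simp add: ab_groups_def square_group_ee)

sublocale TE: group TE
  by (simp add: tens_e_def group_presented_group)

sublocale TEE: comm_group TEE
  by (simp add: tens_ee_def ab.comm_group_ab_tensor)

lemma ab_tensor_fold [simp]: "ab_tensor (lvl_ee M) (lvl_ee N) = TEE"
  by (simp add: tens_ee_def)

lemmas pu_closed [simp] = ab.ab_pure_closed[folded tens_ee_def]
lemmas pu_add = ab.ab_pure_add_left[folded tens_ee_def] ab.ab_pure_add_right[folded tens_ee_def]
lemmas pu_simps [simp] = ab.ab_pure_simps[folded tens_ee_def]

lemma gens_simps [simp]:
  "Circ x y \<in> sg_gens M N \<longleftrightarrow> x \<in> car_e M \<and> y \<in> car_e N"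
  "Bar a b \<in> sg_gens M N \<longleftrightarrow> a \<in> car_ee M \<and> b \<in> car_ee N"
  by (auto simp: sg_gens_def)

lemma cir_closed [simp]: "x \<in> car_e M \<Longrightarrow> y \<in> car_e N \<Longrightarrow> cir x y \<in> carrier TE"
  by (simp add: circ_def tens_e_def)

lemma br_closed [simp]: "a \<in> car_ee M \<Longrightarrow> b \<in> car_ee N \<Longrightarrow> br a b \<in> carrier TE"
  by (simp add: bar_def tens_e_def)

lemma tens_e_generate:
  "generate TE gens_e = carrier TE"
proof -
  have "gen_class (sg_gens M N) (sg_rel M N) ` sg_gens M N =
      gens_e"
    by (auto simp: sg_gens_def circ_def bar_def)
  then show ?thesis
    using presented_group_generate[of "sg_gens M N" "sg_rel M N"] by (simp add: tens_e_def)
qed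

lemma tens_e_gens_closed:
  "gens_e \<subseteq> carrier TE"
  by auto

lemma tens_e_rel:
  assumes "sg_rel M N u v" "u \<in> words (sg_gens M N)" "v \<in> words (sg_gens M N)"
  shows "word_val TE (case_sg_gen cir br) u = word_val TE (case_sg_gen cir br) v"
proof -
  have "gen_class (sg_gens M N) (sg_rel M N) = case_sg_gen cir br"
  proof
    show "gen_class (sg_gens M N) (sg_rel M N) s = case_sg_gen cir br s" for s
      by (cases s) (simp_all add: circ_def bar_def)
  qed
  with presented_group_rel[where R = "sg_rel M N", OF assms] show ?thesis by (simp add: tens_e_def)
qed

lemma br_add_left:
  "a \<in> car_ee M \<Longrightarrow> a' \<in> car_ee M \<Longrightarrow> b \<in> car_ee N \<Longrightarrow> br (a \<oplus>\<^bsub>M\<^esub> a') b = br a b \<bullet> br a' b"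
  using tens_e_rel[OF sg_rel.bar_left[of a M a' b N]] by simp

lemma br_add_right:
  "a \<in> car_ee M \<Longrightarrow> b \<in> car_ee N \<Longrightarrow> b' \<in> car_ee N \<Longrightarrow> br a (b \<oplus>\<^bsub>N\<^esub> b') = br a b \<bullet> br a b'"
  using tens_e_rel[OF sg_rel.bar_right[of a M b N b']] by simp

lemma br_commute:
  assumes "a \<in> car_ee M" "b \<in> car_ee N" "u \<in> carrier TE"
  shows "br a b \<bullet> u = u \<bullet> br a b"
proof -
  have 1: "br a b \<bullet> cir x y = cir x y \<bullet> br a b" if "x \<in> car_e M" "y \<in> car_e N" for x y
    using tens_e_rel[OF sg_rel.bar_central[of a M b N "Circ x y"]] assms that by simp
  have 2: "br a b \<bullet> br a' b' = br a' b' \<bullet> br a b" if "a' \<in> car_ee M" "b' \<in> car_ee N" for a' b'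
    using tens_e_rel[OF sg_rel.bar_central[of a M b N "Bar a' b'"]] assms that by simp
  show ?thesis
    by (rule TE.commute_on_generate[OF tens_e_gens_closed])
      (use assms 1 2 in \<open>auto simp only: tens_e_generate br_closed\<close>)
qed

lemma cir_add_right:
  "x \<in> car_e M \<Longrightarrow> y \<in> car_e N \<Longrightarrow> y' \<in> car_e N \<Longrightarrow> cir x (y \<boxplus>\<^bsub>N\<^esub> y') = cir x y \<bullet> cir x y'"
  using tens_e_rel[OF sg_rel.circ_right[of x M y N y']] by simp

lemma cir_add_left:
  "x \<in> car_e M \<Longrightarrow> x' \<in> car_e M \<Longrightarrow> y \<in> car_e N \<Longrightarrow>
    cir (x \<boxplus>\<^bsub>M\<^esub> x') y = cir x y \<bullet> cir x' y \<bullet> br (crossH M x' x) (Hmap N y)"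
  using tens_e_rel[OF sg_rel.circ_left[of x M x' y N]] by (simp add: TE.m_assoc)

lemma cir_P_right: "x \<in> car_e M \<Longrightarrow> b \<in> car_ee N \<Longrightarrow> cir x (Pmap N b) = br (crossH M x x) b"
  using tens_e_rel[OF sg_rel.circ_P[of x M b N]] by simp

lemma cir_P_left: "a \<in> car_ee M \<Longrightarrow> y \<in> car_e N \<Longrightarrow> cir (Pmap M a) y = br a (Delta N y)"
  using tens_e_rel[OF sg_rel.P_circ[of a M y N]] by simp

lemma br_T: "a \<in> car_ee M \<Longrightarrow> b \<in> car_ee N \<Longrightarrow> br (Tmap M a) (Tmap N b) = inv\<^bsub>TE\<^esub> br a b"
  using tens_e_rel[OF sg_rel.bar_T[of a M b N]] by simp

text \<open>Centrality is asked against all of \<open>G\<close>, as is available when the values of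
  \<open>g\<close> lie in the image of the map \<open>P\<close> of a square group.\<close>

lemma tens_e_hom:
  assumes G: "group G"
    and f: "\<And>x y. x \<in> car_e M \<Longrightarrow> y \<in> car_e N \<Longrightarrow> f x y \<in> carrier G"
    and g: "\<And>a b. a \<in> car_ee M \<Longrightarrow> b \<in> car_ee N \<Longrightarrow> g a b \<in> carrier G"
    and rels: "\<And>a a' b. a \<in> car_ee M \<Longrightarrow> a' \<in> car_ee M \<Longrightarrow> b \<in> car_ee N \<Longrightarrow> g (a \<oplus>\<^bsub>M\<^esub> a') b = g a b \<otimes>\<^bsub>G\<^esub> g a' b"
      "\<And>a b b'. a \<in> car_ee M \<Longrightarrow> b \<in> car_ee N \<Longrightarrow> b' \<in> car_ee N \<Longrightarrow> g a (b \<oplus>\<^bsub>N\<^esub> b') = g a b \<otimes>\<^bsub>G\<^esub> g a b'"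
    and g_central: "\<And>a b u. a \<in> car_ee M \<Longrightarrow> b \<in> car_ee N \<Longrightarrow> u \<in> carrier G \<Longrightarrow> g a b \<otimes>\<^bsub>G\<^esub> u = u \<otimes>\<^bsub>G\<^esub> g a b"
    and rels': "\<And>x y y'. x \<in> car_e M \<Longrightarrow> y \<in> car_e N \<Longrightarrow> y' \<in> car_e N \<Longrightarrow> f x (y \<boxplus>\<^bsub>N\<^esub> y') = f x y \<otimes>\<^bsub>G\<^esub> f x y'"
      "\<And>x x' y. x \<in> car_e M \<Longrightarrow> x' \<in> car_e M \<Longrightarrow> y \<in> car_e N \<Longrightarrow>
       f (x \<boxplus>\<^bsub>M\<^esub> x') y = f x y \<otimes>\<^bsub>G\<^esub> f x' y \<otimes>\<^bsub>G\<^esub> g (crossH M x' x) (Hmap N y)"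
      "\<And>x b. x \<in> car_e M \<Longrightarrow> b \<in> car_ee N \<Longrightarrow> f x (Pmap N b) = g (crossH M x x) b"
      "\<And>a y. a \<in> car_ee M \<Longrightarrow> y \<in> car_e N \<Longrightarrow> f (Pmap M a) y = g a (Delta N y)"
      "\<And>a b. a \<in> car_ee M \<Longrightarrow> b \<in> car_ee N \<Longrightarrow> g (Tmap M a) (Tmap N b) = inv\<^bsub>G\<^esub> g a b"
  shows "\<exists>h \<in> hom TE G. (\<forall>x \<in> car_e M. \<forall>y \<in> car_e N. h (cir x y) = f x y) \<and>
    (\<forall>a \<in> car_ee M. \<forall>b \<in> car_ee N. h (br a b) = g a b)"
proof -
  interpret G: group G by fact
  have "word_val G (case_sg_gen f g) u = word_val G (case_sg_gen f g) v"
    if "sg_rel M N u v" "u \<in> words (sg_gens M N)" "v \<in> words (sg_gens M N)" for u v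
    using that
  proof (cases rule: sg_rel.cases)
    case (bar_central a b s)
    then show ?thesis using that f g g_central[of a b "case_sg_gen f g s"] by (cases s) simp_all
  qed (simp_all add: f g rels rels' G.m_assoc)
  then have "\<exists>h \<in> hom TE G. \<forall>s \<in> sg_gens M N. h (gen_class (sg_gens M N) (sg_rel M N) s) = case_sg_gen f g s"
    unfolding tens_e_def using f g by (intro presented_group_hom[OF G]) (auto simp: sg_gens_def)
  then obtain h where h: "h \<in> hom TE G"
    "\<And>s. s \<in> sg_gens M N \<Longrightarrow> h (gen_class (sg_gens M N) (sg_rel M N) s) = case_sg_gen f g s"
    by blast
  then show ?thesis
    using h(2)[of "Circ _ _"] h(2)[of "Bar _ _"] by (intro bexI[of _ h]) (auto simp: circ_def bar_def)
qed

lemma tens_ee_generate: "generate TEE gens_ee = carrier TEE"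
  using ab.ab_tensor_generate by simp

lemma tens_ee_gens_closed: "gens_ee \<subseteq> carrier TEE"
  by auto

section \<open>The maps \<open>P\<close> and \<open>H\<close> of the tensor product\<close>

lemma tens_P_props:
  "tens_P M N \<in> hom TEE TE"
  "a \<in> car_ee M \<Longrightarrow> b \<in> car_ee N \<Longrightarrow> tens_P M N (pu a b) = br a b"
proof -
  let ?C = "\<lambda>p. p \<in> hom TEE TE \<inter> extensional (carrier TEE) \<and>
     (\<forall>a \<in> car_ee M. \<forall>b \<in> car_ee N. p (pu a b) = br a b)"
  have "\<exists>h \<in> hom TEE TE. \<forall>a \<in> car_ee M. \<forall>b \<in> car_ee N. h (pu a b) = br a b"
    by (rule ab.ab_tensor_hom[unfolded ab_tensor_fold]) (simp_all add: TE.group_axioms br_add_left br_add_right br_commute[OF _ _ br_closed])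
  then obtain h where h: "h \<in> hom TEE TE" "\<forall>a \<in> car_ee M. \<forall>b \<in> car_ee N. h (pu a b) = br a b" by blast
  have 1: "?C (restrict h (carrier TEE))"
    using h TEE.hom_eq[OF h(1), of "restrict h (carrier TEE)"] by auto
  have 2: "p = p'" if "?C p" "?C p'" for p p'
  proof (rule extensionalityI)
    show "p x = p' x" if "x \<in> carrier TEE" for x
      by (rule hom_eq_on_generate[where f = p and g = p', OF TEE.group_axioms TE.group_axioms _ _ tens_ee_gens_closed])
        (use \<open>?C p\<close> \<open>?C p'\<close> that in \<open>auto simp: tens_ee_generate\<close>)
  qed (use that in auto)
  have "?C (tens_P M N)"
    unfolding tens_P_def by (rule theI[where P = ?C, OF 1]) (rule 2[OF _ 1])
  then show "tens_P M N \<in> hom TEE TE"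
    "a \<in> car_ee M \<Longrightarrow> b \<in> car_ee N \<Longrightarrow> tens_P M N (pu a b) = br a b" by auto
qed

definition H_gen :: "('a, 'b, 'c, 'd) sg_gen \<Rightarrow> ('b \<times> 'd) word set" where
  "H_gen = case_sg_gen (\<lambda>x y. pu (crossH M x x) (Hmap N y) \<otimes>\<^bsub>TEE\<^esub> pu (Hmap M x) (Delta N y))
     (\<lambda>a b. pu a b \<otimes>\<^bsub>TEE\<^esub> inv\<^bsub>TEE\<^esub> pu (Tmap M a) (Tmap N b))"

text \<open>The value is zero as soon as a \<open>Bar\<close> occurs, because these elements are to
  generate the image of \<open>P\<close>, where cross-effects vanish.\<close>

definition cross_gen :: "('a, 'b, 'c, 'd) sg_gen \<Rightarrow> ('a, 'b, 'c, 'd) sg_gen \<Rightarrow> ('b \<times> 'd) word set" where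
  "cross_gen = (\<lambda>s t. case s of Bar _ _ \<Rightarrow> \<one>\<^bsub>TEE\<^esub> | Circ x y \<Rightarrow>
     (case t of Bar _ _ \<Rightarrow> \<one>\<^bsub>TEE\<^esub> | Circ x' y' \<Rightarrow> pu (crossH M x x') (crossH N y y')))"

lemma gen_simps [simp]:
  "H_gen (Circ x y) = pu (crossH M x x) (Hmap N y) \<otimes>\<^bsub>TEE\<^esub> pu (Hmap M x) (Delta N y)"
  "H_gen (Bar a b) = pu a b \<otimes>\<^bsub>TEE\<^esub> inv\<^bsub>TEE\<^esub> pu (Tmap M a) (Tmap N b)"
  "cross_gen (Circ x y) (Circ x' y') = pu (crossH M x x') (crossH N y y')"
  "cross_gen (Bar a b) t = \<one>\<^bsub>TEE\<^esub>" "cross_gen s (Bar a b) = \<one>\<^bsub>TEE\<^esub>"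
  by (simp_all add: H_gen_def cross_gen_def split: sg_gen.split)

lemma cross_gen_closed: "s \<in> sg_gens M N \<Longrightarrow> t \<in> sg_gens M N \<Longrightarrow> cross_gen s t \<in> carrier TEE"
  by (cases s; cases t) simp_all

text \<open>The cross-effect respects the relations because \<open>crossH\<close> is biadditive and
  vanishes on the image of \<open>P\<close>. For the values, \<open>circ_P\<close> and
  \<open>P_circ\<close> reduce to \<open>H P = T + 1\<close> together with
  \<open>T (x|x) = - (x|x)\<close> and \<open>T Delta = - Delta\<close>.\<close>

lemma tens_H_exists:
  "\<exists>h. quadratic TE TEE h \<and>
    (\<forall>s \<in> sg_gens M N. h (gen_class (sg_gens M N) (sg_rel M N) s) = H_gen s) \<and>
    (\<forall>s \<in> sg_gens M N. \<forall>t \<in> sg_gens M N.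
       cross_effect TE TEE h (gen_class (sg_gens M N) (sg_rel M N) s) (gen_class (sg_gens M N) (sg_rel M N) t)
         = cross_gen s t)"
  unfolding tens_e_def
proof (rule presented_group_quadratic)
  show "comm_group TEE" by (rule TEE.comm_group_axioms)
  show "H_gen \<in> sg_gens M N \<rightarrow> carrier TEE" by (auto simp: sg_gens_def)
  show "cross_gen s t \<in> carrier TEE" if "s \<in> sg_gens M N" "t \<in> sg_gens M N" for s t
    using that by (rule cross_gen_closed)
  show "word_val TEE (\<lambda>g'. cross_gen g' s) u = word_val TEE (\<lambda>g'. cross_gen g' s) v"
    "word_val TEE (cross_gen s) u = word_val TEE (cross_gen s) v"
    if r: "sg_rel M N u v" and "u \<in> words (sg_gens M N)" "v \<in> words (sg_gens M N)"
      and s: "s \<in> sg_gens M N" for u v s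
  proof -
    show "word_val TEE (\<lambda>g'. cross_gen g' s) u = word_val TEE (\<lambda>g'. cross_gen g' s) v"
    proof (cases s)
      case (Circ x0 y0)
      then have [simp]: "x0 \<in> car_e M" "y0 \<in> car_e N" using s by auto
      show ?thesis
        using r
      proof (cases rule: sg_rel.cases)
        case (bar_central a b g)
        then show ?thesis using Circ cross_gen_closed[of g s] s by simp
      qed (simp_all add: Circ crossH_add pu_add TEE.m_assoc)
    qed (simp add: TEE.word_val_one)
    show "word_val TEE (cross_gen s) u = word_val TEE (cross_gen s) v"
    proof (cases s)
      case (Circ x0 y0)
      then have [simp]: "x0 \<in> car_e M" "y0 \<in> car_e N" using s by auto
      show ?thesis
        using r
      proof (cases rule: sg_rel.cases)
        case (bar_central a b g)
        then show ?thesis using Circ cross_gen_closed[of s g] s by simp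
      qed (simp_all add: Circ crossH_add pu_add TEE.m_assoc)
    next
      case (Bar a0 b0)
      then have eq: "cross_gen s = (\<lambda>_. \<one>\<^bsub>TEE\<^esub>)" by (simp add: fun_eq_iff)
      have "word_val TEE (cross_gen s) w = \<one>\<^bsub>TEE\<^esub>" for w
        using arg_cong[OF eq, of "\<lambda>f. word_val TEE f w"] by (simp add: TEE.word_val_one)
      then show ?thesis by simp
    qed
  qed
  show "quad_val TEE H_gen cross_gen u = quad_val TEE H_gen cross_gen v"
    if "sg_rel M N u v" "u \<in> words (sg_gens M N)" "v \<in> words (sg_gens M N)" for u v
    using that
  proof (cases rule: sg_rel.cases)
    case (bar_left a a' b)
    then show ?thesis by (simp add: pu_add Tmap_add TEE.inv_mult TEE.m_ac)
  next
    case (bar_right a b b')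
    then show ?thesis by (simp add: pu_add Tmap_add TEE.inv_mult TEE.m_ac)
  next
    case (bar_central a b g)
    then show ?thesis using that by (cases g) (simp_all add: TEE.m_ac)
  next
    case (circ_right x y y')
    then show ?thesis by (simp add: pu_add Delta_add Hmap_add TEE.m_ac)
  next
    \<comment> \<open>The two sides differ by \<open>(x|x')\<close> tensored with
      \<open>Delta y + H y - T (H y) - (y|y)\<close>, which is zero by
      \<open>Delta_eq\<close>.\<close>
    case (circ_left x x' y)
    then show ?thesis
      by (simp add: pu_add Delta_eq Hmap_add crossH_add Tmap_crossH TEE.inv_mult
          TEE.sub_norm TEE.sub_closed TEE.m_ac)
  next
    case (circ_P x b)
    then show ?thesis by (simp add: pu_add HP_eq Tmap_crossH TEE.m_ac)
  next
    case (P_circ a y)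
    then show ?thesis by (simp add: pu_add HP_eq Tmap_Delta TEE.m_ac)
  next
    case (bar_T a b)
    then show ?thesis by (simp add: TEE.inv_mult TEE.m_ac)
  qed
qed

text \<open>The predicate of the definite description \<open>tens_H\<close>, named so that existence
  and uniqueness can be argued for it.\<close>

definition tens_H_spec :: "(('a, 'b, 'c, 'd) sg_gen word set \<Rightarrow> ('b \<times> 'd) word set) \<Rightarrow> bool" where
  "tens_H_spec h \<longleftrightarrow> quadratic TE TEE h \<and> h \<in> extensional (carrier TE) \<and>
     (\<forall>x \<in> car_e M. \<forall>y \<in> car_e N. \<forall>x' \<in> car_e M. \<forall>y' \<in> car_e N.
        cross_effect TE TEE h (cir x y) (cir x' y') = pu (crossH M x x') (crossH N y y')) \<and>
     (\<forall>u \<in> carrier TE. \<forall>a \<in> car_ee M. \<forall>b \<in> car_ee N.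
        cross_effect TE TEE h u (br a b) = \<one>\<^bsub>TEE\<^esub> \<and> cross_effect TE TEE h (br a b) u = \<one>\<^bsub>TEE\<^esub>) \<and>
     (\<forall>x \<in> car_e M. \<forall>y \<in> car_e N.
        h (cir x y) = pu (crossH M x x) (Hmap N y) \<otimes>\<^bsub>TEE\<^esub> pu (Hmap M x) (Delta N y)) \<and>
     (\<forall>a \<in> car_ee M. \<forall>b \<in> car_ee N.
        h (br a b) = pu a b \<otimes>\<^bsub>TEE\<^esub> inv\<^bsub>TEE\<^esub> pu (Tmap M a) (Tmap N b))"

lemma tens_H_spec: "tens_H_spec (tens_H M N)"
proof -
  obtain h0 where q0: "quadratic TE TEE h0"
    and h0: "\<And>s. s \<in> sg_gens M N \<Longrightarrow> h0 (gen_class (sg_gens M N) (sg_rel M N) s) = H_gen s"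
    and c0: "\<And>s t. s \<in> sg_gens M N \<Longrightarrow> t \<in> sg_gens M N \<Longrightarrow>
      cross_effect TE TEE h0 (gen_class (sg_gens M N) (sg_rel M N) s) (gen_class (sg_gens M N) (sg_rel M N) t)
        = cross_gen s t"
    using tens_H_exists by blast
  define h where "h = restrict h0 (carrier TE)"
  have heq: "h u = h0 u" if "u \<in> carrier TE" for u using that by (simp add: h_def)
  have ce: "cross_effect TE TEE h u v = cross_effect TE TEE h0 u v" if "u \<in> carrier TE" "v \<in> carrier TE" for u v
    using that by (simp add: cross_effect_def heq)
  have q: "quadratic TE TEE h"
  proof -
    have 1: "(\<lambda>x. cross_effect TE TEE h x y) \<in> hom TE TEE" if "y \<in> carrier TE" for y
    proof (rule TE.hom_eq)
      show "(\<lambda>x. cross_effect TE TEE h0 x y) \<in> hom TE TEE" using q0 that by (simp add: quadratic_def)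
    qed (simp add: ce that)
    have 2: "cross_effect TE TEE h x \<in> hom TE TEE" if "x \<in> carrier TE" for x
    proof (rule TE.hom_eq)
      show "cross_effect TE TEE h0 x \<in> hom TE TEE" using q0 that by (simp add: quadratic_def)
    qed (simp add: ce that)
    show ?thesis using 1 2 q0 by (auto simp: quadratic_def heq)
  qed
  have cc: "cross_effect TE TEE h (cir x y) (cir x' y') = pu (crossH M x x') (crossH N y y')"
    if "x \<in> car_e M" "y \<in> car_e N" "x' \<in> car_e M" "y' \<in> car_e N" for x y x' y'
    using that c0[of "Circ x y" "Circ x' y'"] by (simp add: ce) (simp add: circ_def)
  have trivial: "(\<lambda>_. \<one>\<^bsub>TEE\<^esub>) \<in> hom TE TEE" by (rule homI) simp_all
  \<comment> \<open>The construction controls cross-effects between generators; the specification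
    asks for all \<open>u\<close>, and additivity in \<open>u\<close> closes the gap.\<close>
  have cb: "cross_effect TE TEE h u (br a b) = \<one>\<^bsub>TEE\<^esub>" "cross_effect TE TEE h (br a b) u = \<one>\<^bsub>TEE\<^esub>"
    if u: "u \<in> carrier TE" and ab: "a \<in> car_ee M" "b \<in> car_ee N" for u a b
  proof -
    have 1: "cross_effect TE TEE h0 s (br a b) = \<one>\<^bsub>TEE\<^esub>" "cross_effect TE TEE h0 (br a b) s = \<one>\<^bsub>TEE\<^esub>"
      if s: "s \<in> gens_e" for s
    proof -
      from s obtain g where g: "g \<in> sg_gens M N" "s = gen_class (sg_gens M N) (sg_rel M N) g"
        unfolding circ_def bar_def by (blast intro: gens_simps[THEN iffD2])
      show "cross_effect TE TEE h0 s (br a b) = \<one>\<^bsub>TEE\<^esub>" "cross_effect TE TEE h0 (br a b) s = \<one>\<^bsub>TEE\<^esub>"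
        using c0[OF g(1), of "Bar a b"] c0[OF _ g(1), of "Bar a b"] ab g(2) by (simp_all add: bar_def)
    qed
    have 2: "(\<lambda>u. cross_effect TE TEE h u (br a b)) \<in> hom TE TEE" "cross_effect TE TEE h (br a b) \<in> hom TE TEE"
      using q ab by (auto simp: quadratic_def)
    have S: "s \<in> carrier TE" if "s \<in> gens_e" for s using that tens_e_gens_closed by blast
    show "cross_effect TE TEE h u (br a b) = \<one>\<^bsub>TEE\<^esub>"
      by (rule hom_eq_on_generate[OF TE.group_axioms TEE.group_axioms 2(1) trivial tens_e_gens_closed])
        (use u ab 1 S in \<open>simp_all only: tens_e_generate ce br_closed\<close>)
    show "cross_effect TE TEE h (br a b) u = \<one>\<^bsub>TEE\<^esub>"
      by (rule hom_eq_on_generate[OF TE.group_axioms TEE.group_axioms 2(2) trivial tens_e_gens_closed])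
        (use u ab 1 S in \<open>simp_all only: tens_e_generate ce br_closed\<close>)
  qed
  have "tens_H_spec h"
    unfolding tens_H_spec_def
    using q cc cb h0[of "Circ _ _"] h0[of "Bar _ _"] by (simp add: heq) (simp add: h_def circ_def bar_def)
  moreover have "f = g" if fg: "tens_H_spec f" "tens_H_spec g" for f g
  proof (rule extensionalityI)
    show "f \<in> extensional (carrier TE)" "g \<in> extensional (carrier TE)" using fg by (auto simp: tens_H_spec_def)
    show "f x = g x" if "x \<in> carrier TE" for x
    proof (rule quadratic_eqI[OF _ _ TE.group_axioms TEE.comm_group_axioms tens_e_gens_closed tens_e_generate _ _ that])
      show "quadratic TE TEE f" "quadratic TE TEE g" using fg by (auto simp: tens_H_spec_def)
    qed (use fg in \<open>auto simp: tens_H_spec_def\<close>)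
  qed
  ultimately have "tens_H_spec (THE h. tens_H_spec h)" by (metis theI)
  then show ?thesis unfolding tens_H_def tens_H_spec_def by simp
qed

lemma tens_H_props:
  "quadratic TE TEE (tens_H M N)"
  "\<lbrakk>x \<in> car_e M; y \<in> car_e N; x' \<in> car_e M; y' \<in> car_e N\<rbrakk> \<Longrightarrow>
     tens_cross (cir x y) (cir x' y') = pu (crossH M x x') (crossH N y y')"
  "\<lbrakk>u \<in> carrier TE; a \<in> car_ee M; b \<in> car_ee N\<rbrakk> \<Longrightarrow> tens_cross u (br a b) = \<one>\<^bsub>TEE\<^esub>"
  "\<lbrakk>u \<in> carrier TE; a \<in> car_ee M; b \<in> car_ee N\<rbrakk> \<Longrightarrow> tens_cross (br a b) u = \<one>\<^bsub>TEE\<^esub>"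
  "\<lbrakk>x \<in> car_e M; y \<in> car_e N\<rbrakk> \<Longrightarrow>
     tens_H M N (cir x y) = pu (crossH M x x) (Hmap N y) \<otimes>\<^bsub>TEE\<^esub> pu (Hmap M x) (Delta N y)"
  "\<lbrakk>a \<in> car_ee M; b \<in> car_ee N\<rbrakk> \<Longrightarrow>
     tens_H M N (br a b) = pu a b \<otimes>\<^bsub>TEE\<^esub> inv\<^bsub>TEE\<^esub> pu (Tmap M a) (Tmap N b)"
  using tens_H_spec by (auto simp: tens_H_spec_def)

lemma P_central_tens: "a \<in> carrier TEE \<Longrightarrow> u \<in> carrier TE \<Longrightarrow> tens_P M N a \<bullet> u = u \<bullet> tens_P M N a"
proof -
  assume a: "a \<in> carrier TEE" and u: "u \<in> carrier TE"
  interpret P: group_hom TEE TE "tens_P M N"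
    by (simp add: group_hom_def group_hom_axioms_def TE.group_axioms TEE.group_axioms tens_P_props)
  have "tens_P M N ` gens_ee \<subseteq> carrier TE" by auto
  moreover have "u \<bullet> s = s \<bullet> u" if "s \<in> tens_P M N ` gens_ee" for s
    using that u by (auto simp: tens_P_props br_commute)
  moreover have "tens_P M N a \<in> generate TE (tens_P M N ` gens_ee)"
    using a by (simp add: P.generate_img[OF tens_ee_gens_closed] tens_ee_generate)
  ultimately have "u \<bullet> tens_P M N a = tens_P M N a \<bullet> u"
    by (rule TE.commute_on_generate[OF _ u])
  then show ?thesis ..
qed

text \<open>Expand \<open>(x + x') \<circledcirc> (y + y')\<close> in both orders. The outer
  summands cancel and the middle ones appear in opposite order, which leaves the commutator; its
  value is the cross-effect part of \<open>H (y + y')\<close>.\<close>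

lemma cir_commutator:
  assumes [simp]: "x \<in> car_e M" "x' \<in> car_e M" "y \<in> car_e N" "y' \<in> car_e N"
  shows "cir x' y \<bullet> cir x y' = cir x y' \<bullet> cir x' y \<bullet> br (crossH M x' x) (crossH N y y')"
proof -
  have comm: "br a b \<bullet> (u \<bullet> v) = u \<bullet> (br a b \<bullet> v)"
    if "a \<in> car_ee M" "b \<in> car_ee N" "u \<in> carrier TE" "v \<in> carrier TE" for a b u v
    using that br_commute[of a b u] by (simp flip: TE.m_assoc)
  let ?p = "br (crossH M x' x) (Hmap N y)" and ?q = "br (crossH M x' x) (Hmap N y')"
    and ?s = "br (crossH M x' x) (crossH N y y')"
  have "cir x y \<bullet> ((cir x' y \<bullet> cir x y') \<bullet> (cir x' y' \<bullet> (?p \<bullet> ?q)))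
      = cir (x \<boxplus>\<^bsub>M\<^esub> x') y \<bullet> cir (x \<boxplus>\<^bsub>M\<^esub> x') y'"
    by (simp add: cir_add_left TE.m_assoc comm[of _ _ "cir _ _"])
  also have "\<dots> = cir (x \<boxplus>\<^bsub>M\<^esub> x') (y \<boxplus>\<^bsub>N\<^esub> y')"
    by (simp add: cir_add_right)
  also have "\<dots> = cir x (y \<boxplus>\<^bsub>N\<^esub> y') \<bullet> cir x' (y \<boxplus>\<^bsub>N\<^esub> y') \<bullet> br (crossH M x' x) (Hmap N (y \<boxplus>\<^bsub>N\<^esub> y'))"
    by (rule cir_add_left) simp_all
  also have "\<dots> = cir x y \<bullet> ((cir x y' \<bullet> cir x' y) \<bullet> (cir x' y' \<bullet> (?p \<bullet> (?q \<bullet> ?s))))"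
    by (simp add: cir_add_right Hmap_add br_add_right TE.m_assoc)
  also have "\<dots> = cir x y \<bullet> ((cir x y' \<bullet> cir x' y \<bullet> ?s) \<bullet> (cir x' y' \<bullet> (?p \<bullet> ?q)))"
    using comm[of "crossH M x' x" "crossH N y y'" "cir x' y'"] br_commute[of "crossH M x' x" "crossH N y y'" "?p \<bullet> ?q"]
    by (simp add: TE.m_assoc)
  finally show ?thesis
    using TE.Units_l_cancel TE.right_cancel by simp
qed

end

text \<open>These are the relations of the tensor product with \<open>Pmap K (p a b)\<close> in
  place of \<open>bar M N a b\<close>, and compatibility with \<open>H\<close> on generators. The
  relation \<open>bar_T\<close> appears as \<open>Tmap_p\<close>, an equation in the
  \<open>ee\<close>-level: compatibility with \<open>H\<close> on \<open>bar M N a b\<close>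
  requires it, and \<open>P T = P\<close> brings back the relation itself.\<close>

locale sg_bimor =
  fixes M :: "('a, 'b) sq_group" and N :: "('c, 'd) sq_group" and K :: "('k, 'l) sq_group"
    and f :: "'a \<Rightarrow> 'c \<Rightarrow> 'k" and p :: "'b \<Rightarrow> 'd \<Rightarrow> 'l"
  assumes sq_M [simp]: "square_group M" and sq_N [simp]: "square_group N" and sq_K [simp]: "square_group K"
    and f_closed [simp]: "\<lbrakk>x \<in> car_e M; y \<in> car_e N\<rbrakk> \<Longrightarrow> f x y \<in> car_e K"
    and p_closed [simp]: "\<lbrakk>a \<in> car_ee M; b \<in> car_ee N\<rbrakk> \<Longrightarrow> p a b \<in> car_ee K"
    and p_add_left: "\<lbrakk>a \<in> car_ee M; a' \<in> car_ee M; b \<in> car_ee N\<rbrakk> \<Longrightarrow> p (a \<oplus>\<^bsub>M\<^esub> a') b = p a b \<oplus>\<^bsub>K\<^esub> p a' b"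
    and p_add_right: "\<lbrakk>a \<in> car_ee M; b \<in> car_ee N; b' \<in> car_ee N\<rbrakk> \<Longrightarrow> p a (b \<oplus>\<^bsub>N\<^esub> b') = p a b \<oplus>\<^bsub>K\<^esub> p a b'"
    and f_add_right: "\<lbrakk>x \<in> car_e M; y \<in> car_e N; y' \<in> car_e N\<rbrakk> \<Longrightarrow> f x (y \<boxplus>\<^bsub>N\<^esub> y') = f x y \<boxplus>\<^bsub>K\<^esub> f x y'"
    and f_add_left: "\<lbrakk>x \<in> car_e M; x' \<in> car_e M; y \<in> car_e N\<rbrakk> \<Longrightarrow>
       f (x \<boxplus>\<^bsub>M\<^esub> x') y = f x y \<boxplus>\<^bsub>K\<^esub> f x' y \<boxplus>\<^bsub>K\<^esub> Pmap K (p (crossH M x' x) (Hmap N y))"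
    and f_P_right: "\<lbrakk>x \<in> car_e M; b \<in> car_ee N\<rbrakk> \<Longrightarrow> f x (Pmap N b) = Pmap K (p (crossH M x x) b)"
    and f_P_left: "\<lbrakk>a \<in> car_ee M; y \<in> car_e N\<rbrakk> \<Longrightarrow> f (Pmap M a) y = Pmap K (p a (Delta N y))"
    and Tmap_p: "\<lbrakk>a \<in> car_ee M; b \<in> car_ee N\<rbrakk> \<Longrightarrow> Tmap K (p a b) = \<ominus>\<^bsub>K\<^esub> p (Tmap M a) (Tmap N b)"
    and crossH_f: "\<lbrakk>x \<in> car_e M; y \<in> car_e N; x' \<in> car_e M; y' \<in> car_e N\<rbrakk> \<Longrightarrow>
       crossH K (f x y) (f x' y') = p (crossH M x x') (crossH N y y')"
    and Hmap_f: "\<lbrakk>x \<in> car_e M; y \<in> car_e N\<rbrakk> \<Longrightarrow>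
       Hmap K (f x y) = p (crossH M x x) (Hmap N y) \<oplus>\<^bsub>K\<^esub> p (Hmap M x) (Delta N y)"
begin

lemma p_hom_left: "b \<in> car_ee N \<Longrightarrow> (\<lambda>a. p a b) \<in> hom (lvl_ee M) (lvl_ee K)"
  by (rule homI) (simp_all add: p_add_left)

lemma p_hom_right: "a \<in> car_ee M \<Longrightarrow> p a \<in> hom (lvl_ee N) (lvl_ee K)"
  by (rule homI) (simp_all add: p_add_right)

lemma f_hom_right: "x \<in> car_e M \<Longrightarrow> f x \<in> hom (lvl_e N) (lvl_e K)"
  by (rule homI) (simp_all add: f_add_right)

lemma p_simps [simp]:
  "b \<in> car_ee N \<Longrightarrow> p \<zero>\<^bsub>M\<^esub> b = \<zero>\<^bsub>K\<^esub>"
  "a \<in> car_ee M \<Longrightarrow> p a \<zero>\<^bsub>N\<^esub> = \<zero>\<^bsub>K\<^esub>"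
  "a \<in> car_ee M \<Longrightarrow> b \<in> car_ee N \<Longrightarrow> p (\<ominus>\<^bsub>M\<^esub> a) b = \<ominus>\<^bsub>K\<^esub> p a b"
  "a \<in> car_ee M \<Longrightarrow> b \<in> car_ee N \<Longrightarrow> p a (\<ominus>\<^bsub>N\<^esub> b) = \<ominus>\<^bsub>K\<^esub> p a b"
  using hom_one[OF p_hom_left] hom_one[OF p_hom_right] hom_inv[OF p_hom_left] hom_inv[OF p_hom_right]
  by (auto simp: square_group_ee')

lemma f_zero [simp]: "x \<in> car_e M \<Longrightarrow> f x \<zero>\<^sub>e\<^bsub>N\<^esub> = \<zero>\<^sub>e\<^bsub>K\<^esub>"
  using hom_one[OF f_hom_right] by (simp add: square_group_e)

lemma f_neg_right: "x \<in> car_e M \<Longrightarrow> y \<in> car_e N \<Longrightarrow> f x (\<boxminus>\<^bsub>N\<^esub> y) = \<boxminus>\<^bsub>K\<^esub> f x y"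
  using hom_inv[OF f_hom_right] by (simp add: square_group_e)

lemma P_p_T: "a \<in> car_ee M \<Longrightarrow> b \<in> car_ee N \<Longrightarrow> Pmap K (p (Tmap M a) (Tmap N b)) = \<boxminus>\<^bsub>K\<^esub> Pmap K (p a b)"
proof -
  assume ab: "a \<in> car_ee M" "b \<in> car_ee N"
  then have "p (Tmap M a) (Tmap N b) = \<ominus>\<^bsub>K\<^esub> Tmap K (p a b)" by (simp add: Tmap_p)
  then show ?thesis using ab by (simp add: Pmap_neg del: P_Tmap) (simp add: P_Tmap)
qed

text \<open>Apply \<open>T H - H\<close> plus the diagonal cross-effect to \<open>f x y\<close>. The
  terms with first entry \<open>(x|x)\<close> add up to \<open>p (x|x) (Delta y)\<close> by the
  formula for \<open>Delta y\<close>, those with \<open>H x\<close> to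
  \<open>p (T (H x) - H x) (Delta y)\<close>. \<open>Delta N y\<close> is unfolded only after
  \<open>Tmap_Delta\<close> has been applied to it.\<close>

lemma Delta_f: "x \<in> car_e M \<Longrightarrow> y \<in> car_e N \<Longrightarrow> Delta K (f x y) = p (Delta M x) (Delta N y)"
  by (simp add: Delta_eq[of K] Hmap_f Tmap_add Tmap_p crossH_f Tmap_crossH Tmap_Delta)
    (simp add: Delta_eq p_add_left p_add_right ee_neg_add, simp add: ee_norm ee_ac)

end

section \<open>The tensor product as a square group and its universal property\<close>

context sg_pair
begin

abbreviation MN where "MN \<equiv> sg_tensor M N"

lemma sg_tensor_simps:
  "lvl_e MN = TE" "lvl_ee MN = TEE" "Hmap MN = tens_H M N" "Pmap MN = tens_P M N"
  by (simp_all add: sg_tensor_def)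

lemma cross_P_tens:
  assumes w: "w \<in> carrier TEE" and u: "u \<in> carrier TE"
  shows "tens_cross (tens_P M N w) u = \<one>\<^bsub>TEE\<^esub>"
    "tens_cross u (tens_P M N w) = \<one>\<^bsub>TEE\<^esub>"
proof -
  have trivial: "(\<lambda>_. \<one>\<^bsub>TEE\<^esub>) \<in> hom TEE TEE" by (rule homI) simp_all
  have "(\<lambda>v. tens_cross v u) \<in> hom TE TEE" "tens_cross u \<in> hom TE TEE"
    using tens_H_props(1) u by (auto simp: quadratic_def)
  from this[THEN hom_compose[OF tens_P_props(1)]]
  have 1: "(\<lambda>w. tens_cross (tens_P M N w) u) \<in> hom TEE TEE"
    and 2: "(\<lambda>w. tens_cross u (tens_P M N w)) \<in> hom TEE TEE" by (simp_all add: comp_def)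
  show "tens_cross (tens_P M N w) u = \<one>\<^bsub>TEE\<^esub>"
    by (rule hom_eq_on_generate[OF TEE.group_axioms TEE.group_axioms 1 trivial tens_ee_gens_closed])
      (use w u in \<open>auto simp: tens_ee_generate tens_P_props tens_H_props\<close>)
  show "tens_cross u (tens_P M N w) = \<one>\<^bsub>TEE\<^esub>"
    by (rule hom_eq_on_generate[OF TEE.group_axioms TEE.group_axioms 2 trivial tens_ee_gens_closed])
      (use w u in \<open>auto simp: tens_ee_generate tens_P_props tens_H_props\<close>)
qed

text \<open>On generators this is \<open>cir_commutator\<close>, or trivial because one of them is
  central. As \<open>P\<close> of the cross-effect is biadditive with central values, the formula
  spreads to one variable and then to the other.\<close>

lemma tens_commutator:
  assumes u: "u \<in> carrier TE" and v: "v \<in> carrier TE"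
  shows "u \<bullet> v = v \<bullet> u \<bullet> tens_P M N (tens_cross u v)"
proof -
  define c where "c = tens_cross"
  have hc: "(\<lambda>u. c u v) \<in> hom TE TEE" "c v \<in> hom TE TEE" if "v \<in> carrier TE" for v
    using that tens_H_props(1) by (auto simp: quadratic_def c_def)
  note Pc = this[THEN hom_compose[OF _ tens_P_props(1)], unfolded comp_def]
  have cl: "c u v \<in> carrier TEE" if "u \<in> carrier TE" "v \<in> carrier TE" for u v
    using hc that by (auto simp: hom_def)
  have Pcl: "tens_P M N w \<in> carrier TE" if "w \<in> carrier TEE" for w
    using tens_P_props(1) that by (auto simp: hom_def)
  have P1: "tens_P M N \<one>\<^bsub>TEE\<^esub> = \<one>\<^bsub>TE\<^esub>"
    by (rule hom_one[OF tens_P_props(1)]) (simp_all add: TE.group_axioms TEE.group_axioms)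
  have S: "s \<in> carrier TE" if "s \<in> gens_e" for s using that tens_e_gens_closed by blast
  have 1: "s \<bullet> t = t \<bullet> s \<bullet> tens_P M N (c s t)" if st: "s \<in> gens_e" "t \<in> gens_e" for s t
  proof -
    have "s \<bullet> t = t \<bullet> s \<bullet> tens_P M N (c s t)"
      if "s = br a b \<or> t = br a b" "a \<in> car_ee M" "b \<in> car_ee N" for a b
    proof -
      have "c s t = \<one>\<^bsub>TEE\<^esub>" unfolding c_def
        using that(1) tens_H_props(3)[OF S[OF st(1)] that(2,3)] tens_H_props(4)[OF S[OF st(2)] that(2,3)] by metis
      moreover have "s \<bullet> t = t \<bullet> s"
        using that(1) br_commute[OF that(2,3) S[OF st(1)]] br_commute[OF that(2,3) S[OF st(2)]] by metis
      ultimately show ?thesis using S[OF st(1)] S[OF st(2)] by (simp add: P1)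
    qed
    moreover have "s \<bullet> t = t \<bullet> s \<bullet> tens_P M N (c s t)"
      if "s = cir x y" "t = cir x' y'" "x \<in> car_e M" "y \<in> car_e N" "x' \<in> car_e M" "y' \<in> car_e N" for x y x' y'
      using that cir_commutator[of x' x y y'] by (simp add: c_def tens_H_props tens_P_props)
    ultimately show ?thesis using st by blast
  qed
  have 2: "u \<bullet> t = t \<bullet> u \<bullet> tens_P M N (c u t)" if t: "t \<in> gens_e" and u: "u \<in> carrier TE" for u t
  proof (rule TE.commutator_on_generate[OF tens_e_gens_closed S[OF t] Pc(1)[OF S[OF t]]])
    show "u \<in> generate TE gens_e" using u by (simp add: tens_e_generate)
    show "tens_P M N (c x t) \<bullet> y = y \<bullet> tens_P M N (c x t)" if "x \<in> carrier TE" "y \<in> carrier TE" for x y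
      using that S[OF t] by (intro P_central_tens cl)
    show "s \<bullet> t = t \<bullet> s \<bullet> tens_P M N (c s t)" if "s \<in> gens_e" for s
      using that t by (rule 1)
  qed
  \<comment> \<open>\<open>commutator_on_generate\<close> varies the left factor, so for the second
    variable the factors are exchanged, which inverts the correction.\<close>
  have "v \<bullet> u = u \<bullet> v \<bullet> inv\<^bsub>TE\<^esub> tens_P M N (c u v)"
  proof (rule TE.commutator_on_generate[OF tens_e_gens_closed u])
    show "v \<in> generate TE gens_e" using v by (simp add: tens_e_generate)
    have comm: "tens_P M N w \<bullet> z = z \<bullet> tens_P M N w" if "w \<in> carrier TEE" "z \<in> carrier TE" for w z
      using that by (rule P_central_tens)
    have Pi: "inv\<^bsub>TE\<^esub> tens_P M N w = tens_P M N (inv\<^bsub>TEE\<^esub> w)" if "w \<in> carrier TEE" for w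
      using that by (simp add: hom_inv[OF tens_P_props(1)] TE.group_axioms TEE.group_axioms)
    show "(\<lambda>v. inv\<^bsub>TE\<^esub> tens_P M N (c u v)) \<in> hom TE TE"
    proof (rule homI)
      fix x y assume xy: "x \<in> carrier TE" "y \<in> carrier TE"
      have "inv\<^bsub>TE\<^esub> tens_P M N (c u (x \<bullet> y)) = tens_P M N (inv\<^bsub>TEE\<^esub> c u x \<otimes>\<^bsub>TEE\<^esub> inv\<^bsub>TEE\<^esub> c u y)"
        using xy u by (subst Pi) (simp_all add: cl hom_mult[OF hc(2)] TEE.inv_mult)
      then show "inv\<^bsub>TE\<^esub> tens_P M N (c u (x \<bullet> y)) =
          inv\<^bsub>TE\<^esub> tens_P M N (c u x) \<bullet> inv\<^bsub>TE\<^esub> tens_P M N (c u y)"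
        using xy u by (simp add: Pi cl hom_mult[OF tens_P_props(1)])
    qed (simp add: cl Pcl u)
    show "inv\<^bsub>TE\<^esub> tens_P M N (c u x) \<bullet> y = y \<bullet> inv\<^bsub>TE\<^esub> tens_P M N (c u x)"
      if "x \<in> carrier TE" "y \<in> carrier TE" for x y
      using that u by (simp add: Pi cl comm)
    show "t \<bullet> u = u \<bullet> t \<bullet> inv\<^bsub>TE\<^esub> tens_P M N (c u t)" if t: "t \<in> gens_e" for t
      using 2[OF t u] S[OF t] u by (simp add: TE.m_assoc cl Pcl)
  qed
  then show ?thesis
    using u v by (simp add: c_def[symmetric] cl Pcl TE.m_assoc)
qed

lemma square_group_sg_tensor: "square_group MN"
proof -
  let ?c = "tens_cross"
  have cl: "?c u v \<in> carrier TEE" if "u \<in> carrier TE" "v \<in> carrier TE" for u v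
    using tens_H_props(1) that by (auto simp: quadratic_def hom_def)
  have Pcl: "tens_P M N w \<in> carrier TE" if "w \<in> carrier TEE" for w
    using tens_P_props(1) that by (auto simp: hom_def)
  have "tens_P M N (?c u v) = inv\<^bsub>TE\<^esub> u \<bullet> inv\<^bsub>TE\<^esub> v \<bullet> u \<bullet> v"
    if u: "u \<in> carrier TE" and v: "v \<in> carrier TE" for u v
  proof -
    have inv_cancel: "inv\<^bsub>TE\<^esub> w \<bullet> (w \<bullet> z) = z" if "w \<in> carrier TE" "z \<in> carrier TE" for w z
      using that by (simp flip: TE.m_assoc)
    have "inv\<^bsub>TE\<^esub> u \<bullet> inv\<^bsub>TE\<^esub> v \<bullet> u \<bullet> v = inv\<^bsub>TE\<^esub> (v \<bullet> u) \<bullet> (u \<bullet> v)"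
      using that by (simp add: TE.inv_mult_group TE.m_assoc)
    also have "\<dots> = inv\<^bsub>TE\<^esub> (v \<bullet> u) \<bullet> (v \<bullet> u \<bullet> tens_P M N (?c u v))"
      using tens_commutator[OF u v] by simp
    also have "\<dots> = tens_P M N (?c u v)"
      using u v cl Pcl inv_cancel[of "v \<bullet> u"] by simp
    finally show ?thesis ..
  qed
  \<comment> \<open>Both sides are additive in \<open>w\<close>: the left because cross-effects
    vanish on the image of \<open>P\<close>, the right because that image is central. On
    \<open>a \<otimes> b\<close> the relation \<open>bar_T\<close> turns
    \<open>P (a \<otimes> b - T a \<otimes> T b)\<close> into twice
    \<open>P (a \<otimes> b)\<close>.\<close>
  moreover have "tens_P M N (tens_H M N (tens_P M N w)) = tens_P M N w \<bullet> tens_P M N w"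
    if w: "w \<in> carrier TEE" for w
  proof (rule hom_eq_on_generate[OF TEE.group_axioms TE.group_axioms _ _ tens_ee_gens_closed])
    have q: "tens_H M N u \<in> carrier TEE" if "u \<in> carrier TE" for u
      using tens_H_props(1) that by (auto simp: quadratic_def)
    have "(\<lambda>w. tens_H M N (tens_P M N w)) \<in> hom TEE TEE"
      using tens_P_props(1) cross_P_tens quadratic_mult[OF tens_H_props(1) TE.group_axioms TEE.comm_group_axioms]
      by (intro homI) (simp_all add: q Pcl hom_mult)
    from hom_compose[OF this tens_P_props(1)]
    show "(\<lambda>w. tens_P M N (tens_H M N (tens_P M N w))) \<in> hom TEE TE" by (simp add: comp_def)
    show "(\<lambda>w. tens_P M N w \<bullet> tens_P M N w) \<in> hom TEE TE"
    proof (rule homI)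
      fix v w assume vw: "v \<in> carrier TEE" "w \<in> carrier TEE"
      have "tens_P M N v \<bullet> tens_P M N w = tens_P M N w \<bullet> tens_P M N v"
        using vw by (intro P_central_tens Pcl)
      then have "tens_P M N v \<bullet> (tens_P M N w \<bullet> tens_P M N v) \<bullet> tens_P M N w =
        tens_P M N v \<bullet> (tens_P M N v \<bullet> tens_P M N w) \<bullet> tens_P M N w" by simp
      then show "tens_P M N (v \<otimes>\<^bsub>TEE\<^esub> w) \<bullet> tens_P M N (v \<otimes>\<^bsub>TEE\<^esub> w) =
          tens_P M N v \<bullet> tens_P M N v \<bullet> (tens_P M N w \<bullet> tens_P M N w)"
        using vw Pcl tens_P_props(1) by (simp add: hom_mult TE.m_assoc)
    qed (simp add: Pcl)
    show "tens_P M N (tens_H M N (tens_P M N s)) = tens_P M N s \<bullet> tens_P M N s"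
      if "s \<in> gens_ee" for s
      using that by (auto simp: tens_P_props tens_H_props hom_mult[OF tens_P_props(1)] br_T
          hom_inv[OF tens_P_props(1)] TE.group_axioms TEE.group_axioms)
    show "w \<in> generate TEE gens_ee"
      using w by (simp add: tens_ee_generate)
  qed
  ultimately show ?thesis
    using tens_H_props(1) tens_P_props(1)
    by (simp add: square_group_def sg_tensor_simps TE.group_axioms TEE.comm_group_axioms cross_P_tens)
qed

lemma sg_bimor_sg_tensor: "sg_bimor M N MN cir pu"
proof -
  have sq: "square_group MN" by (rule square_group_sg_tensor)
  \<comment> \<open>\<open>H P (a \<otimes> b)\<close> is
    \<open>a \<otimes> b - T a \<otimes> T b\<close>, and \<open>T = H P - 1\<close> removes the
    first summand.\<close>
  have T: "Tmap MN (pu a b) = \<ominus>\<^bsub>MN\<^esub> pu (Tmap M a) (Tmap N b)" if "a \<in> car_ee M" "b \<in> car_ee N" for a b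
    using that by (simp add: Tmap_def[of MN] sg_tensor_simps tens_P_props tens_H_props
        TEE.sub_norm TEE.sub_closed TEE.m_ac)
  show ?thesis
    by (unfold_locales)
      (simp_all add: sq T, simp_all add: sg_tensor_simps pu_add cir_add_left cir_add_right cir_P_left cir_P_right
        tens_P_props tens_H_props)
qed

text \<open>The two levels are built separately. Compatibility with \<open>P\<close> is compared on
  pure tensors; compatibility with \<open>H\<close> is an equality of two quadratic maps, so values
  and cross-effects on generators decide it. Uniqueness comes from
  \<open>sg_hom_eqI\<close>.\<close>

lemma sg_tensor_univ:
  assumes "sg_bimor M N K f p"
  shows "\<exists>\<phi> \<in> sg_hom MN K. (\<forall>x \<in> car_e M. \<forall>y \<in> car_e N. map_e \<phi> (cir x y) = f x y) \<and>
    (\<forall>a \<in> car_ee M. \<forall>b \<in> car_ee N. map_ee \<phi> (pu a b) = p a b)"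
proof -
  interpret sg_bimor M N K f p by fact
  have "\<exists>h \<in> hom TE (lvl_e K). (\<forall>x \<in> car_e M. \<forall>y \<in> car_e N. h (cir x y) = f x y) \<and>
    (\<forall>a \<in> car_ee M. \<forall>b \<in> car_ee N. h (br a b) = Pmap K (p a b))"
    by (rule tens_e_hom; (rule P_central)?)
      (simp_all add: square_group_e p_add_left p_add_right Pmap_add f_add_left f_add_right f_P_left f_P_right P_p_T)
  then obtain h where h: "h \<in> hom TE (lvl_e K)"
    "\<And>x y. x \<in> car_e M \<Longrightarrow> y \<in> car_e N \<Longrightarrow> h (cir x y) = f x y"
    "\<And>a b. a \<in> car_ee M \<Longrightarrow> b \<in> car_ee N \<Longrightarrow> h (br a b) = Pmap K (p a b)" by blast
  have "\<exists>k \<in> hom TEE (lvl_ee K). \<forall>a \<in> car_ee M. \<forall>b \<in> car_ee N. k (pu a b) = p a b"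
    by (rule ab.ab_tensor_hom[unfolded ab_tensor_fold])
      (simp_all add: square_group_ee' p_add_left p_add_right ee_ac)
  then obtain k where k: "k \<in> hom TEE (lvl_ee K)"
    "\<And>a b. a \<in> car_ee M \<Longrightarrow> b \<in> car_ee N \<Longrightarrow> k (pu a b) = p a b" by blast
  note ax = TE.group_axioms TEE.group_axioms TEE.comm_group_axioms square_group_e[OF sq_K]
    square_group_ee'[OF sq_K] square_group_ee[OF sq_K]
  have P: "h (tens_P M N w) = Pmap K (k w)" if "w \<in> carrier TEE" for w
  proof (rule hom_eq_on_generate[OF ax(2) ax(4) _ _ tens_ee_gens_closed])
    show "(\<lambda>w. h (tens_P M N w)) \<in> hom TEE (lvl_e K)" "(\<lambda>w. Pmap K (k w)) \<in> hom TEE (lvl_e K)"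
      using hom_compose[OF tens_P_props(1) h(1)] hom_compose[OF k(1) Pmap_hom] by (simp_all add: comp_def)
  qed (use that in \<open>auto simp: tens_ee_generate tens_P_props h k\<close>)
  have H: "k (tens_H M N u) = Hmap K (h u)" if "u \<in> carrier TE" for u
  proof (rule quadratic_eqI[OF _ _ ax(1) ax(6) tens_e_gens_closed tens_e_generate _ _ that])
    note q1 = quadratic_hom_comp[OF tens_H_props(1) k(1) ax(3) ax(6) ax(1)]
    note q2 = hom_quadratic_comp[OF quadratic_Hmap[OF sq_K] h(1) ax(6) ax(4) ax(1)]
    show "quadratic TE (lvl_ee K) (\<lambda>u. k (tens_H M N u))" "quadratic TE (lvl_ee K) (\<lambda>u. Hmap K (h u))"
      by (rule q1(1), rule q2(1))
    show "k (tens_H M N s) = Hmap K (h s)" if "s \<in> gens_e" for s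
      using that by (auto simp: tens_H_props h k hom_mult[OF k(1)] hom_inv[OF k(1)] ax Hmap_f HP_eq Tmap_p ee_ac)
    show "cross_effect TE (lvl_ee K) (\<lambda>u. k (tens_H M N u)) s t = cross_effect TE (lvl_ee K) (\<lambda>u. Hmap K (h u)) s t"
      if "s \<in> gens_e" "t \<in> gens_e" for s t
      using that by (auto simp: q1(2) q2(2) tens_H_props h k crossH_f hom_one[OF k(1)] ax)
  qed
  let ?\<phi> = "\<lparr>src = MN, tgt = K, map_e = restrict h (carrier TE), map_ee = restrict k (carrier TEE)\<rparr>"
  have "Hmap MN u \<in> carrier TEE" if "u \<in> carrier TE" for u
    using that tens_H_props(1) by (auto simp: quadratic_def sg_tensor_simps)
  moreover have "Pmap MN w \<in> carrier TE" if "w \<in> carrier TEE" for w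
    using that tens_P_props(1) by (auto simp: hom_def sg_tensor_simps)
  moreover have "restrict h (carrier TE) \<in> hom TE (lvl_e K)" by (rule TE.hom_eq[OF h(1)]) simp
  moreover have "restrict k (carrier TEE) \<in> hom TEE (lvl_ee K)" by (rule TEE.hom_eq[OF k(1)]) simp
  ultimately have "?\<phi> \<in> sg_hom MN K" by (simp add: sg_hom_def sg_tensor_simps H P)
  then show ?thesis by (rule bexI[rotated]) (simp add: h k)
qed

end

section \<open>Generators of square groups and uniqueness of morphisms\<close>

definition sg_generated :: "('a, 'b) sq_group \<Rightarrow> 'a set \<Rightarrow> 'b set \<Rightarrow> bool" where
  "sg_generated K S U \<longleftrightarrow> S \<subseteq> car_e K \<and> U \<subseteq> car_ee K \<and>
     generate (lvl_ee K) U = car_ee K \<and> generate (lvl_e K) (S \<union> Pmap K ` U) = car_e K"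

lemma sg_hom_eqI:
  assumes \<phi>: "\<phi> \<in> sg_hom K L" and \<psi>: "\<psi> \<in> sg_hom K L" and K: "square_group K" and L: "square_group L"
    and gen: "sg_generated K S U"
    and e: "\<And>x. x \<in> S \<Longrightarrow> map_e \<phi> x = map_e \<psi> x" and ee: "\<And>a. a \<in> U \<Longrightarrow> map_ee \<phi> a = map_ee \<psi> a"
  shows "\<phi> = \<psi>"
proof -
  note g = gen[unfolded sg_generated_def]
  have eq_ee: "map_ee \<phi> a = map_ee \<psi> a" if "a \<in> car_ee K" for a
    by (rule hom_eq_on_generate[where f = "map_ee \<phi>" and g = "map_ee \<psi>" and S = U,
          OF square_group_ee'[OF K] square_group_ee'[OF L] sg_homD(4)[OF \<phi>] sg_homD(4)[OF \<psi>]])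
      (use that g ee in auto)
  have "map_e \<phi> x = map_e \<psi> x" if "x \<in> car_e K" for x
  proof (rule hom_eq_on_generate[where f = "map_e \<phi>" and g = "map_e \<psi>" and S = "S \<union> Pmap K ` U",
          OF square_group_e[OF K] square_group_e[OF L] sg_homD(3)[OF \<phi>] sg_homD(3)[OF \<psi>]])
    show "S \<union> Pmap K ` U \<subseteq> car_e K" using g K by auto
    show "map_e \<phi> s = map_e \<psi> s" if "s \<in> S \<union> Pmap K ` U" for s
      using that g e eq_ee sg_homD(8)[OF \<phi>] sg_homD(8)[OF \<psi>] by auto
  qed (use g that in auto)
  with eq_ee show ?thesis
    using sg_homD(1,2,5,6)[OF \<phi>] sg_homD(1,2,5,6)[OF \<psi>]
    by (intro sg_mor.equality) (auto intro: extensionalityI)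
qed

context sg_bimor
begin

lemma f_neg_left:
  assumes x: "x \<in> car_e M" and y: "y \<in> car_e N"
  shows "f (\<boxminus>\<^bsub>M\<^esub> x) y = \<boxminus>\<^bsub>K\<^esub> (f x y \<boxplus>\<^bsub>K\<^esub> Pmap K (p (crossH M x (\<boxminus>\<^bsub>M\<^esub> x)) (Hmap N y)))"
proof -
  interpret group "lvl_e K" by (rule square_group_e) simp
  \<comment> \<open>Zero is written as \<open>P 0\<close>, so that \<open>f_P_left\<close> evaluates
    \<open>f\<close> at it.\<close>
  have "f (Pmap M \<zero>\<^bsub>M\<^esub>) y = \<zero>\<^sub>e\<^bsub>K\<^esub>" using y by (subst f_P_left) auto
  then have "f (\<boxminus>\<^bsub>M\<^esub> x) y \<boxplus>\<^bsub>K\<^esub> f x y \<boxplus>\<^bsub>K\<^esub> Pmap K (p (crossH M x (\<boxminus>\<^bsub>M\<^esub> x)) (Hmap N y)) = \<zero>\<^sub>e\<^bsub>K\<^esub>"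
    using x y f_add_left[of "\<boxminus>\<^bsub>M\<^esub> x" x y] by simp
  then show ?thesis
    using x y by (intro inv_equality[symmetric]) (simp_all add: m_assoc)
qed

text \<open>On the right \<open>f\<close> is additive. On the left it is additive up to
  \<open>P\<close> of values of \<open>p\<close>, and these are shown beforehand to lie in the
  generated subgroup. The statement can be iterated, which handles diagrams on three and four
  factors.\<close>

lemma sg_generated_subset:
  assumes K: "sg_generated K {f x y |x y. x \<in> car_e M \<and> y \<in> car_e N} {p a b |a b. a \<in> car_ee M \<and> b \<in> car_ee N}"
    and M: "sg_generated M S U" and N: "sg_generated N S' U'"
  shows "sg_generated K {f s t |s t. s \<in> S \<and> t \<in> S'} {p u v |u v. u \<in> U \<and> v \<in> U'}"
proof -
  let ?S = "{f s t |s t. s \<in> S \<and> t \<in> S'}" and ?U = "{p u v |u v. u \<in> U \<and> v \<in> U'}"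
  note K = K[unfolded sg_generated_def] and M = M[unfolded sg_generated_def] and N = N[unfolded sg_generated_def]
  have U_ee: "U \<subseteq> car_ee M" "generate (lvl_ee M) U = car_ee M"
    and U'_ee: "U' \<subseteq> car_ee N" "generate (lvl_ee N) U' = car_ee N"
    using M N by blast+
  interpret E: group "lvl_e K" by (rule square_group_e) simp
  have S: "?S \<subseteq> car_e K" using f_closed M N by blast
  have U: "?U \<subseteq> car_ee K" using p_closed M N by blast
  have W: "?S \<union> Pmap K ` ?U \<subseteq> car_e K" using S U Pmap_closed[OF sq_K] by blast
  note ax = square_group_ee'[OF sq_M] square_group_ee'[OF sq_N] square_group_ee'[OF sq_K] square_group_e[OF sq_K]
  have inU: "p u v \<in> generate (lvl_ee K) ?U" if "u \<in> U" "v \<in> U'" for u v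
    using that by (intro generate.incl) auto
  have pU: "p a b \<in> generate (lvl_ee K) ?U" if "a \<in> car_ee M" "b \<in> car_ee N" for a b
    by (rule biadditive_generate[where g = p, OF ax(1,2,3) p_hom_left p_hom_right U_ee U'_ee U inU that])
  have 1: "generate (lvl_ee K) ?U = car_ee K"
    by (rule generate_subset_carrier[OF ax(3) _ U, of "{p a b |a b. a \<in> car_ee M \<and> b \<in> car_ee N}"])
      (use K pU in auto)
  let ?W = "generate (lvl_e K) (?S \<union> Pmap K ` ?U)"
  have P_left: "(\<lambda>a. Pmap K (p a b)) \<in> hom (lvl_ee M) (lvl_e K)" if "b \<in> car_ee N" for b
    using hom_compose[OF p_hom_left[OF that] Pmap_hom[OF sq_K]] by (simp add: comp_def)
  have P_right: "(\<lambda>b. Pmap K (p a b)) \<in> hom (lvl_ee N) (lvl_e K)" if "a \<in> car_ee M" for a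
    using hom_compose[OF p_hom_right[OF that] Pmap_hom[OF sq_K]] by (simp add: comp_def)
  have inW: "Pmap K (p u v) \<in> ?W" if "u \<in> U" "v \<in> U'" for u v
    using that by (intro generate.incl UnI2 imageI) auto
  have Pp: "Pmap K (p a b) \<in> ?W" if "a \<in> car_ee M" "b \<in> car_ee N" for a b
    by (rule biadditive_generate[where g = "\<lambda>a b. Pmap K (p a b)",
          OF ax(1,2,4) P_left P_right U_ee U'_ee W inW that])
  have fs: "f s y \<in> ?W" if s: "s \<in> S" and y: "y \<in> generate (lvl_e N) (S' \<union> Pmap N ` U')" for s y
    using y
  proof (induction rule: generate.induct)
    have [simp]: "s \<in> car_e M" using s M by auto
    {
      case one
      show ?case by (simp add: generate.one)
    next
      case (incl h)
      then show ?case using s M N Pp by (auto intro: generate.incl simp: f_P_right)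
    next
      case (inv h)
      then have "h \<in> car_e N" using N by auto
      moreover have "f s h \<in> ?W" using inv s M N Pp by (auto intro: generate.incl simp: f_P_right)
      ultimately show ?case by (simp add: f_neg_right E.generate_m_inv_closed[OF W])
    next
      case (eng h1 h2)
      then have "h1 \<in> car_e N" "h2 \<in> car_e N" using N by auto
      then show ?case using eng by (simp add: f_add_right generate.eng)
    }
  qed
  have "f x y \<in> ?W" if x: "x \<in> generate (lvl_e M) (S \<union> Pmap M ` U)" and y: "y \<in> car_e N" for x y
    using x
  proof (induction rule: generate.induct)
    case one
    have "f (Pmap M \<zero>\<^bsub>M\<^esub>) y = \<zero>\<^sub>e\<^bsub>K\<^esub>" using y by (subst f_P_left) auto
    then show ?case by (simp add: generate.one)
  next
    case (incl h)
    then show ?case using M N y fs Pp by (auto simp: f_P_left)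
  next
    case (inv h)
    then have "h \<in> car_e M" using M by auto
    moreover have "f h y \<in> ?W" using inv M N y fs Pp by (auto simp: f_P_left)
    ultimately show ?case
      using y Pp by (simp add: f_neg_left E.generate_m_inv_closed[OF W] generate.eng)
  next
    case (eng h1 h2)
    then have "h1 \<in> car_e M" "h2 \<in> car_e M" using M by auto
    then show ?case using eng y Pp by (simp add: f_add_left generate.eng)
  qed
  then have "{f x y |x y. x \<in> car_e M \<and> y \<in> car_e N} \<union> Pmap K ` {p a b |a b. a \<in> car_ee M \<and> b \<in> car_ee N} \<subseteq> ?W"
    using Pp M by auto
  then have "?W = car_e K"
    by (rule generate_subset_carrier[OF ax(4) _ W]) (use K in auto)
  then show ?thesis using 1 S U by (simp add: sg_generated_def)
qed

lemma sg_bimor_comp: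
  assumes \<phi>: "\<phi> \<in> sg_hom K L" and L [simp]: "square_group L"
  shows "sg_bimor M N L (\<lambda>x y. map_e \<phi> (f x y)) (\<lambda>a b. map_ee \<phi> (p a b))"
proof -
  note rev = sg_homD(7,8)[OF \<phi>, symmetric] sg_hom_pres(3,4)[OF \<phi> sq_K L, symmetric]
  show ?thesis
    by unfold_locales
      (simp_all add: sg_homD(9-)[OF \<phi>] sg_hom_pres(1,2)[OF \<phi>] rev p_add_left p_add_right f_add_left f_add_right
        f_P_left f_P_right Tmap_p crossH_f Hmap_f)
qed

lemma sg_bimor_precomp:
  assumes \<phi>: "\<phi> \<in> sg_hom M' M" and \<psi>: "\<psi> \<in> sg_hom N' N"
    and sq [simp]: "square_group M'" "square_group N'"
  shows "sg_bimor M' N' K (\<lambda>x y. f (map_e \<phi> x) (map_e \<psi> y)) (\<lambda>a b. p (map_ee \<phi> a) (map_ee \<psi> b))"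
proof -
  note pres = sg_homD(7-)[OF \<phi>] sg_hom_pres[OF \<phi> sq(1) sq_M] sg_homD(7-)[OF \<psi>] sg_hom_pres[OF \<psi> sq(2) sq_N]
  show ?thesis
    by unfold_locales
      (simp_all add: pres p_add_left p_add_right f_add_left f_add_right f_P_left f_P_right Tmap_p crossH_f Hmap_f)
qed

end

lemma sg_generated_carrier: "square_group K \<Longrightarrow> sg_generated K (car_e K) (car_ee K)"
proof -
  assume K: "square_group K"
  then have "car_e K \<union> Pmap K ` car_ee K = car_e K" by auto
  then show ?thesis
    using K generate_eq_carrierI[OF square_group_e[OF K], of "car_e K"]
      generate_eq_carrierI[OF square_group_ee'[OF K], of "car_ee K"]
    by (auto simp: sg_generated_def intro: generate.incl)
qed

lemma sg_generated_image:
  assumes \<phi>: "\<phi> \<in> sg_hom K L" and K: "square_group K" and L: "square_group L" and gen: "sg_generated K S U"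
    and surj: "map_e \<phi> ` car_e K = car_e L" "map_ee \<phi> ` car_ee K = car_ee L"
  shows "sg_generated L (map_e \<phi> ` S) (map_ee \<phi> ` U)"
proof -
  note g = gen[unfolded sg_generated_def]
  interpret E: group_hom "lvl_e K" "lvl_e L" "map_e \<phi>"
    using sg_homD(3)[OF \<phi>] by (simp add: group_hom_def group_hom_axioms_def square_group_e K L)
  interpret EE: group_hom "lvl_ee K" "lvl_ee L" "map_ee \<phi>"
    using sg_homD(4)[OF \<phi>] by (simp add: group_hom_def group_hom_axioms_def square_group_ee' K L)
  have SU: "S \<union> Pmap K ` U \<subseteq> car_e K" using g K by auto
  have eq: "map_e \<phi> ` S \<union> Pmap L ` map_ee \<phi> ` U = map_e \<phi> ` (S \<union> Pmap K ` U)"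
  proof -
    have "Pmap L (map_ee \<phi> u) = map_e \<phi> (Pmap K u)" if "u \<in> U" for u
      using g that sg_homD(8)[OF \<phi>, of u] by auto
    then show ?thesis by (simp add: image_Un image_image)
  qed
  have "generate (lvl_e L) (map_e \<phi> ` S \<union> Pmap L ` map_ee \<phi> ` U) = car_e L"
    unfolding eq using E.generate_img[OF SU] g surj by simp
  moreover have "generate (lvl_ee L) (map_ee \<phi> ` U) = car_ee L"
    using EE.generate_img[of U] g surj by simp
  ultimately show ?thesis
    using g sg_homD(9,10)[OF \<phi>] by (auto simp: sg_generated_def)
qed

section \<open>Composition of morphisms\<close>

lemma map_sg_comp:
  "x \<in> car_e (src \<phi>) \<Longrightarrow> map_e (sg_comp \<psi> \<phi>) x = map_e \<psi> (map_e \<phi> x)"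
  "a \<in> car_ee (src \<phi>) \<Longrightarrow> map_ee (sg_comp \<psi> \<phi>) a = map_ee \<psi> (map_ee \<phi> a)"
  by (simp_all add: sg_comp_def compose_def)

lemma map_sg_id [simp]:
  "x \<in> car_e M \<Longrightarrow> map_e (sg_id M) x = x" "a \<in> car_ee M \<Longrightarrow> map_ee (sg_id M) a = a"
  by (simp_all add: sg_id_def)

lemma sg_id_hom: "square_group M \<Longrightarrow> sg_id M \<in> sg_hom M M"
  by (simp add: sg_hom_def sg_id_def hom_def)

lemma sg_comp_hom: "\<phi> \<in> sg_hom L M \<Longrightarrow> \<psi> \<in> sg_hom M N \<Longrightarrow> square_group L \<Longrightarrow> sg_comp \<psi> \<phi> \<in> sg_hom L N"
  unfolding sg_hom_def by (simp add: sg_comp_def hom_def Pi_iff compose_def)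

lemma map_sg_comp_hom:
  assumes "\<phi> \<in> sg_hom L M"
  shows "x \<in> car_e L \<Longrightarrow> map_e (sg_comp \<psi> \<phi>) x = map_e \<psi> (map_e \<phi> x)"
    and "a \<in> car_ee L \<Longrightarrow> map_ee (sg_comp \<psi> \<phi>) a = map_ee \<psi> (map_ee \<phi> a)"
  using assms sg_homD(1)[OF assms] by (auto simp: map_sg_comp)

lemma sg_hom_ext:
  assumes "\<phi> \<in> sg_hom K L" "\<psi> \<in> sg_hom K L"
    and "\<And>x. x \<in> car_e K \<Longrightarrow> map_e \<phi> x = map_e \<psi> x" "\<And>a. a \<in> car_ee K \<Longrightarrow> map_ee \<phi> a = map_ee \<psi> a"
  shows "\<phi> = \<psi>"
  using assms sg_homD(1,2,5,6)[OF assms(1)] sg_homD(1,2,5,6)[OF assms(2)]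
  by (intro sg_mor.equality) (auto intro: extensionalityI)

lemma sg_comp_assoc:
  assumes "\<phi> \<in> sg_hom K L" "\<psi> \<in> sg_hom L M" "\<chi> \<in> sg_hom M N" "square_group K" "square_group L"
  shows "sg_comp (sg_comp \<chi> \<psi>) \<phi> = sg_comp \<chi> (sg_comp \<psi> \<phi>)"
  by (rule sg_hom_ext[of _ K N])
    (use assms in \<open>auto intro!: sg_comp_hom simp: map_sg_comp_hom[OF assms(1)] map_sg_comp_hom[OF assms(2)]
      map_sg_comp_hom[OF sg_comp_hom[OF assms(1,2)]] sg_homD(9,10)[OF assms(1)]\<close>)

lemma sg_comp_id:
  assumes "\<phi> \<in> sg_hom K L" "square_group K" "square_group L"
  shows "sg_comp \<phi> (sg_id K) = \<phi>" "sg_comp (sg_id L) \<phi> = \<phi>"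
proof -
  show "sg_comp \<phi> (sg_id K) = \<phi>"
    by (rule sg_hom_ext[of _ K L])
      (use assms in \<open>auto intro!: sg_comp_hom sg_id_hom simp: map_sg_comp_hom[OF sg_id_hom]\<close>)
  show "sg_comp (sg_id L) \<phi> = \<phi>"
    by (rule sg_hom_ext[of _ K L])
      (use assms in \<open>auto intro!: sg_comp_hom sg_id_hom simp: map_sg_comp_hom sg_homD(9,10)\<close>)
qed

lemma sg_isoI:
  assumes "\<phi> \<in> sg_hom M N" "\<psi> \<in> sg_hom N M" "sg_comp \<psi> \<phi> = sg_id M" "sg_comp \<phi> \<psi> = sg_id N"
  shows "\<phi> \<in> sg_iso M N"
  using assms by (auto simp: sg_iso_def)

section \<open>Transport of structure\<close>

lemma transport_group_mult:
  assumes "inj_on f (carrier G)" "x \<in> carrier G" "y \<in> carrier G"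
  shows "f x \<otimes>\<^bsub>transport_group f G\<^esub> f y = f (x \<otimes>\<^bsub>G\<^esub> y)"
  using assms by (simp add: transport_group_def)

lemma carrier_transport_group [simp]: "carrier (transport_group f G) = f ` carrier G"
  by (simp add: transport_group_def)

lemma one_transport_group: "\<one>\<^bsub>transport_group f G\<^esub> = f \<one>\<^bsub>G\<^esub>"
  by (simp add: transport_group_def)

lemma group_transport_group:
  assumes "group G" and f: "inj_on f (carrier G)"
  shows "group (transport_group f G)"
proof -
  interpret group G by fact
  show ?thesis
  proof (rule groupI)
    show "\<exists>y\<in>carrier (transport_group f G). y \<otimes>\<^bsub>transport_group f G\<^esub> x = \<one>\<^bsub>transport_group f G\<^esub>"
      if x: "x \<in> carrier (transport_group f G)" for x
    proof -
      obtain a where "a \<in> carrier G" "x = f a" using x by auto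
      then show ?thesis
        using f by (intro bexI[of _ "f (inv\<^bsub>G\<^esub> a)"]) (auto simp: transport_group_mult one_transport_group)
    qed
  qed (use f in \<open>auto simp: transport_group_mult one_transport_group m_assoc\<close>)
qed

lemma transport_group_hom: "inj_on f (carrier G) \<Longrightarrow> f \<in> hom G (transport_group f G)"
  by (auto simp: hom_def transport_group_mult)

lemma transport_sg_simps:
  "lvl_e (transport_sg f g K) = transport_group f (lvl_e K)"
  "lvl_ee (transport_sg f g K) = transport_group g (lvl_ee K)"
  "inj_on f (car_e K) \<Longrightarrow> x \<in> car_e K \<Longrightarrow> Hmap (transport_sg f g K) (f x) = g (Hmap K x)"
  "inj_on g (car_ee K) \<Longrightarrow> a \<in> car_ee K \<Longrightarrow> Pmap (transport_sg f g K) (g a) = f (Pmap K a)"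
  by (simp_all add: transport_sg_def)

lemma square_group_transport_sg:
  assumes K [simp]: "square_group K" and f: "inj_on f (car_e K)" and g: "inj_on g (car_ee K)"
  shows "square_group (transport_sg f g K)"
proof -
  let ?E = "transport_group f (lvl_e K)" and ?EE = "transport_group g (lvl_ee K)"
  let ?H = "Hmap (transport_sg f g K)" and ?P = "Pmap (transport_sg f g K)"
  have E: "group ?E" using f by (intro group_transport_group square_group_e K)
  have "group ?EE" using g by (intro group_transport_group square_group_ee' K)
  then have EE: "comm_group ?EE"
    using g by (intro group.group_comm_groupI) (auto simp: transport_group_mult ee_ac)
  note s = transport_sg_simps(3)[OF f] transport_sg_simps(4)[OF g]
    transport_group_mult[OF f] transport_group_mult[OF g]
  have inv_e: "inv\<^bsub>?E\<^esub> f x = f (\<boxminus>\<^bsub>K\<^esub> x)" if "x \<in> car_e K" for x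
    using hom_inv[OF transport_group_hom[OF f] square_group_e E that] by simp
  have Q: "quadratic ?E ?EE ?H" and cross: "\<And>x y. x \<in> car_e K \<Longrightarrow> y \<in> car_e K \<Longrightarrow>
     cross_effect ?E ?EE ?H (f x) (f y) = g (crossH K x y)"
  proof -
    let ?i = "inv_into (car_e K) f"
    let ?c = "\<lambda>u v. g (crossH K (?i u) (?i v))"
    have i: "?i (f x) = x" if "x \<in> car_e K" for x using f that by simp
    have 1: "?H x \<in> carrier ?EE" if "x \<in> carrier ?E" for x
      using that by (auto simp: s)
    have 2: "(\<lambda>x. ?c x y) \<in> hom ?E ?EE" if "y \<in> carrier ?E" for y
      using that by (intro homI) (auto simp: s i crossH_add)
    have 3: "?c x \<in> hom ?E ?EE" if "x \<in> carrier ?E" for x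
      using that by (intro homI) (auto simp: s i crossH_add)
    have 4: "?H (x \<otimes>\<^bsub>?E\<^esub> y) = ?H x \<otimes>\<^bsub>?EE\<^esub> ?H y \<otimes>\<^bsub>?EE\<^esub> ?c x y" if "x \<in> carrier ?E" "y \<in> carrier ?E" for x y
      using that by (auto simp: s i Hmap_add)
    show "quadratic ?E ?EE ?H" by (rule quadraticI(1)[OF EE 1 2 3 E 4])
    show "cross_effect ?E ?EE ?H (f x) (f y) = g (crossH K x y)" if "x \<in> car_e K" "y \<in> car_e K" for x y
      using quadraticI(2)[OF EE 1 2 3 E 4, of "f x" "f y"] that by (simp add: i)
  qed
  show ?thesis
    unfolding square_group_def transport_sg_simps(1,2)
  proof (intro conjI ballI)
    show "?P \<in> hom ?EE ?E" by (rule homI) (auto simp: s Pmap_add)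
  qed (auto simp: E EE Q cross s inv_e one_transport_group P_crossH PHP)
qed

context sg_pair
begin

lemma sg_tensor_generated:
  "sg_generated MN {cir x y |x y. x \<in> car_e M \<and> y \<in> car_e N} gens_ee"
proof -
  have "tens_P M N ` gens_ee = {br a b |a b. a \<in> car_ee M \<and> b \<in> car_ee N}"
  proof (intro equalityI subsetI)
    fix u assume "u \<in> {br a b |a b. a \<in> car_ee M \<and> b \<in> car_ee N}"
    then obtain a b where ab: "a \<in> car_ee M" "b \<in> car_ee N" "u = br a b" by blast
    then have "tens_P M N (pu a b) \<in> tens_P M N ` gens_ee"
      by (intro imageI) auto
    then show "u \<in> tens_P M N ` gens_ee"
      using ab by (simp add: tens_P_props)
  next
    fix u assume "u \<in> tens_P M N ` gens_ee"
    then obtain a b where "a \<in> car_ee M" "b \<in> car_ee N" "u = tens_P M N (pu a b)" by blast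
    then show "u \<in> {br a b |a b. a \<in> car_ee M \<and> b \<in> car_ee N}"
      using tens_P_props(2)[of a b] by auto
  qed
  then show ?thesis
    using tens_e_generate tens_ee_generate by (auto simp: sg_generated_def sg_tensor_simps)
qed

end

lemma sg_tensor_map_props:
  assumes sq: "square_group M" "square_group M'" "square_group N" "square_group N'"
    and f: "f \<in> sg_hom M M'" and g: "g \<in> sg_hom N N'"
  shows "sg_tensor_map f g \<in> sg_hom (sg_tensor M N) (sg_tensor M' N')"
    and "\<lbrakk>x \<in> car_e M; y \<in> car_e N\<rbrakk> \<Longrightarrow> map_e (sg_tensor_map f g) (circ M N x y) = circ M' N' (map_e f x) (map_e g y)"
    and "\<lbrakk>a \<in> car_ee M; b \<in> car_ee N\<rbrakk> \<Longrightarrow>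
      map_ee (sg_tensor_map f g) (pure_ee M N a b) = pure_ee M' N' (map_ee f a) (map_ee g b)"
proof -
  interpret S: sg_pair M N using sq by (simp add: sg_pair_def)
  interpret T: sg_pair M' N' using sq by (simp add: sg_pair_def)
  let ?C = "\<lambda>\<phi>. \<phi> \<in> sg_hom (sg_tensor M N) (sg_tensor M' N') \<and>
        (\<forall>x \<in> carrier (lvl_e M). \<forall>y \<in> carrier (lvl_e N).
           map_e \<phi> (circ M N x y) = circ M' N' (map_e f x) (map_e g y)) \<and>
        (\<forall>a \<in> carrier (lvl_ee M). \<forall>b \<in> carrier (lvl_ee N).
           map_e \<phi> (bar M N a b) = bar M' N' (map_ee f a) (map_ee g b) \<and>
           map_ee \<phi> (pure_ee M N a b) = pure_ee M' N' (map_ee f a) (map_ee g b))"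
  obtain \<phi> where \<phi>: "\<phi> \<in> sg_hom (sg_tensor M N) (sg_tensor M' N')"
    "\<And>x y. x \<in> car_e M \<Longrightarrow> y \<in> car_e N \<Longrightarrow> map_e \<phi> (circ M N x y) = circ M' N' (map_e f x) (map_e g y)"
    "\<And>a b. a \<in> car_ee M \<Longrightarrow> b \<in> car_ee N \<Longrightarrow> map_ee \<phi> (pure_ee M N a b) = pure_ee M' N' (map_ee f a) (map_ee g b)"
    using S.sg_tensor_univ[OF sg_bimor.sg_bimor_precomp[OF T.sg_bimor_sg_tensor f g sq(1,3)]] by blast
  \<comment> \<open>This value is forced rather than chosen: \<open>bar M N a b\<close> is
    \<open>P\<close> of the pure tensor.\<close>
  have "map_e \<phi> (bar M N a b) = bar M' N' (map_ee f a) (map_ee g b)" if "a \<in> car_ee M" "b \<in> car_ee N" for a b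
    using that \<phi>(3) sg_homD(8)[OF \<phi>(1), of "pure_ee M N a b"] sg_homD(10)[OF f] sg_homD(10)[OF g]
    by (simp add: S.sg_tensor_simps T.sg_tensor_simps S.tens_P_props T.tens_P_props)
  then have C: "?C \<phi>" using \<phi> by simp
  have "\<psi> = \<phi>" if "?C \<psi>" for \<psi>
    by (rule sg_hom_eqI[OF _ \<phi>(1) S.square_group_sg_tensor T.square_group_sg_tensor S.sg_tensor_generated])
      (use that \<phi> in auto)
  with C have "?C (THE \<phi>. ?C \<phi>)" by (rule theI)
  moreover have "sg_tensor_map f g = (THE \<phi>. ?C \<phi>)"
    by (simp only: sg_tensor_map_def Let_def sg_homD(1,2)[OF f] sg_homD(1,2)[OF g])
  ultimately have C': "?C (sg_tensor_map f g)" by simp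
  then show "sg_tensor_map f g \<in> sg_hom (sg_tensor M N) (sg_tensor M' N')"
    and "\<lbrakk>x \<in> car_e M; y \<in> car_e N\<rbrakk> \<Longrightarrow> map_e (sg_tensor_map f g) (circ M N x y) = circ M' N' (map_e f x) (map_e g y)"
    and "\<lbrakk>a \<in> car_ee M; b \<in> car_ee N\<rbrakk> \<Longrightarrow>
      map_ee (sg_tensor_map f g) (pure_ee M N a b) = pure_ee M' N' (map_ee f a) (map_ee g b)"
    by blast+
qed

section \<open>The tensor product on the category of square groups\<close>

text \<open>Written with \<open>restrict\<close> so that it is literally \<open>map_e\<close> of
  \<open>code_mor\<close> applied to \<open>circ\<close>; \<open>sg_bimor_ten\<close> then follows
  from \<open>sg_bimor_comp\<close>.\<close>

definition ten :: "'x sgU \<Rightarrow> 'x sgU \<Rightarrow> 'x elt \<Rightarrow> 'x elt \<Rightarrow> 'x elt" where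
  "ten M N x y = restrict code_e (car_e (sg_tensor M N)) (circ M N x y)"

definition pur :: "'x sgU \<Rightarrow> 'x sgU \<Rightarrow> 'x elt \<Rightarrow> 'x elt \<Rightarrow> 'x elt" where
  "pur M N a b = restrict code_ee (car_ee (sg_tensor M N)) (pure_ee M N a b)"

definition code_mor :: "'x sgU \<Rightarrow> 'x sgU \<Rightarrow>
    (('x elt, 'x elt, 'x elt, 'x elt) sg_gen word set, ('x elt \<times> 'x elt) word set, 'x elt, 'x elt) sg_mor" where
  "code_mor M N = \<lparr>src = sg_tensor M N, tgt = SG_tensor M N,
     map_e = restrict code_e (car_e (sg_tensor M N)), map_ee = restrict code_ee (car_ee (sg_tensor M N))\<rparr>"

lemma inj_code:
  "inj_on code_e (car_e (sg_tensor M N))" "inj_on code_ee (car_ee (sg_tensor M N))"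
  by (simp_all add: sg_tensor_def tens_e_def tens_ee_def ab_tensor_def inj_on_code)

lemma code_mor_iso:
  "square_group M \<Longrightarrow> square_group N \<Longrightarrow> code_mor M N \<in> sg_iso (sg_tensor M N) (SG_tensor M N)"
  unfolding code_mor_def SG_tensor_def
  by (intro transport_sg_iso sg_pair.square_group_sg_tensor inj_code) (simp add: sg_pair_def)

lemma square_group_SG_tensor [simp]: "square_group M \<Longrightarrow> square_group N \<Longrightarrow> square_group (SG_tensor M N)"
  unfolding SG_tensor_def
  by (intro square_group_transport_sg sg_pair.square_group_sg_tensor inj_code) (simp add: sg_pair_def)

lemma sg_bimor_ten: "square_group M \<Longrightarrow> square_group N \<Longrightarrow> sg_bimor M N (SG_tensor M N) (ten M N) (pur M N)"
  using sg_bimor.sg_bimor_comp[OF sg_pair.sg_bimor_sg_tensor, of M N "code_mor M N" "SG_tensor M N"] code_mor_iso[of M N]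
  by (simp add: sg_pair_def sg_iso_def code_mor_def ten_def[abs_def] pur_def[abs_def])

lemma car_SG_tensor:
  "car_e (SG_tensor M N) = code_e ` car_e (sg_tensor M N)"
  "car_ee (SG_tensor M N) = code_ee ` car_ee (sg_tensor M N)"
  by (simp_all add: SG_tensor_def transport_sg_simps)

lemma ten_eq: "square_group M \<Longrightarrow> square_group N \<Longrightarrow> x \<in> car_e M \<Longrightarrow> y \<in> car_e N \<Longrightarrow>
    circ M N x y \<in> car_e (sg_tensor M N) \<and> ten M N x y = code_e (circ M N x y)"
  by (simp add: ten_def sg_tensor_def sg_pair.cir_closed sg_pair_def)

lemma pur_eq: "square_group M \<Longrightarrow> square_group N \<Longrightarrow> a \<in> car_ee M \<Longrightarrow> b \<in> car_ee N \<Longrightarrow>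
    pure_ee M N a b \<in> car_ee (sg_tensor M N) \<and> pur M N a b = code_ee (pure_ee M N a b)"
  by (simp add: pur_def sg_tensor_def sg_pair.pu_closed sg_pair_def)

lemma sg_generated_ten_full:
  assumes "square_group M" "square_group N"
  shows "sg_generated (SG_tensor M N) {ten M N x y |x y. x \<in> car_e M \<and> y \<in> car_e N}
    {pur M N a b |a b. a \<in> car_ee M \<and> b \<in> car_ee N}"
proof -
  interpret sg_pair M N using assms by (simp add: sg_pair_def)
  have h: "code_mor M N \<in> sg_hom MN (SG_tensor M N)"
    using code_mor_iso[OF assms] by (simp add: sg_iso_def)
  have 1: "map_e (code_mor M N) ` {cir x y |x y. x \<in> car_e M \<and> y \<in> car_e N} =
      {ten M N x y |x y. x \<in> car_e M \<and> y \<in> car_e N}"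
    by (auto simp: code_mor_def ten_def image_def)
  have 2: "map_ee (code_mor M N) ` gens_ee =
      {pur M N a b |a b. a \<in> car_ee M \<and> b \<in> car_ee N}"
    by (auto simp: code_mor_def pur_def image_def)
  have "map_e (code_mor M N) ` car_e MN = car_e (SG_tensor M N)"
    "map_ee (code_mor M N) ` car_ee MN = car_ee (SG_tensor M N)"
    by (simp_all add: code_mor_def car_SG_tensor)
  from sg_generated_image[OF h square_group_sg_tensor _ sg_tensor_generated this]
  show ?thesis using assms by (simp add: 1 2)
qed

lemma sg_generated_ten:
  assumes "square_group M" "square_group N" "sg_generated M S U" "sg_generated N S' U'"
  shows "sg_generated (SG_tensor M N) {ten M N s t |s t. s \<in> S \<and> t \<in> S'} {pur M N u v |u v. u \<in> U \<and> v \<in> U'}"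
  using sg_bimor.sg_generated_subset[OF sg_bimor_ten sg_generated_ten_full] assms by blast

lemma code_mor_inverse:
  assumes "square_group M" "square_group N"
  obtains \<sigma> where "\<sigma> \<in> sg_hom (SG_tensor M N) (sg_tensor M N)"
    "\<And>u. u \<in> car_e (sg_tensor M N) \<Longrightarrow> map_e \<sigma> (code_e u) = u"
    "\<And>w. w \<in> car_ee (sg_tensor M N) \<Longrightarrow> map_ee \<sigma> (code_ee w) = w"
proof -
  obtain \<sigma> where \<sigma>: "\<sigma> \<in> sg_hom (SG_tensor M N) (sg_tensor M N)"
    "sg_comp \<sigma> (code_mor M N) = sg_id (sg_tensor M N)"
    using code_mor_iso[OF assms] by (auto simp: sg_iso_def)
  have "map_e \<sigma> (code_e u) = u" if "u \<in> car_e (sg_tensor M N)" for u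
    using arg_cong[OF \<sigma>(2), of "\<lambda>\<phi>. map_e \<phi> u"] that by (simp add: map_sg_comp code_mor_def)
  moreover have "map_ee \<sigma> (code_ee w) = w" if "w \<in> car_ee (sg_tensor M N)" for w
    using arg_cong[OF \<sigma>(2), of "\<lambda>\<phi>. map_ee \<phi> w"] that by (simp add: map_sg_comp code_mor_def)
  ultimately show ?thesis using that \<sigma>(1) by blast
qed

definition lift :: "'x sgU \<Rightarrow> 'x sgU \<Rightarrow> 'x sgU \<Rightarrow> ('x elt \<Rightarrow> 'x elt \<Rightarrow> 'x elt) \<Rightarrow> ('x elt \<Rightarrow> 'x elt \<Rightarrow> 'x elt) \<Rightarrow> 'x morU" where
  "lift M N K f p = (SOME \<phi>. \<phi> \<in> sg_hom (SG_tensor M N) K \<and>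
     (\<forall>x \<in> car_e M. \<forall>y \<in> car_e N. map_e \<phi> (ten M N x y) = f x y) \<and>
     (\<forall>a \<in> car_ee M. \<forall>b \<in> car_ee N. map_ee \<phi> (pur M N a b) = p a b))"

lemma lift:
  assumes b: "sg_bimor M N K f p"
  shows lift_hom: "lift M N K f p \<in> sg_hom (SG_tensor M N) K"
    and lift_ten: "\<lbrakk>x \<in> car_e M; y \<in> car_e N\<rbrakk> \<Longrightarrow> map_e (lift M N K f p) (ten M N x y) = f x y"
    and lift_pur: "\<lbrakk>a \<in> car_ee M; b \<in> car_ee N\<rbrakk> \<Longrightarrow> map_ee (lift M N K f p) (pur M N a b) = p a b"
proof -
  interpret sg_bimor M N K f p by fact
  interpret sg_pair M N by (simp add: sg_pair_def)
  obtain \<sigma> where \<sigma>: "\<sigma> \<in> sg_hom (SG_tensor M N) MN"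
    "\<And>u. u \<in> car_e MN \<Longrightarrow> map_e \<sigma> (code_e u) = u" "\<And>w. w \<in> car_ee MN \<Longrightarrow> map_ee \<sigma> (code_ee w) = w"
    using code_mor_inverse[OF sq_M sq_N] by blast
  obtain \<phi> where \<phi>: "\<phi> \<in> sg_hom MN K" "\<And>x y. x \<in> car_e M \<Longrightarrow> y \<in> car_e N \<Longrightarrow> map_e \<phi> (cir x y) = f x y"
    "\<And>a b. a \<in> car_ee M \<Longrightarrow> b \<in> car_ee N \<Longrightarrow> map_ee \<phi> (pu a b) = p a b"
    using sg_tensor_univ[OF b] by blast
  note ten_eq' = ten_eq[OF sq_M sq_N] and pur_eq' = pur_eq[OF sq_M sq_N]
  have "sg_comp \<phi> \<sigma> \<in> sg_hom (SG_tensor M N) K" using \<sigma>(1) \<phi>(1) by (rule sg_comp_hom) simp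
  moreover have "map_e (sg_comp \<phi> \<sigma>) (ten M N x y) = f x y" if "x \<in> car_e M" "y \<in> car_e N" for x y
    using that ten_eq'[of x y] by (simp add: map_sg_comp_hom[OF \<sigma>(1)] car_SG_tensor \<sigma> \<phi>)
  moreover have "map_ee (sg_comp \<phi> \<sigma>) (pur M N a b) = p a b" if "a \<in> car_ee M" "b \<in> car_ee N" for a b
    using that pur_eq'[of a b] by (simp add: map_sg_comp_hom[OF \<sigma>(1)] car_SG_tensor \<sigma> \<phi>)
  ultimately have "\<exists>\<phi>. \<phi> \<in> sg_hom (SG_tensor M N) K \<and>
     (\<forall>x \<in> car_e M. \<forall>y \<in> car_e N. map_e \<phi> (ten M N x y) = f x y) \<and>
     (\<forall>a \<in> car_ee M. \<forall>b \<in> car_ee N. map_ee \<phi> (pur M N a b) = p a b)"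
    by (intro exI[of _ "sg_comp \<phi> \<sigma>"]) simp
  from someI_ex[OF this, folded lift_def]
  show "lift M N K f p \<in> sg_hom (SG_tensor M N) K"
    "\<lbrakk>x \<in> car_e M; y \<in> car_e N\<rbrakk> \<Longrightarrow> map_e (lift M N K f p) (ten M N x y) = f x y"
    "\<lbrakk>a \<in> car_ee M; b \<in> car_ee N\<rbrakk> \<Longrightarrow> map_ee (lift M N K f p) (pur M N a b) = p a b" by simp_all
qed

text \<open>For fixed \<open>x\<close>, the map sending \<open>v\<close> to
  \<open>x \<circledcirc> v\<close> is a homomorphism on the \<open>e\<close>-level but in general
  not part of a morphism of square groups, so \<open>lift\<close> does not cover it. Here
  \<open>H\<close> of the target is not involved, and \<open>bar_T\<close> is asked only after
  applying \<open>P\<close>.\<close>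

lemma SG_tensor_hom_e:
  assumes sq [simp]: "square_group M" "square_group N" "square_group L"
    and f: "\<And>x y. x \<in> car_e M \<Longrightarrow> y \<in> car_e N \<Longrightarrow> f x y \<in> car_e L"
    and p: "\<And>a b. a \<in> car_ee M \<Longrightarrow> b \<in> car_ee N \<Longrightarrow> p a b \<in> car_ee L"
    and rels: "\<And>a a' b. a \<in> car_ee M \<Longrightarrow> a' \<in> car_ee M \<Longrightarrow> b \<in> car_ee N \<Longrightarrow> p (a \<oplus>\<^bsub>M\<^esub> a') b = p a b \<oplus>\<^bsub>L\<^esub> p a' b"
      "\<And>a b b'. a \<in> car_ee M \<Longrightarrow> b \<in> car_ee N \<Longrightarrow> b' \<in> car_ee N \<Longrightarrow> p a (b \<oplus>\<^bsub>N\<^esub> b') = p a b \<oplus>\<^bsub>L\<^esub> p a b'"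
      "\<And>x y y'. x \<in> car_e M \<Longrightarrow> y \<in> car_e N \<Longrightarrow> y' \<in> car_e N \<Longrightarrow> f x (y \<boxplus>\<^bsub>N\<^esub> y') = f x y \<boxplus>\<^bsub>L\<^esub> f x y'"
      "\<And>x x' y. x \<in> car_e M \<Longrightarrow> x' \<in> car_e M \<Longrightarrow> y \<in> car_e N \<Longrightarrow>
         f (x \<boxplus>\<^bsub>M\<^esub> x') y = f x y \<boxplus>\<^bsub>L\<^esub> f x' y \<boxplus>\<^bsub>L\<^esub> Pmap L (p (crossH M x' x) (Hmap N y))"
      "\<And>x b. x \<in> car_e M \<Longrightarrow> b \<in> car_ee N \<Longrightarrow> f x (Pmap N b) = Pmap L (p (crossH M x x) b)"
      "\<And>a y. a \<in> car_ee M \<Longrightarrow> y \<in> car_e N \<Longrightarrow> f (Pmap M a) y = Pmap L (p a (Delta N y))"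
      "\<And>a b. a \<in> car_ee M \<Longrightarrow> b \<in> car_ee N \<Longrightarrow> Pmap L (p (Tmap M a) (Tmap N b)) = \<boxminus>\<^bsub>L\<^esub> Pmap L (p a b)"
  shows "\<exists>h \<in> hom (lvl_e (SG_tensor M N)) (lvl_e L).
    (\<forall>x \<in> car_e M. \<forall>y \<in> car_e N. h (ten M N x y) = f x y) \<and>
    (\<forall>a \<in> car_ee M. \<forall>b \<in> car_ee N. h (Pmap (SG_tensor M N) (pur M N a b)) = Pmap L (p a b))"
proof -
  interpret sg_pair M N by (simp add: sg_pair_def)
  obtain \<sigma> where \<sigma>: "\<sigma> \<in> sg_hom (SG_tensor M N) MN"
    "\<And>u. u \<in> car_e MN \<Longrightarrow> map_e \<sigma> (code_e u) = u" "\<And>w. w \<in> car_ee MN \<Longrightarrow> map_ee \<sigma> (code_ee w) = w"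
    using code_mor_inverse[OF sq(1,2)] by blast
  have "\<exists>h \<in> hom TE (lvl_e L). (\<forall>x \<in> car_e M. \<forall>y \<in> car_e N. h (cir x y) = f x y) \<and>
    (\<forall>a \<in> car_ee M. \<forall>b \<in> car_ee N. h (br a b) = Pmap L (p a b))"
    by (rule tens_e_hom; (rule P_central)?) (simp_all add: square_group_e f p rels Pmap_add)
  then obtain h where h: "h \<in> hom TE (lvl_e L)"
    "\<And>x y. x \<in> car_e M \<Longrightarrow> y \<in> car_e N \<Longrightarrow> h (cir x y) = f x y"
    "\<And>a b. a \<in> car_ee M \<Longrightarrow> b \<in> car_ee N \<Longrightarrow> h (br a b) = Pmap L (p a b)" by blast
  have "(\<lambda>u. h (map_e \<sigma> u)) \<in> hom (lvl_e (SG_tensor M N)) (lvl_e L)"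
    using hom_compose[OF sg_homD(3)[OF \<sigma>(1)], of h "lvl_e L"] h(1) by (simp add: sg_tensor_simps comp_def)
  moreover have "h (map_e \<sigma> (ten M N x y)) = f x y" if "x \<in> car_e M" "y \<in> car_e N" for x y
    using that ten_eq[of M N x y] by (simp add: \<sigma> h)
  moreover have "h (map_e \<sigma> (Pmap (SG_tensor M N) (pur M N a b))) = Pmap L (p a b)"
    if "a \<in> car_ee M" "b \<in> car_ee N" for a b
  proof -
    have "map_e \<sigma> (Pmap (SG_tensor M N) (pur M N a b)) = br a b"
      using that pur_eq[of M N a b]
      by (simp add: sg_homD(8)[OF \<sigma>(1)] car_SG_tensor \<sigma>) (simp add: sg_tensor_simps tens_P_props)
    then show ?thesis using that h by simp
  qed
  ultimately show ?thesis by (intro bexI[of _ "\<lambda>u. h (map_e \<sigma> u)"]) simp_all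
qed

lemma SG_tensor_hom_ee:
  assumes sq [simp]: "square_group M" "square_group N" "square_group L"
    and p: "\<And>a b. a \<in> car_ee M \<Longrightarrow> b \<in> car_ee N \<Longrightarrow> p a b \<in> car_ee L"
      "\<And>a a' b. a \<in> car_ee M \<Longrightarrow> a' \<in> car_ee M \<Longrightarrow> b \<in> car_ee N \<Longrightarrow> p (a \<oplus>\<^bsub>M\<^esub> a') b = p a b \<oplus>\<^bsub>L\<^esub> p a' b"
      "\<And>a b b'. a \<in> car_ee M \<Longrightarrow> b \<in> car_ee N \<Longrightarrow> b' \<in> car_ee N \<Longrightarrow> p a (b \<oplus>\<^bsub>N\<^esub> b') = p a b \<oplus>\<^bsub>L\<^esub> p a b'"
  shows "\<exists>h \<in> hom (lvl_ee (SG_tensor M N)) (lvl_ee L).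
    (\<forall>a \<in> car_ee M. \<forall>b \<in> car_ee N. h (pur M N a b) = p a b)"
proof -
  interpret sg_pair M N by (simp add: sg_pair_def)
  obtain \<sigma> where \<sigma>: "\<sigma> \<in> sg_hom (SG_tensor M N) MN"
    "\<And>u. u \<in> car_e MN \<Longrightarrow> map_e \<sigma> (code_e u) = u" "\<And>w. w \<in> car_ee MN \<Longrightarrow> map_ee \<sigma> (code_ee w) = w"
    using code_mor_inverse[OF sq(1,2)] by blast
  have "\<exists>h \<in> hom TEE (lvl_ee L). \<forall>a \<in> car_ee M. \<forall>b \<in> car_ee N. h (pu a b) = p a b"
    by (rule ab.ab_tensor_hom[unfolded ab_tensor_fold]) (simp_all add: square_group_ee' p ee_ac)
  then obtain h where h: "h \<in> hom TEE (lvl_ee L)"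
    "\<And>a b. a \<in> car_ee M \<Longrightarrow> b \<in> car_ee N \<Longrightarrow> h (pu a b) = p a b" by blast
  have "(\<lambda>u. h (map_ee \<sigma> u)) \<in> hom (lvl_ee (SG_tensor M N)) (lvl_ee L)"
    using hom_compose[OF sg_homD(4)[OF \<sigma>(1)], of h "lvl_ee L"] h(1) by (simp add: sg_tensor_simps comp_def)
  moreover have "h (map_ee \<sigma> (pur M N a b)) = p a b" if "a \<in> car_ee M" "b \<in> car_ee N" for a b
    using that pur_eq[of M N a b] by (simp add: \<sigma> h)
  ultimately show ?thesis by (intro bexI[of _ "\<lambda>u. h (map_ee \<sigma> u)"]) simp_all
qed

lemma SG_tensor_map:
  assumes sq: "square_group M" "square_group M'" "square_group N" "square_group N'"
    and f: "f \<in> sg_hom M M'" and g: "g \<in> sg_hom N N'"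
  shows "SG_tensor_map f g \<in> sg_hom (SG_tensor M N) (SG_tensor M' N')"
    and "\<lbrakk>x \<in> car_e M; y \<in> car_e N\<rbrakk> \<Longrightarrow> map_e (SG_tensor_map f g) (ten M N x y) = ten M' N' (map_e f x) (map_e g y)"
    and "\<lbrakk>a \<in> car_ee M; b \<in> car_ee N\<rbrakk> \<Longrightarrow> map_ee (SG_tensor_map f g) (pur M N a b) = pur M' N' (map_ee f a) (map_ee g b)"
proof -
  let ?t = "sg_tensor_map f g" and ?S = "sg_tensor M N" and ?T = "sg_tensor M' N'"
  note t = sg_tensor_map_props[OF sq f g]
  have S: "square_group ?S" "square_group ?T"
    using sq by (auto intro!: sg_pair.square_group_sg_tensor simp: sg_pair_def)
  note inj = inj_code[of M N] inj_code[of M' N']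
  have src: "src ?t = ?S" "tgt ?t = ?T" using sg_homD(1,2)[OF t(1)] by auto
  have e: "map_e (SG_tensor_map f g) (code_e u) = code_e (map_e ?t u)" if "u \<in> car_e ?S" for u
    using that inj by (simp add: SG_tensor_map_def transport_mor_def src)
  have ee: "map_ee (SG_tensor_map f g) (code_ee w) = code_ee (map_ee ?t w)" if "w \<in> car_ee ?S" for w
    using that inj by (simp add: SG_tensor_map_def transport_mor_def src)
  note simps = e ee transport_sg_simps inj S transport_group_mult sg_homD(7-)[OF t(1)]
  have "src (SG_tensor_map f g) = SG_tensor M N" "tgt (SG_tensor_map f g) = SG_tensor M' N'"
    "map_e (SG_tensor_map f g) \<in> extensional (car_e (SG_tensor M N))"
    "map_ee (SG_tensor_map f g) \<in> extensional (car_ee (SG_tensor M N))"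
    by (simp_all add: SG_tensor_map_def transport_mor_def src SG_tensor_def transport_sg_simps)
  moreover have "map_e (SG_tensor_map f g) \<in> hom (lvl_e (SG_tensor M N)) (lvl_e (SG_tensor M' N'))"
    "map_ee (SG_tensor_map f g) \<in> hom (lvl_ee (SG_tensor M N)) (lvl_ee (SG_tensor M' N'))"
    unfolding SG_tensor_def by (rule homI; auto simp: simps)+
  moreover have "\<forall>x \<in> car_e (SG_tensor M N). map_ee (SG_tensor_map f g) (Hmap (SG_tensor M N) x) =
      Hmap (SG_tensor M' N') (map_e (SG_tensor_map f g) x)"
    "\<forall>a \<in> car_ee (SG_tensor M N). map_e (SG_tensor_map f g) (Pmap (SG_tensor M N) a) =
      Pmap (SG_tensor M' N') (map_ee (SG_tensor_map f g) a)"
    unfolding SG_tensor_def by (auto simp: simps)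
  ultimately show "SG_tensor_map f g \<in> sg_hom (SG_tensor M N) (SG_tensor M' N')"
    by (simp add: sg_hom_def)
  show "map_e (SG_tensor_map f g) (ten M N x y) = ten M' N' (map_e f x) (map_e g y)" if "x \<in> car_e M" "y \<in> car_e N"
    using that ten_eq[OF sq(1,3) that] ten_eq[OF sq(2,4), of "map_e f x" "map_e g y"]
    by (simp add: e t sg_homD(9)[OF f] sg_homD(9)[OF g])
  show "map_ee (SG_tensor_map f g) (pur M N a b) = pur M' N' (map_ee f a) (map_ee g b)" if "a \<in> car_ee M" "b \<in> car_ee N"
    using that pur_eq[OF sq(1,3) that] pur_eq[OF sq(2,4), of "map_ee f a" "map_ee g b"]
    by (simp add: ee t sg_homD(10)[OF f] sg_homD(10)[OF g])
qed

lemma P_cong: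
  "u = u' \<Longrightarrow> w = w' \<Longrightarrow> u \<boxplus>\<^bsub>K\<^esub> Pmap K w = u' \<boxplus>\<^bsub>K\<^esub> Pmap K w'"
  by simp

context sg_bimor
begin

text \<open>This is \<open>P T = P\<close> combined with \<open>Tmap_p\<close>. It is oriented so
  that one substitution moves \<open>T\<close> between the factors inside \<open>P\<close>, which is
  how correction terms are made to cancel.\<close>

lemma P_p_swap:
  assumes "a \<in> car_ee M" "b \<in> car_ee N"
  shows "Pmap K (p a b) = Pmap K (\<ominus>\<^bsub>K\<^esub> p (Tmap M a) (Tmap N b))"
proof -
  have "Pmap K (Tmap K (p a b)) = Pmap K (p a b)" using assms by simp
  then show ?thesis using assms by (simp only: Tmap_p)
qed

end

lemmas ten_closed [simp] = sg_bimor.f_closed[OF sg_bimor_ten]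
lemmas pur_closed [simp] = sg_bimor.p_closed[OF sg_bimor_ten]
lemmas pur_simps [simp] = sg_bimor.p_simps[OF sg_bimor_ten]
lemmas pur_add = sg_bimor.p_add_left[OF sg_bimor_ten] sg_bimor.p_add_right[OF sg_bimor_ten]
lemmas ten_add_right = sg_bimor.f_add_right[OF sg_bimor_ten]
lemmas ten_add_left = sg_bimor.f_add_left[OF sg_bimor_ten]
lemmas ten_P_right = sg_bimor.f_P_right[OF sg_bimor_ten]
lemmas ten_P_left = sg_bimor.f_P_left[OF sg_bimor_ten]
lemmas Tmap_pur = sg_bimor.Tmap_p[OF sg_bimor_ten]
lemmas crossH_ten = sg_bimor.crossH_f[OF sg_bimor_ten]
lemmas Hmap_ten = sg_bimor.Hmap_f[OF sg_bimor_ten]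
lemmas Delta_ten = sg_bimor.Delta_f[OF sg_bimor_ten]
lemmas P_pur_T = sg_bimor.P_p_T[OF sg_bimor_ten]
lemmas P_pur_swap = sg_bimor.P_p_swap[OF sg_bimor_ten]

lemma SG_tensor_eqI:
  assumes "square_group M" "square_group N" "square_group L"
    and "\<phi> \<in> sg_hom (SG_tensor M N) L" "\<psi> \<in> sg_hom (SG_tensor M N) L"
    and "sg_generated M S U" "sg_generated N S' U'"
    and "\<And>s t. s \<in> S \<Longrightarrow> t \<in> S' \<Longrightarrow> map_e \<phi> (ten M N s t) = map_e \<psi> (ten M N s t)"
    and "\<And>u v. u \<in> U \<Longrightarrow> v \<in> U' \<Longrightarrow> map_ee \<phi> (pur M N u v) = map_ee \<psi> (pur M N u v)"
  shows "\<phi> = \<psi>"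
  by (rule sg_hom_eqI[OF assms(4,5) _ _ sg_generated_ten[OF assms(1,2,6,7)]]) (use assms in auto)

section \<open>The symmetry\<close>

text \<open>The second summand makes \<open>x \<circledcirc> y \<mapsto> brd_e x y\<close> compatible with \<open>H\<close>: the swap of \<open>H (x \<circledcirc> y)\<close> and
  \<open>H (y \<circledcirc> x)\<close> differ by \<open>H (P (T (H y) \<otimes> H x))\<close>.\<close>

definition brd_e :: "'x sgU \<Rightarrow> 'x sgU \<Rightarrow> 'x elt \<Rightarrow> 'x elt \<Rightarrow> 'x elt" where
  "brd_e M N x y = ten N M y x \<boxplus>\<^bsub>SG_tensor N M\<^esub> Pmap (SG_tensor N M) (pur N M (Tmap N (Hmap N y)) (Hmap M x))"

lemma sg_bimor_brd:
  assumes [simp]: "square_group M" "square_group N"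
  shows "sg_bimor M N (SG_tensor N M) (brd_e M N) (\<lambda>a b. pur N M b a)"
proof -
  let ?K = "SG_tensor N M" let ?P = "Pmap ?K" let ?p = "pur N M"
  note simps = brd_e_def P_collect pur_add
  show ?thesis
  proof
    fix x y y' assume [simp]: "x \<in> car_e M" "y \<in> car_e N" "y' \<in> car_e N"
    \<comment> \<open>Expanding \<open>(y + y') \<circledcirc> x\<close> on the left produces
      \<open>(y'|y) \<otimes> H x\<close>. The correction term cancels it, as
      \<open>T (H (y + y'))\<close> contains \<open>T (y|y') = - (y'|y)\<close>.\<close>
    show "brd_e M N x (y \<boxplus>\<^bsub>N\<^esub> y') = brd_e M N x y \<boxplus>\<^bsub>?K\<^esub> brd_e M N x y'"
      by (simp add: simps ten_add_left Hmap_add Tmap_add Tmap_crossH)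
        (rule P_cong[OF HOL.refl], simp add: ee_norm ee_ac)
  next
    fix x x' y assume [simp]: "x \<in> car_e M" "x' \<in> car_e M" "y \<in> car_e N"
    \<comment> \<open>The right side is what the cross-effect in \<open>H (x + x')\<close> adds to
      the correction term; moving \<open>T\<close> inside \<open>P\<close> identifies it with the
      term that the relation demands.\<close>
    have *: "?P (?p (Hmap N y) (crossH M x' x)) = ?P (?p (Tmap N (Hmap N y)) (crossH M x x'))"
      by (subst P_pur_swap) (simp_all add: Tmap_crossH)
    show "brd_e M N (x \<boxplus>\<^bsub>M\<^esub> x') y = brd_e M N x y \<boxplus>\<^bsub>?K\<^esub> brd_e M N x' y \<boxplus>\<^bsub>?K\<^esub> ?P (?p (Hmap N y) (crossH M x' x))"
      by (simp add: * simps ten_add_right Hmap_add ee_ac)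
  next
    fix x b assume [simp]: "x \<in> car_e M" "b \<in> car_ee N"
    have *: "?P (?p (Tmap N b) (Hmap M x)) = ?P (\<ominus>\<^bsub>?K\<^esub> ?p b (Tmap M (Hmap M x)))"
      by (subst P_pur_swap) simp_all
    have "brd_e M N x (Pmap N b) = ?P (?p b (Delta M x)) \<boxplus>\<^bsub>?K\<^esub> (?P (?p b (Hmap M x)) \<boxplus>\<^bsub>?K\<^esub> ?P (?p (Tmap N b) (Hmap M x)))"
      by (simp add: brd_e_def ten_P_left HP_eq Tmap_add pur_add Pmap_add)
    also have "\<dots> = ?P (?p b (Delta M x) \<oplus>\<^bsub>?K\<^esub> (?p b (Hmap M x) \<oplus>\<^bsub>?K\<^esub> \<ominus>\<^bsub>?K\<^esub> ?p b (Tmap M (Hmap M x))))"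
      by (simp add: * Pmap_add)
    \<comment> \<open>By \<open>Delta_eq\<close>, \<open>Delta x + H x - T (H x) = (x|x)\<close>;
      the same identity for \<open>y\<close> settles the relation on the other side.\<close>
    also have "?p b (Delta M x) \<oplus>\<^bsub>?K\<^esub> (?p b (Hmap M x) \<oplus>\<^bsub>?K\<^esub> \<ominus>\<^bsub>?K\<^esub> ?p b (Tmap M (Hmap M x))) = ?p b (crossH M x x)"
      by (simp add: Delta_eq pur_add, simp add: ee_norm ee_ac)
    finally show "brd_e M N x (Pmap N b) = ?P (?p b (crossH M x x))" .
  next
    fix a y assume [simp]: "a \<in> car_ee M" "y \<in> car_e N"
    have *: "?P (?p (Tmap N (Hmap N y)) (Tmap M a)) = ?P (\<ominus>\<^bsub>?K\<^esub> ?p (Hmap N y) a)"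
      by (subst P_pur_swap) simp_all
    have "brd_e M N (Pmap M a) y = ?P (?p (crossH N y y) a) \<boxplus>\<^bsub>?K\<^esub> (?P (?p (Tmap N (Hmap N y)) (Tmap M a)) \<boxplus>\<^bsub>?K\<^esub> ?P (?p (Tmap N (Hmap N y)) a))"
      by (simp add: brd_e_def ten_P_right HP_eq pur_add Pmap_add)
    also have "\<dots> = ?P (?p (crossH N y y) a \<oplus>\<^bsub>?K\<^esub> (\<ominus>\<^bsub>?K\<^esub> ?p (Hmap N y) a \<oplus>\<^bsub>?K\<^esub> ?p (Tmap N (Hmap N y)) a))"
      by (simp add: * Pmap_add)
    also have "?p (crossH N y y) a \<oplus>\<^bsub>?K\<^esub> (\<ominus>\<^bsub>?K\<^esub> ?p (Hmap N y) a \<oplus>\<^bsub>?K\<^esub> ?p (Tmap N (Hmap N y)) a) = ?p (Delta N y) a"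
      by (simp add: Delta_eq pur_add, simp add: ee_norm ee_ac)
    finally show "brd_e M N (Pmap M a) y = ?P (?p (Delta N y) a)" .
  next
    fix x y assume [simp]: "x \<in> car_e M" "y \<in> car_e N"
    show "Hmap ?K (brd_e M N x y) = ?p (Hmap N y) (crossH M x x) \<oplus>\<^bsub>?K\<^esub> ?p (Delta N y) (Hmap M x)"
      by (simp add: brd_e_def Hmap_add HP_eq Hmap_ten Tmap_pur Delta_eq pur_add, simp add: ee_norm ee_ac)
  qed (simp_all add: pur_add Tmap_pur brd_e_def crossH_add crossH_ten)
qed

definition brd :: "'x sgU \<Rightarrow> 'x sgU \<Rightarrow> 'x morU" where
  "brd M N = lift M N (SG_tensor N M) (brd_e M N) (\<lambda>a b. pur N M b a)"

context
  fixes M N :: "'x sgU"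
  assumes sq [simp]: "square_group M" "square_group N"
begin

lemma brd_hom: "brd M N \<in> sg_hom (SG_tensor M N) (SG_tensor N M)"
  unfolding brd_def by (rule lift_hom[OF sg_bimor_brd]) simp_all

lemma brd_ten: "x \<in> car_e M \<Longrightarrow> y \<in> car_e N \<Longrightarrow> map_e (brd M N) (ten M N x y) =
    ten N M y x \<boxplus>\<^bsub>SG_tensor N M\<^esub> Pmap (SG_tensor N M) (pur N M (Tmap N (Hmap N y)) (Hmap M x))"
  unfolding brd_def by (subst lift_ten[OF sg_bimor_brd]) (simp_all add: brd_e_def)

lemma brd_pur: "a \<in> car_ee M \<Longrightarrow> b \<in> car_ee N \<Longrightarrow> map_ee (brd M N) (pur M N a b) = pur N M b a"
  unfolding brd_def by (subst lift_pur[OF sg_bimor_brd]) simp_all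

end

lemmas brd_maps = sg_homD(8,9,10,11,12)[OF brd_hom] sg_hom_pres(1)[OF brd_hom]

lemma brd_brd:
  assumes [simp]: "square_group M" "square_group N"
  shows "sg_comp (brd N M) (brd M N) = sg_id (SG_tensor M N)"
proof (rule SG_tensor_eqI[OF assms _ _ _ sg_generated_carrier[OF assms(1)] sg_generated_carrier[OF assms(2)]])
  show "sg_comp (brd N M) (brd M N) \<in> sg_hom (SG_tensor M N) (SG_tensor M N)"
    by (rule sg_comp_hom[OF brd_hom brd_hom]) simp_all
  fix x y assume [simp]: "x \<in> car_e M" "y \<in> car_e N"
  let ?K = "SG_tensor M N"
  \<comment> \<open>The second symmetry adds \<open>P\<close> of
    \<open>T (H x) \<otimes> H y\<close> and carries the first correction to \<open>P\<close> of
    \<open>H x \<otimes> T (H y)\<close>; these two are opposite.\<close>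
  have *: "Pmap ?K (pur M N (Hmap M x) (Tmap N (Hmap N y))) = Pmap ?K (\<ominus>\<^bsub>?K\<^esub> pur M N (Tmap M (Hmap M x)) (Hmap N y))"
    by (subst P_pur_swap) simp_all
  show "map_e (sg_comp (brd N M) (brd M N)) (ten M N x y) = map_e (sg_id ?K) (ten M N x y)"
    by (simp add: map_sg_comp_hom[OF brd_hom] brd_ten brd_pur brd_maps * P_collect)
qed (simp_all add: sg_id_hom map_sg_comp_hom[OF brd_hom] brd_pur)

section \<open>The unit\<close>

lemma double_choose2: "2 * (n * (n - 1) div 2) = n * (n - 1)" for n :: int
  by simp

lemma choose2_add: "(m + n) * (m + n - 1) div 2 = m * (m - 1) div 2 + n * (n - 1) div 2 + m * n" for m n :: int
proof -
  have "2 * ((m + n) * (m + n - 1) div 2) = 2 * (m * (m - 1) div 2 + n * (n - 1) div 2 + m * n)"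
    unfolding distrib_left[of 2] double_choose2 by (simp add: algebra_simps)
  then show ?thesis by (simp only: mult_cancel_left) auto
qed

text \<open>The left side is kept in the unsimplified form in which the binomial coefficient of
  \<open>lun_e\<close> and \<open>Hmap_pow\<close> appears at \<open>n + 1\<close>, so that it can
  serve as a rewrite rule.\<close>

lemma choose2_Suc: "(n + 1) * (n + 1 - 1) div 2 = n * (n - 1) div 2 + (n :: int)"
  using choose2_add[of n 1] by simp

lemma comm_group_integer_group: "comm_group integer_group"
  by (rule group.group_comm_groupI) simp_all

lemma inv_integer_group: "inv\<^bsub>integer_group\<^esub> n = - n"
  by (rule group.inv_equality[OF group_integer_group]) simp_all

lemma cross_effect_Z_nil: "crossH Z_nil m n = m * n"
  by (simp add: Z_nil_def cross_effect_def inv_integer_group choose2_add)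

lemma square_group_Z_nil: "square_group Z_nil"
proof -
  have "quadratic integer_group integer_group (\<lambda>n. n * (n - 1) div 2)"
  proof (rule quadraticI(1)[OF comm_group_integer_group, where c = "(*)"])
    show "(\<lambda>x. x * y) \<in> hom integer_group integer_group" "(*) y \<in> hom integer_group integer_group" for y :: int
      by (auto intro!: homI simp: algebra_simps)
  qed (simp_all add: choose2_add)
  then show ?thesis
    using cross_effect_Z_nil
    by (simp add: square_group_def Z_nil_def comm_group_integer_group inv_integer_group hom_def)
qed

lemma inj_Num: "inj_on Num A"
  by (simp add: inj_on_def)

lemma square_group_SG_unit [simp]: "square_group SG_unit"
  unfolding SG_unit_def by (rule square_group_transport_sg[OF square_group_Z_nil inj_Num inj_Num])

lemma SG_unit_simps [simp]:
  "car_e SG_unit = range Num" "car_ee SG_unit = range Num"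
  "Num m \<boxplus>\<^bsub>SG_unit\<^esub> Num n = Num (m + n)" "Num m \<oplus>\<^bsub>SG_unit\<^esub> Num n = Num (m + n)"
  "\<zero>\<^sub>e\<^bsub>SG_unit\<^esub> = Num 0" "\<zero>\<^bsub>SG_unit\<^esub> = Num 0"
  "Hmap SG_unit (Num n) = Num (n * (n - 1) div 2)"
  "Pmap SG_unit (Num n) = Num 0"
proof -
  have i: "inv_into UNIV Num (Num n) = n" for n :: int by (rule inv_into_f_f[OF inj_Num]) simp
  show "car_e SG_unit = range Num" "car_ee SG_unit = range Num"
    "Num m \<boxplus>\<^bsub>SG_unit\<^esub> Num n = Num (m + n)" "Num m \<oplus>\<^bsub>SG_unit\<^esub> Num n = Num (m + n)"
    "\<zero>\<^sub>e\<^bsub>SG_unit\<^esub> = Num 0" "\<zero>\<^bsub>SG_unit\<^esub> = Num 0"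
    "Hmap SG_unit (Num n) = Num (n * (n - 1) div 2)"
    "Pmap SG_unit (Num n) = Num 0"
    by (simp_all add: SG_unit_def Z_nil_def transport_sg_def transport_group_def i)
qed

lemma SG_unit_neg [simp]: "\<ominus>\<^bsub>SG_unit\<^esub> Num n = Num (- n)" "\<boxminus>\<^bsub>SG_unit\<^esub> Num n = Num (- n)"
  by (rule group.inv_equality, simp_all add: square_group_e square_group_ee')+

text \<open>\<open>T\<close> is negation because \<open>P = 0\<close>, and then
  \<open>Delta n\<close> is \<open>n * n\<close> minus twice the binomial coefficient, that is,
  \<open>n\<close>.\<close>

lemma SG_unit_derived [simp]:
  "crossH SG_unit (Num m) (Num n) = Num (m * n)"
  "Tmap SG_unit (Num n) = Num (- n)"
  "Delta SG_unit (Num n) = Num n"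
proof -
  show c: "crossH SG_unit (Num m) (Num n) = Num (m * n)" for m n
    by (simp add: cross_effect_def choose2_add)
  show T: "Tmap SG_unit (Num n) = Num (- n)" for n
    by (simp add: Tmap_def)
  show "Delta SG_unit (Num n) = Num n"
    using double_choose2[of n] by (simp add: Delta_eq c T algebra_simps)
qed

text \<open>Diagrams with the unit can therefore be checked at \<open>Num 1\<close>, where the
  binomial term of \<open>lun_e\<close> is zero.\<close>

lemma sg_generated_SG_unit: "sg_generated (SG_unit :: 'x sgU) {Num 1} {Num 1}"
proof -
  have gen: "Num n \<in> generate G S" if "group G" "Num 1 \<in> S" "\<And>m n. Num m \<otimes>\<^bsub>G\<^esub> Num n = Num (m + n)"
    "\<one>\<^bsub>G\<^esub> = Num 0" "inv\<^bsub>G\<^esub> Num 1 = Num (- 1)" for G :: "'x elt monoid" and S n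
  proof (induction n rule: int_induct[where k = 0])
    case base
    show ?case using generate.one[of G S] that by simp
  next
    case (step1 i)
    show ?case using generate.eng[OF step1(2) generate.incl[OF that(2)]] that by simp
  next
    case (step2 i)
    show ?case using generate.eng[OF step2(2) generate.inv[OF that(2)]] that by simp
  qed
  have "range Num \<subseteq> generate (lvl_ee (SG_unit :: 'x sgU)) {Num 1}"
    "range Num \<subseteq> generate (lvl_e (SG_unit :: 'x sgU)) ({Num 1} \<union> Pmap SG_unit ` {Num 1})"
    by (auto intro!: gen simp: square_group_e square_group_ee')
  then show ?thesis
    using generate_eq_carrierI[OF square_group_ee'[of "SG_unit :: 'x sgU"], of "{Num 1}"]
      generate_eq_carrierI[OF square_group_e[of "SG_unit :: 'x sgU"], of "{Num 1} \<union> Pmap SG_unit ` {Num 1}"]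
    by (simp add: sg_generated_def)
qed

text \<open>Both sides start equal and grow by the same increment \<open>s n\<close>; cancelling
  \<open>s (n - 1)\<close> covers negative \<open>n\<close>. Identities between integer multiples in
  a non-commutative group are reduced in this way to a comparison of increments.\<close>

lemma int_recursion_unique:
  assumes G: "group G"
    and F: "\<And>n. F n \<in> carrier G" "\<And>n. F' n \<in> carrier G" "\<And>n. s n \<in> carrier G"
    and zero: "F 0 = F' 0"
    and step: "\<And>n. F (n + 1) = F n \<otimes>\<^bsub>G\<^esub> s n" "\<And>n. F' (n + 1) = F' n \<otimes>\<^bsub>G\<^esub> s n"
  shows "F n = F' (n :: int)"
proof -
  interpret group G by fact
  show ?thesis
  proof (induction n rule: int_induct[where k = 0])
    case (step2 i)
    have "F (i - 1) \<otimes>\<^bsub>G\<^esub> s (i - 1) = F' (i - 1) \<otimes>\<^bsub>G\<^esub> s (i - 1)"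
      using step2 step(1)[of "i - 1"] step(2)[of "i - 1"] by simp
    then show ?case using F by simp
  qed (simp_all add: zero step)
qed

section \<open>Integer multiples in square groups\<close>

abbreviation pow_e :: "('a, 'b) sq_group \<Rightarrow> int \<Rightarrow> 'a \<Rightarrow> 'a" where
  "pow_e N n x \<equiv> x [^]\<^bsub>lvl_e N\<^esub> n"

abbreviation pow_ee :: "('a, 'b) sq_group \<Rightarrow> int \<Rightarrow> 'b \<Rightarrow> 'b" where
  "pow_ee N n a \<equiv> a [^]\<^bsub>lvl_ee N\<^esub> n"

lemmas pow_e_simps [simp] = group.int_pow_closed[OF square_group_e] group.int_pow_1[OF square_group_e]
lemmas pow_ee_simps [simp] = group.int_pow_closed[OF square_group_ee'] group.int_pow_1[OF square_group_ee']
lemmas pow_e_add = group.int_pow_mult[OF square_group_e]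
lemmas pow_ee_add = group.int_pow_mult[OF square_group_ee']
lemmas pow_ee_pow = group.int_pow_pow[OF square_group_ee']
lemmas pow_ee_neg = group.int_pow_neg[OF square_group_ee']
lemmas pow_ee_distrib = comm_group.int_pow_distrib[OF square_group_ee]

context
  fixes N :: "('a, 'b) sq_group"
  assumes sq [simp]: "square_group N"
begin

lemma pow_ee_neg_base: "a \<in> car_ee N \<Longrightarrow> pow_ee N n (\<ominus>\<^bsub>N\<^esub> a) = \<ominus>\<^bsub>N\<^esub> pow_ee N n a"
  using group.int_pow_inv[OF square_group_ee'[OF sq]] by simp

lemma hom_pow_ee: "f \<in> hom (lvl_ee N) (lvl_ee N) \<Longrightarrow> a \<in> car_ee N \<Longrightarrow> f (pow_ee N n a) = pow_ee N n (f a)"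
  by (rule hom_int_pow) (simp_all add: square_group_ee')

lemma pow_ee_zero: "pow_ee N n \<zero>\<^bsub>N\<^esub> = \<zero>\<^bsub>N\<^esub>"
  by (rule int_recursion_unique[where F = "\<lambda>n. pow_ee N n \<zero>\<^bsub>N\<^esub>" and F' = "\<lambda>n. \<zero>\<^bsub>N\<^esub>" and s = "\<lambda>n. \<zero>\<^bsub>N\<^esub>", OF square_group_ee'[OF sq]])
    (simp_all add: pow_ee_add)

lemma Pmap_pow: "a \<in> car_ee N \<Longrightarrow> Pmap N (pow_ee N n a) = pow_e N n (Pmap N a)"
  by (rule hom_int_pow[OF Pmap_hom]) (simp_all add: square_group_e square_group_ee')

lemma crossH_pow:
  "x \<in> car_e N \<Longrightarrow> y \<in> car_e N \<Longrightarrow> crossH N (pow_e N n x) y = pow_ee N n (crossH N x y)"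
  "x \<in> car_e N \<Longrightarrow> y \<in> car_e N \<Longrightarrow> crossH N x (pow_e N n y) = pow_ee N n (crossH N x y)"
  using hom_int_pow[OF crossH_hom_left, of N y x n] hom_int_pow[OF crossH_hom_right, of N x y n]
  by (simp_all add: square_group_e square_group_ee')

text \<open>Passing from \<open>n\<close> to \<open>n + 1\<close> adds \<open>H y\<close> and the
  cross-effect of \<open>n y\<close> with \<open>y\<close>, which is \<open>n\<close> times
  \<open>(y|y)\<close>; these add up to the binomial coefficient.\<close>

lemma Hmap_pow:
  assumes [simp]: "y \<in> car_e N"
  shows "Hmap N (pow_e N n y) = pow_ee N n (Hmap N y) \<oplus>\<^bsub>N\<^esub> pow_ee N (n * (n - 1) div 2) (crossH N y y)"
proof (rule int_recursion_unique[where s = "\<lambda>n. Hmap N y \<oplus>\<^bsub>N\<^esub> pow_ee N n (crossH N y y)",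
      OF square_group_ee'[OF sq], where F = "\<lambda>n. Hmap N (pow_e N n y)"])
  show "Hmap N (pow_e N (n + 1) y) = Hmap N (pow_e N n y) \<oplus>\<^bsub>N\<^esub> (Hmap N y \<oplus>\<^bsub>N\<^esub> pow_ee N n (crossH N y y))" for n
    by (simp add: pow_e_add Hmap_add crossH_pow ee_assoc)
  show "pow_ee N (n + 1) (Hmap N y) \<oplus>\<^bsub>N\<^esub> pow_ee N ((n + 1) * (n + 1 - 1) div 2) (crossH N y y) =
      pow_ee N n (Hmap N y) \<oplus>\<^bsub>N\<^esub> pow_ee N (n * (n - 1) div 2) (crossH N y y) \<oplus>\<^bsub>N\<^esub>
        (Hmap N y \<oplus>\<^bsub>N\<^esub> pow_ee N n (crossH N y y))" for n
    by (simp only: choose2_Suc) (simp add: pow_ee_add ee_ac)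
qed simp_all

end

text \<open>The term with \<open>P\<close> is forced by \<open>n \<circledcirc> y = n (1 \<circledcirc> y) + binomial n 2 \<cdot> (1 \<otimes> H y)\<close>.\<close>

fun lun_e :: "'x sgU \<Rightarrow> 'x elt \<Rightarrow> 'x elt \<Rightarrow> 'x elt" where
  "lun_e N (Num n) y = pow_e N n y \<boxplus>\<^bsub>N\<^esub> Pmap N (pow_ee N (n * (n - 1) div 2) (Hmap N y))"
| "lun_e N _ y = undefined"

fun lun_ee :: "'x sgU \<Rightarrow> 'x elt \<Rightarrow> 'x elt \<Rightarrow> 'x elt" where
  "lun_ee N (Num n) b = pow_ee N n b"
| "lun_ee N _ b = undefined"

lemma sg_bimor_lun:
  assumes [simp]: "square_group (N :: 'x sgU)"
  shows "sg_bimor SG_unit N N (lun_e N) (lun_ee N)"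
proof -
  let ?c = "\<lambda>n::int. n * (n - 1) div 2"
  \<comment> \<open>This is where the binomial term acts: \<open>n (y + y')\<close> and
    \<open>n y + n y'\<close> differ by \<open>P\<close> of \<open>binomial n 2\<close> times
    \<open>(y|y')\<close>, and the cross-effect in \<open>H (y + y')\<close> makes up for it. The
    increment from \<open>n\<close> to \<open>n + 1\<close> isolates a single exchange, that of
    \<open>y\<close> with \<open>n y'\<close>.\<close>
  have lun_add: "lun_e N (Num n) (y \<boxplus>\<^bsub>N\<^esub> y') = lun_e N (Num n) y \<boxplus>\<^bsub>N\<^esub> lun_e N (Num n) y'"
    if [simp]: "y \<in> car_e N" "y' \<in> car_e N" for n y y'
  proof (rule int_recursion_unique[where F = "\<lambda>n. lun_e N (Num n) (y \<boxplus>\<^bsub>N\<^esub> y')"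
        and s = "\<lambda>n. y \<boxplus>\<^bsub>N\<^esub> y' \<boxplus>\<^bsub>N\<^esub> Pmap N (pow_ee N n (Hmap N (y \<boxplus>\<^bsub>N\<^esub> y')))", OF square_group_e[of N]])
    fix n :: int
    have S: "lun_e N (Num (n + 1)) z = lun_e N (Num n) z \<boxplus>\<^bsub>N\<^esub> (z \<boxplus>\<^bsub>N\<^esub> Pmap N (pow_ee N n (Hmap N z)))"
      if [simp]: "z \<in> car_e N" for z
      unfolding lun_e.simps choose2_Suc by (simp add: pow_e_add pow_ee_add P_collect)
    show "lun_e N (Num (n + 1)) (y \<boxplus>\<^bsub>N\<^esub> y') = lun_e N (Num n) (y \<boxplus>\<^bsub>N\<^esub> y') \<boxplus>\<^bsub>N\<^esub>
        (y \<boxplus>\<^bsub>N\<^esub> y' \<boxplus>\<^bsub>N\<^esub> Pmap N (pow_ee N n (Hmap N (y \<boxplus>\<^bsub>N\<^esub> y'))))"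
      by (rule S) simp
    let ?h = "Hmap N y" and ?h' = "Hmap N y'"
    have swap: "y \<boxplus>\<^bsub>N\<^esub> pow_e N n y' = pow_e N n y' \<boxplus>\<^bsub>N\<^esub> y \<boxplus>\<^bsub>N\<^esub> Pmap N (pow_ee N n (crossH N y y'))"
      using add_swap[of N y "pow_e N n y'"] by (simp add: crossH_pow)
    have "lun_e N (Num (n + 1)) y \<boxplus>\<^bsub>N\<^esub> lun_e N (Num (n + 1)) y' =
        pow_e N n y \<boxplus>\<^bsub>N\<^esub> (y \<boxplus>\<^bsub>N\<^esub> pow_e N n y') \<boxplus>\<^bsub>N\<^esub> y' \<boxplus>\<^bsub>N\<^esub>
          Pmap N (pow_ee N (?c n) ?h \<oplus>\<^bsub>N\<^esub> pow_ee N n ?h \<oplus>\<^bsub>N\<^esub> (pow_ee N (?c n) ?h' \<oplus>\<^bsub>N\<^esub> pow_ee N n ?h'))"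
      by (simp add: S del: lun_e.simps, simp add: P_collect, simp add: e_assoc)
    also have "\<dots> = pow_e N n y \<boxplus>\<^bsub>N\<^esub> (pow_e N n y' \<boxplus>\<^bsub>N\<^esub> y) \<boxplus>\<^bsub>N\<^esub> Pmap N (pow_ee N n (crossH N y y')) \<boxplus>\<^bsub>N\<^esub>
        (y' \<boxplus>\<^bsub>N\<^esub>
          Pmap N (pow_ee N (?c n) ?h \<oplus>\<^bsub>N\<^esub> pow_ee N n ?h \<oplus>\<^bsub>N\<^esub> (pow_ee N (?c n) ?h' \<oplus>\<^bsub>N\<^esub> pow_ee N n ?h')))"
      unfolding swap by (simp add: e_assoc)
    also have "\<dots> = pow_e N n y \<boxplus>\<^bsub>N\<^esub> pow_e N n y' \<boxplus>\<^bsub>N\<^esub> (y \<boxplus>\<^bsub>N\<^esub> y') \<boxplus>\<^bsub>N\<^esub>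
        Pmap N (pow_ee N (?c n) ?h \<oplus>\<^bsub>N\<^esub> pow_ee N (?c n) ?h' \<oplus>\<^bsub>N\<^esub> pow_ee N n (?h \<oplus>\<^bsub>N\<^esub> ?h' \<oplus>\<^bsub>N\<^esub> crossH N y y'))"
      by (subst P_collect_add) (simp_all add: e_assoc pow_ee_distrib ee_ac)
    also have "\<dots> = lun_e N (Num n) y \<boxplus>\<^bsub>N\<^esub> lun_e N (Num n) y' \<boxplus>\<^bsub>N\<^esub>
        (y \<boxplus>\<^bsub>N\<^esub> y' \<boxplus>\<^bsub>N\<^esub> Pmap N (pow_ee N n (Hmap N (y \<boxplus>\<^bsub>N\<^esub> y'))))"
      by (simp add: P_collect Hmap_add)
    finally show "lun_e N (Num (n + 1)) y \<boxplus>\<^bsub>N\<^esub> lun_e N (Num (n + 1)) y' =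
        lun_e N (Num n) y \<boxplus>\<^bsub>N\<^esub> lun_e N (Num n) y' \<boxplus>\<^bsub>N\<^esub>
        (y \<boxplus>\<^bsub>N\<^esub> y' \<boxplus>\<^bsub>N\<^esub> Pmap N (pow_ee N n (Hmap N (y \<boxplus>\<^bsub>N\<^esub> y'))))" .
  qed simp_all
  \<comment> \<open>This matches \<open>(n|n) = n * n\<close> in the unit with the \<open>n\<close>
    and the two copies of the binomial coefficient that arise from \<open>lun_e\<close>.\<close>
  have sum: "n + (?c n + ?c n) = n * n" for n
    using double_choose2[of n] by (simp add: algebra_simps)
  show ?thesis
  proof
    fix x x' y :: "'x elt" assume "x \<in> car_e SG_unit" "x' \<in> car_e SG_unit" and [simp]: "y \<in> car_e N"
    then obtain m n where x [simp]: "x = Num m" "x' = Num n" by auto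
    show "lun_e N (x \<boxplus>\<^bsub>SG_unit\<^esub> x') y = lun_e N x y \<boxplus>\<^bsub>N\<^esub> lun_e N x' y \<boxplus>\<^bsub>N\<^esub>
        Pmap N (lun_ee N (crossH SG_unit x' x) (Hmap N y))"
      by (simp add: choose2_add pow_e_add pow_ee_add P_collect mult.commute)
  next
    fix x b :: "'x elt" assume "x \<in> car_e SG_unit" and [simp]: "b \<in> car_ee N"
    then obtain n where x [simp]: "x = Num n" by auto
    have 1: "pow_ee N (?c n) b \<oplus>\<^bsub>N\<^esub> pow_ee N (?c n) b = pow_ee N (?c n + ?c n) b"
      by (rule pow_ee_add[symmetric]) simp_all
    have "lun_e N x (Pmap N b) = Pmap N (pow_ee N n b) \<boxplus>\<^bsub>N\<^esub> Pmap N (pow_ee N (?c n) (Tmap N b) \<oplus>\<^bsub>N\<^esub> pow_ee N (?c n) b)"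
      by (simp add: Pmap_pow HP_eq pow_ee_distrib)
    also have "\<dots> = Pmap N (pow_ee N n b) \<boxplus>\<^bsub>N\<^esub> (Pmap N (Tmap N (pow_ee N (?c n) b)) \<boxplus>\<^bsub>N\<^esub> Pmap N (pow_ee N (?c n) b))"
      by (simp only: hom_pow_ee[OF _ Tmap_hom] assms \<open>b \<in> car_ee N\<close>) (simp add: Pmap_add)
    also have "\<dots> = Pmap N (pow_ee N n b \<oplus>\<^bsub>N\<^esub> (pow_ee N (?c n) b \<oplus>\<^bsub>N\<^esub> pow_ee N (?c n) b))"
      by (simp add: Pmap_add)
    also have "\<dots> = Pmap N (pow_ee N (n * n) b)"
      unfolding 1 sum[of n, symmetric] by (simp only: pow_ee_add assms \<open>b \<in> car_ee N\<close>)
    finally show "lun_e N x (Pmap N b) = Pmap N (lun_ee N (crossH SG_unit x x) b)" by simp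
  next
    fix a y :: "'x elt" assume "a \<in> car_ee SG_unit" and [simp]: "y \<in> car_e N"
    then obtain n where a [simp]: "a = Num n" by auto
    \<comment> \<open>Both sides are zero: \<open>P\<close> vanishes on the unit, and
      \<open>P\<close> kills \<open>Delta\<close>.\<close>
    show "lun_e N (Pmap SG_unit a) y = Pmap N (lun_ee N a (Delta N y))"
      using Pmap_pow[of N "\<zero>\<^bsub>N\<^esub>" n] by (simp add: Pmap_pow P_Delta pow_ee_zero)
  next
    fix x y x' y' :: "'x elt"
    assume "x \<in> car_e SG_unit" "x' \<in> car_e SG_unit" and [simp]: "y \<in> car_e N" "y' \<in> car_e N"
    then obtain m n where x [simp]: "x = Num m" "x' = Num n" by auto
    show "crossH N (lun_e N x y) (lun_e N x' y') = lun_ee N (crossH SG_unit x x') (crossH N y y')"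
      by (simp add: crossH_add crossH_pow pow_ee_pow mult.commute)
  next
    fix x y :: "'x elt" assume "x \<in> car_e SG_unit" and [simp]: "y \<in> car_e N"
    then obtain n where x [simp]: "x = Num n" by auto
    have "pow_ee N (n * n) (Hmap N y) = pow_ee N n (Hmap N y) \<oplus>\<^bsub>N\<^esub> (pow_ee N (?c n) (Hmap N y) \<oplus>\<^bsub>N\<^esub> pow_ee N (?c n) (Hmap N y))"
      unfolding sum[of n, symmetric] by (simp only: pow_ee_add Hmap_closed assms \<open>y \<in> car_e N\<close>)
    then show "Hmap N (lun_e N x y) = lun_ee N (crossH SG_unit x x) (Hmap N y) \<oplus>\<^bsub>N\<^esub> lun_ee N (Hmap SG_unit x) (Delta N y)"
      by (simp add: Hmap_add Hmap_pow HP_eq hom_pow_ee[OF _ Tmap_hom] Delta_eq pow_ee_distrib pow_ee_neg_base)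
        (simp add: ee_norm ee_ac)
  qed (auto simp: lun_add[unfolded lun_e.simps] pow_ee_add pow_ee_distrib hom_pow_ee[OF _ Tmap_hom] pow_ee_neg)
qed

definition lun :: "'x sgU \<Rightarrow> 'x morU" where
  "lun N = lift SG_unit N N (lun_e N) (lun_ee N)"

text \<open>Obtained from \<open>lun\<close> through the symmetry, so that no second bimorphism has
  to be verified.\<close>

definition run :: "'x sgU \<Rightarrow> 'x morU" where
  "run N = sg_comp (lun N) (brd N SG_unit)"

context
  fixes N :: "'x sgU"
  assumes sq [simp]: "square_group N"
begin

lemma lun_hom: "lun N \<in> sg_hom (SG_tensor SG_unit N) N"
  unfolding lun_def by (rule lift_hom[OF sg_bimor_lun]) simp

lemma lun_ten: "y \<in> car_e N \<Longrightarrow> map_e (lun N) (ten SG_unit N (Num 1) y) = y"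
  unfolding lun_def by (subst lift_ten[OF sg_bimor_lun]) simp_all

lemma lun_pur: "b \<in> car_ee N \<Longrightarrow> map_ee (lun N) (pur SG_unit N (Num 1) b) = b"
  unfolding lun_def by (subst lift_pur[OF sg_bimor_lun]) simp_all

lemma lun_iso: "lun N \<in> sg_iso (SG_tensor SG_unit N) N"
proof (rule sg_isoI[OF lun_hom])
  \<comment> \<open>The inverse sends \<open>y\<close> to \<open>1 \<circledcirc> y\<close>. It
    respects \<open>H\<close> and \<open>P\<close> because \<open>H 1 = 0\<close> and
    \<open>(1|1) = 1\<close>.\<close>
  define \<psi> where "\<psi> = \<lparr>src = N, tgt = SG_tensor SG_unit N,
    map_e = (\<lambda>y \<in> car_e N. ten SG_unit N (Num 1) y), map_ee = (\<lambda>b \<in> car_ee N. pur SG_unit N (Num 1) b)\<rparr>"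
  show \<psi>: "\<psi> \<in> sg_hom N (SG_tensor SG_unit N)"
    using pur_simps(1)[of SG_unit N]
    by (simp add: sg_hom_def \<psi>_def hom_def ten_add_right pur_add Hmap_ten ten_P_right)
  show "sg_comp (lun N) \<psi> = sg_id N"
    by (rule sg_hom_ext[OF sg_comp_hom[OF \<psi> lun_hom] sg_id_hom])
      (simp_all add: map_sg_comp_hom[OF \<psi>], simp_all add: \<psi>_def lun_ten lun_pur)
  show "sg_comp \<psi> (lun N) = sg_id (SG_tensor SG_unit N)"
    by (rule SG_tensor_eqI[OF _ _ _ sg_comp_hom[OF lun_hom \<psi>] sg_id_hom
          sg_generated_SG_unit sg_generated_carrier])
      (simp_all add: map_sg_comp_hom[OF lun_hom] lun_ten lun_pur, simp_all add: \<psi>_def)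
qed

end

section \<open>The associativity constraint\<close>

text \<open>Exchanging the two middle summands costs \<open>P\<close> of their cross-effect. This is
  what makes a sum of two homomorphisms into \<open>L\<close> fail to be additive, as has to be
  compensated in \<open>psi_e_add_left\<close>.\<close>

lemma add_interchange:
  assumes [simp]: "square_group L" "a \<in> car_e L" "a' \<in> car_e L" "b \<in> car_e L" "b' \<in> car_e L" "w \<in> car_ee L"
  shows "a \<boxplus>\<^bsub>L\<^esub> b \<boxplus>\<^bsub>L\<^esub> (a' \<boxplus>\<^bsub>L\<^esub> b') \<boxplus>\<^bsub>L\<^esub> Pmap L w =
    a \<boxplus>\<^bsub>L\<^esub> a' \<boxplus>\<^bsub>L\<^esub> (b \<boxplus>\<^bsub>L\<^esub> b') \<boxplus>\<^bsub>L\<^esub> Pmap L (w \<oplus>\<^bsub>L\<^esub> crossH L b a')"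
proof -
  have "a \<boxplus>\<^bsub>L\<^esub> b \<boxplus>\<^bsub>L\<^esub> (a' \<boxplus>\<^bsub>L\<^esub> b') \<boxplus>\<^bsub>L\<^esub> Pmap L w = a \<boxplus>\<^bsub>L\<^esub> (b \<boxplus>\<^bsub>L\<^esub> a') \<boxplus>\<^bsub>L\<^esub> (b' \<boxplus>\<^bsub>L\<^esub> Pmap L w)"
    by (simp add: e_assoc)
  also have "\<dots> = a \<boxplus>\<^bsub>L\<^esub> (a' \<boxplus>\<^bsub>L\<^esub> b \<boxplus>\<^bsub>L\<^esub> Pmap L (crossH L b a')) \<boxplus>\<^bsub>L\<^esub> (b' \<boxplus>\<^bsub>L\<^esub> Pmap L w)"
    by (subst add_swap[of L b a']) simp_all
  also have "\<dots> = a \<boxplus>\<^bsub>L\<^esub> a' \<boxplus>\<^bsub>L\<^esub> b \<boxplus>\<^bsub>L\<^esub> Pmap L (crossH L b a') \<boxplus>\<^bsub>L\<^esub> (b' \<boxplus>\<^bsub>L\<^esub> Pmap L w)"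
    by (simp add: e_assoc)
  also have "\<dots> = a \<boxplus>\<^bsub>L\<^esub> a' \<boxplus>\<^bsub>L\<^esub> b \<boxplus>\<^bsub>L\<^esub> b' \<boxplus>\<^bsub>L\<^esub> Pmap L (crossH L b a' \<oplus>\<^bsub>L\<^esub> w)"
    by (rule P_collect_add) simp_all
  finally show ?thesis by (simp add: e_assoc ee_ac)
qed

text \<open>The formula for \<open>H (x \<circledcirc> v)\<close> is of this kind in
  \<open>v\<close>: the term with \<open>H v\<close> is quadratic, the one with
  \<open>Delta v\<close> additive.\<close>

lemma quadratic_mult_hom:
  assumes q: "quadratic G A q" and d: "d \<in> hom G A" and G: "group G" and A: "comm_group A"
  shows "quadratic G A (\<lambda>x. q x \<otimes>\<^bsub>A\<^esub> d x)"
    and "\<And>x y. x \<in> carrier G \<Longrightarrow> y \<in> carrier G \<Longrightarrow>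
      cross_effect G A (\<lambda>x. q x \<otimes>\<^bsub>A\<^esub> d x) x y = cross_effect G A q x y"
proof -
  interpret G: group G by fact
  interpret A: comm_group A by fact
  have cl: "q x \<in> carrier A" "d x \<in> carrier A" if "x \<in> carrier G" for x
    using q d that by (auto simp: quadratic_def hom_def)
  have c: "cross_effect G A q x y \<in> carrier A" if "x \<in> carrier G" "y \<in> carrier G" for x y
    using q that by (auto simp: quadratic_def hom_def)
  have 1: "q x \<otimes>\<^bsub>A\<^esub> d x \<in> carrier A" if "x \<in> carrier G" for x using that cl by simp
  have 2: "(\<lambda>x. cross_effect G A q x y) \<in> hom G A" if "y \<in> carrier G" for y
    using q that by (simp add: quadratic_def)
  have 3: "cross_effect G A q x \<in> hom G A" if "x \<in> carrier G" for x
    using q that by (simp add: quadratic_def)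
  have 4: "q (x \<otimes>\<^bsub>G\<^esub> y) \<otimes>\<^bsub>A\<^esub> d (x \<otimes>\<^bsub>G\<^esub> y) = q x \<otimes>\<^bsub>A\<^esub> d x \<otimes>\<^bsub>A\<^esub> (q y \<otimes>\<^bsub>A\<^esub> d y) \<otimes>\<^bsub>A\<^esub> cross_effect G A q x y"
    if "x \<in> carrier G" "y \<in> carrier G" for x y
    using that cl c quadratic_mult[OF q G A] hom_mult[OF d] by (simp add: A.m_ac)
  show "quadratic G A (\<lambda>x. q x \<otimes>\<^bsub>A\<^esub> d x)" by (rule quadraticI(1)[OF A 1 2 3 G 4])
  show "cross_effect G A (\<lambda>x. q x \<otimes>\<^bsub>A\<^esub> d x) x y = cross_effect G A q x y"
    if "x \<in> carrier G" "y \<in> carrier G" for x y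
    by (rule quadraticI(2)[OF A 1 2 3 G 4 that])
qed

text \<open>The sign in \<open>Tmap_pur\<close> cancels the sign in
  \<open>T (x|x) = - (x|x)\<close>.\<close>

lemma Tmap_pur_crossH:
  "square_group M \<Longrightarrow> square_group N \<Longrightarrow> x \<in> car_e M \<Longrightarrow> b \<in> car_ee N \<Longrightarrow>
    Tmap (SG_tensor M N) (pur M N (crossH M x x) b) = pur M N (crossH M x x) (Tmap N b)"
  by (simp add: Tmap_pur Tmap_crossH)

context
  fixes N K :: "'x sgU"
  assumes sq [simp]: "square_group N" "square_group K"
begin

lemma ten_gens_closed:
  "{ten N K y z |y z. y \<in> car_e N \<and> z \<in> car_e K} \<union> Pmap (SG_tensor N K) ` {pur N K b c |b c. b \<in> car_ee N \<and> c \<in> car_ee K} \<subseteq> car_e (SG_tensor N K)"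
  by auto

lemma ten_hom_eqI:
  assumes G: "group G" and h: "h \<in> hom (lvl_e (SG_tensor N K)) G" "h' \<in> hom (lvl_e (SG_tensor N K)) G"
    and "\<And>y z. y \<in> car_e N \<Longrightarrow> z \<in> car_e K \<Longrightarrow> h (ten N K y z) = h' (ten N K y z)"
    and "\<And>b c. b \<in> car_ee N \<Longrightarrow> c \<in> car_ee K \<Longrightarrow> h (Pmap (SG_tensor N K) (pur N K b c)) = h' (Pmap (SG_tensor N K) (pur N K b c))"
    and v: "v \<in> car_e (SG_tensor N K)"
  shows "h v = h' v"
proof (rule hom_eq_on_generate[OF square_group_e G h ten_gens_closed])
  show "v \<in> generate (lvl_e (SG_tensor N K)) ({ten N K y z |y z. y \<in> car_e N \<and> z \<in> car_e K} \<union>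
      Pmap (SG_tensor N K) ` {pur N K b c |b c. b \<in> car_ee N \<and> c \<in> car_ee K})"
    using v sg_generated_ten_full[OF sq] by (simp add: sg_generated_def)
qed (use assms in auto)

lemma pur_hom_eqI:
  assumes G: "group G" and h: "h \<in> hom (lvl_ee (SG_tensor N K)) G" "h' \<in> hom (lvl_ee (SG_tensor N K)) G"
    and "\<And>b c. b \<in> car_ee N \<Longrightarrow> c \<in> car_ee K \<Longrightarrow> h (pur N K b c) = h' (pur N K b c)"
    and v: "v \<in> car_ee (SG_tensor N K)"
  shows "h v = h' v"
proof (rule hom_eq_on_generate[OF square_group_ee' G h])
  show "v \<in> generate (lvl_ee (SG_tensor N K)) {pur N K b c |b c. b \<in> car_ee N \<and> c \<in> car_ee K}"
    using v sg_generated_ten_full[OF sq] by (simp add: sg_generated_def)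
qed (use assms in auto)

end

text \<open>As \<open>x \<circledcirc> v\<close> is additive in \<open>v\<close> but only quadratic in \<open>x\<close>, the inverse \<open>psi\<close> of the associativity
  constraint is the direction that can be defined on generators, as \<open>x \<circledcirc> v \<mapsto> psi_e x v\<close> with \<open>psi_e x\<close>
  a homomorphism; the constraint \<open>asc\<close> itself is then \<open>psi\<close> conjugated by symmetries.\<close>

definition psi_e :: "'x sgU \<Rightarrow> 'x sgU \<Rightarrow> 'x sgU \<Rightarrow> 'x elt \<Rightarrow> 'x elt \<Rightarrow> 'x elt" where
  "psi_e M N K x = (SOME h. h \<in> hom (lvl_e (SG_tensor N K)) (lvl_e (SG_tensor (SG_tensor M N) K)) \<and>
     (\<forall>y \<in> car_e N. \<forall>z \<in> car_e K. h (ten N K y z) = ten (SG_tensor M N) K (ten M N x y) z) \<and>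
     (\<forall>b \<in> car_ee N. \<forall>c \<in> car_ee K. h (Pmap (SG_tensor N K) (pur N K b c)) =
        Pmap (SG_tensor (SG_tensor M N) K) (pur (SG_tensor M N) K (pur M N (crossH M x x) b) c)))"

definition psi_ee :: "'x sgU \<Rightarrow> 'x sgU \<Rightarrow> 'x sgU \<Rightarrow> 'x elt \<Rightarrow> 'x elt \<Rightarrow> 'x elt" where
  "psi_ee M N K a = (SOME h. h \<in> hom (lvl_ee (SG_tensor N K)) (lvl_ee (SG_tensor (SG_tensor M N) K)) \<and>
     (\<forall>b \<in> car_ee N. \<forall>c \<in> car_ee K. h (pur N K b c) = pur (SG_tensor M N) K (pur M N a b) c))"

locale sg_triple =
  fixes M N K :: "'x sgU"
  assumes sq [simp]: "square_group M" "square_group N" "square_group K"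
begin

abbreviation (input) NK' where "NK' \<equiv> SG_tensor N K"
abbreviation (input) MN where "MN \<equiv> SG_tensor M N"
abbreviation (input) L where "L \<equiv> SG_tensor (SG_tensor M N) K"
abbreviation (input) PL where "PL \<equiv> Pmap (SG_tensor (SG_tensor M N) K)"
abbreviation (input) p3 where "p3 a b c \<equiv> pur (SG_tensor M N) K (pur M N a b) c"

text \<open>The value on \<open>P (b \<otimes> c)\<close> is forced by \<open>circ_P\<close>. It is
  consistent because the cross-effect of \<open>x \<circledcirc> y'\<close> and
  \<open>x \<circledcirc> y\<close> is \<open>(x|x) \<otimes> (y'|y)\<close>: in every relation the
  factor from \<open>M\<close> is \<open>(x|x)\<close>.\<close>

lemma psi_e_ex:
  assumes [simp]: "x \<in> car_e M"
  shows "\<exists>h \<in> hom (lvl_e NK') (lvl_e L).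
     (\<forall>y \<in> car_e N. \<forall>z \<in> car_e K. h (ten N K y z) = ten MN K (ten M N x y) z) \<and>
     (\<forall>b \<in> car_ee N. \<forall>c \<in> car_ee K. h (Pmap NK' (pur N K b c)) = PL (p3 (crossH M x x) b c))"
proof (rule SG_tensor_hom_e)
  show "PL (p3 (crossH M x x) (Tmap N b) (Tmap K c)) = \<boxminus>\<^bsub>L\<^esub> PL (p3 (crossH M x x) b c)"
    if "b \<in> car_ee N" "c \<in> car_ee K" for b c
    using that by (simp flip: Tmap_pur_crossH add: P_pur_T)
qed (simp_all add: pur_add ten_add_right ten_add_left ten_P_right ten_P_left crossH_ten)

lemma psi_ee_ex:
  assumes [simp]: "a \<in> car_ee M"
  shows "\<exists>h \<in> hom (lvl_ee NK') (lvl_ee L). \<forall>b \<in> car_ee N. \<forall>c \<in> car_ee K. h (pur N K b c) = p3 a b c"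
  by (rule SG_tensor_hom_ee) (simp_all add: pur_add)

lemma psi_e_props:
  assumes "x \<in> car_e M"
  shows psi_e_hom: "psi_e M N K x \<in> hom (lvl_e NK') (lvl_e L)"
    and psi_e_ten: "y \<in> car_e N \<Longrightarrow> z \<in> car_e K \<Longrightarrow> psi_e M N K x (ten N K y z) = ten MN K (ten M N x y) z"
    and psi_e_P_pur: "b \<in> car_ee N \<Longrightarrow> c \<in> car_ee K \<Longrightarrow>
      psi_e M N K x (Pmap NK' (pur N K b c)) = PL (p3 (crossH M x x) b c)"
  using someI_ex[OF psi_e_ex[OF assms, unfolded Bex_def], folded psi_e_def] by blast+

lemma psi_ee_props:
  assumes "a \<in> car_ee M"
  shows psi_ee_hom: "psi_ee M N K a \<in> hom (lvl_ee NK') (lvl_ee L)"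
    and psi_ee_pur: "b \<in> car_ee N \<Longrightarrow> c \<in> car_ee K \<Longrightarrow> psi_ee M N K a (pur N K b c) = p3 a b c"
  using someI_ex[OF psi_ee_ex[OF assms, unfolded Bex_def], folded psi_ee_def] by blast+

lemma psi_closed [simp]:
  "x \<in> car_e M \<Longrightarrow> v \<in> car_e NK' \<Longrightarrow> psi_e M N K x v \<in> car_e L"
  "a \<in> car_ee M \<Longrightarrow> q \<in> car_ee NK' \<Longrightarrow> psi_ee M N K a q \<in> car_ee L"
  using psi_e_hom[of x] psi_ee_hom[of a] by (auto simp: hom_def)

lemma psi_add:
  "x \<in> car_e M \<Longrightarrow> v \<in> car_e NK' \<Longrightarrow> v' \<in> car_e NK' \<Longrightarrow>
     psi_e M N K x (v \<boxplus>\<^bsub>NK'\<^esub> v') = psi_e M N K x v \<boxplus>\<^bsub>L\<^esub> psi_e M N K x v'"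
  "a \<in> car_ee M \<Longrightarrow> q \<in> car_ee NK' \<Longrightarrow> q' \<in> car_ee NK' \<Longrightarrow>
     psi_ee M N K a (q \<oplus>\<^bsub>NK'\<^esub> q') = psi_ee M N K a q \<oplus>\<^bsub>L\<^esub> psi_ee M N K a q'"
  using psi_e_hom[of x] psi_ee_hom[of a] by (auto simp: hom_def)

lemma psi_ee_simps [simp]:
  "a \<in> car_ee M \<Longrightarrow> psi_ee M N K a \<zero>\<^bsub>NK'\<^esub> = \<zero>\<^bsub>L\<^esub>"
  "a \<in> car_ee M \<Longrightarrow> q \<in> car_ee NK' \<Longrightarrow> psi_ee M N K a (\<ominus>\<^bsub>NK'\<^esub> q) = \<ominus>\<^bsub>L\<^esub> psi_ee M N K a q"
  using hom_one[OF psi_ee_hom] hom_inv[OF psi_ee_hom] by (simp_all add: square_group_ee')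

lemma psi_ee_add_left:
  assumes [simp]: "a \<in> car_ee M" "a' \<in> car_ee M" and q: "q \<in> car_ee NK'"
  shows "psi_ee M N K (a \<oplus>\<^bsub>M\<^esub> a') q = psi_ee M N K a q \<oplus>\<^bsub>L\<^esub> psi_ee M N K a' q"
proof (rule pur_hom_eqI[OF sq(2,3) square_group_ee'[of L] _ _ _ q])
  show "psi_ee M N K (a \<oplus>\<^bsub>M\<^esub> a') \<in> hom (lvl_ee NK') (lvl_ee L)" by (rule psi_ee_hom) simp
  show "(\<lambda>q. psi_ee M N K a q \<oplus>\<^bsub>L\<^esub> psi_ee M N K a' q) \<in> hom (lvl_ee NK') (lvl_ee L)"
    by (rule homI) (simp_all add: psi_add ee_ac)
qed (simp_all add: psi_ee_pur pur_add)

lemma psi_e_P: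
  assumes [simp]: "x \<in> car_e M" and q: "q \<in> car_ee NK'"
  shows "psi_e M N K x (Pmap NK' q) = PL (psi_ee M N K (crossH M x x) q)"
proof (rule pur_hom_eqI[OF sq(2,3) square_group_e[of L] _ _ _ q])
  show "(\<lambda>q. psi_e M N K x (Pmap NK' q)) \<in> hom (lvl_ee NK') (lvl_e L)"
    by (rule homI) (simp_all add: psi_add Pmap_add)
  show "(\<lambda>q. PL (psi_ee M N K (crossH M x x) q)) \<in> hom (lvl_ee NK') (lvl_e L)"
    by (rule homI) (simp_all add: psi_add Pmap_add)
qed (simp_all add: psi_ee_pur psi_e_P_pur)

text \<open>Both sides are biadditive in \<open>v\<close> and \<open>v'\<close>, so they are
  compared on generators, one variable at a time; on the image of \<open>P\<close> both
  vanish.\<close>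

lemma crossH_psi:
  assumes [simp]: "x \<in> car_e M" "x' \<in> car_e M" "v \<in> car_e NK'" "v' \<in> car_e NK'"
  shows "crossH L (psi_e M N K x v) (psi_e M N K x' v') = psi_ee M N K (crossH M x x') (crossH NK' v v')"
proof -
  have l: "(\<lambda>v. crossH L (psi_e M N K x v) w) \<in> hom (lvl_e NK') (lvl_ee L)" if "w \<in> car_e L" for w
    using hom_compose[OF psi_e_hom[of x] crossH_hom_left[of L w]] that by (simp add: comp_def)
  have l': "(\<lambda>v. psi_ee M N K (crossH M x x') (crossH NK' v w)) \<in> hom (lvl_e NK') (lvl_ee L)" if "w \<in> car_e NK'" for w
    using hom_compose[OF crossH_hom_left psi_ee_hom] that by (simp add: comp_def)
  have r: "(\<lambda>v'. crossH L (psi_e M N K x v) (psi_e M N K x' v')) \<in> hom (lvl_e NK') (lvl_ee L)"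
    using hom_compose[OF psi_e_hom crossH_hom_right] by (simp add: comp_def)
  have r': "(\<lambda>v'. psi_ee M N K (crossH M x x') (crossH NK' v v')) \<in> hom (lvl_e NK') (lvl_ee L)"
    using hom_compose[OF crossH_hom_right psi_ee_hom] by (simp add: comp_def)
  have 1: "crossH L (psi_e M N K x v) (psi_e M N K x' (ten N K y z)) = psi_ee M N K (crossH M x x') (crossH NK' v (ten N K y z))"
    if [simp]: "y \<in> car_e N" "z \<in> car_e K" for y z
    by (rule ten_hom_eqI[OF sq(2,3) square_group_ee'[of L] l l' _ _ \<open>v \<in> car_e NK'\<close>])
      (simp_all add: psi_e_ten psi_e_P_pur crossH_ten psi_ee_pur)
  show ?thesis
    by (rule ten_hom_eqI[OF sq(2,3) square_group_ee'[of L] r r' _ _ \<open>v' \<in> car_e NK'\<close>])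
      (simp_all add: 1 psi_e_P_pur)
qed

lemma psi_e_add_left:
  assumes [simp]: "x \<in> car_e M" "x' \<in> car_e M" and v: "v \<in> car_e NK'"
  shows "psi_e M N K (x \<boxplus>\<^bsub>M\<^esub> x') v = psi_e M N K x v \<boxplus>\<^bsub>L\<^esub> psi_e M N K x' v \<boxplus>\<^bsub>L\<^esub>
    PL (psi_ee M N K (crossH M x' x) (Hmap NK' v))"
proof (rule ten_hom_eqI[OF sq(2,3) square_group_e[of L] _ _ _ _ v])
  show "psi_e M N K (x \<boxplus>\<^bsub>M\<^esub> x') \<in> hom (lvl_e NK') (lvl_e L)" by (rule psi_e_hom) simp
  \<comment> \<open>The exchange of the middle summands costs \<open>P\<close> of the cross-effect
    of \<open>psi_e M N K x' v\<close> and \<open>psi_e M N K x v'\<close>. By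
    \<open>crossH_psi\<close> this is what the cross-effect in \<open>H (v + v')\<close>
    contributes.\<close>
  show "(\<lambda>v. psi_e M N K x v \<boxplus>\<^bsub>L\<^esub> psi_e M N K x' v \<boxplus>\<^bsub>L\<^esub> PL (psi_ee M N K (crossH M x' x) (Hmap NK' v)))
      \<in> hom (lvl_e NK') (lvl_e L)"
    by (rule homI) (simp_all add: P_collect add_interchange crossH_psi psi_add Hmap_add)
next
  fix y z assume [simp]: "y \<in> car_e N" "z \<in> car_e K"
  show "psi_e M N K (x \<boxplus>\<^bsub>M\<^esub> x') (ten N K y z) = psi_e M N K x (ten N K y z) \<boxplus>\<^bsub>L\<^esub> psi_e M N K x' (ten N K y z) \<boxplus>\<^bsub>L\<^esub>
      PL (psi_ee M N K (crossH M x' x) (Hmap NK' (ten N K y z)))"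
    by (simp add: psi_e_ten ten_add_left ten_P_left Hmap_ten crossH_ten psi_add psi_ee_pur P_collect)
next
  fix b c assume [simp]: "b \<in> car_ee N" "c \<in> car_ee K"
  \<comment> \<open>\<open>H P\<close> turns \<open>b \<otimes> c\<close> into
    \<open>b \<otimes> c - T b \<otimes> T c\<close>. The first part gives the summand
    \<open>(x'|x)\<close> in the expansion of \<open>(x + x'|x + x')\<close>, the second part gives
    the summand \<open>(x|x')\<close>.\<close>
  have *: "PL (p3 (crossH M x' x) (Tmap N b) (Tmap K c)) = PL (\<ominus>\<^bsub>L\<^esub> p3 (crossH M x x') b c)"
    by (subst P_pur_swap) (simp_all add: Tmap_pur Tmap_crossH)
  show "psi_e M N K (x \<boxplus>\<^bsub>M\<^esub> x') (Pmap NK' (pur N K b c)) =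
      psi_e M N K x (Pmap NK' (pur N K b c)) \<boxplus>\<^bsub>L\<^esub> psi_e M N K x' (Pmap NK' (pur N K b c)) \<boxplus>\<^bsub>L\<^esub>
      PL (psi_ee M N K (crossH M x' x) (Hmap NK' (Pmap NK' (pur N K b c))))"
    by (simp add: psi_e_P_pur HP_eq Tmap_pur psi_add psi_ee_pur Pmap_add[of L] Pmap_neg[of L] *)
      (simp add: crossH_add pur_add ee_ac flip: Pmap_add)
qed simp_all

lemma sg_bimor_psi: "sg_bimor M NK' L (psi_e M N K) (psi_ee M N K)"
proof
  fix a v assume [simp]: "a \<in> car_ee M" and v [simp]: "v \<in> car_e NK'"
  show "psi_e M N K (Pmap M a) v = PL (psi_ee M N K a (Delta NK' v))"
  proof (rule ten_hom_eqI[OF sq(2,3) square_group_e[of L] _ _ _ _ v])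
    show "psi_e M N K (Pmap M a) \<in> hom (lvl_e NK') (lvl_e L)" by (rule psi_e_hom) simp
    show "(\<lambda>v. PL (psi_ee M N K a (Delta NK' v))) \<in> hom (lvl_e NK') (lvl_e L)"
      by (rule homI) (simp_all add: psi_add Pmap_add Delta_add)
  qed (simp_all add: psi_e_ten psi_e_P_pur ten_P_left Delta_ten psi_ee_pur)
next
  fix a q assume [simp]: "a \<in> car_ee M" and q [simp]: "q \<in> car_ee NK'"
  show "Tmap L (psi_ee M N K a q) = \<ominus>\<^bsub>L\<^esub> psi_ee M N K (Tmap M a) (Tmap NK' q)"
  proof (rule pur_hom_eqI[OF sq(2,3) square_group_ee'[of L] _ _ _ q])
    show "(\<lambda>q. Tmap L (psi_ee M N K a q)) \<in> hom (lvl_ee NK') (lvl_ee L)"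
      by (rule homI) (simp_all add: psi_add Tmap_add)
    show "(\<lambda>q. \<ominus>\<^bsub>L\<^esub> psi_ee M N K (Tmap M a) (Tmap NK' q)) \<in> hom (lvl_ee NK') (lvl_ee L)"
      by (rule homI) (simp_all add: psi_add Tmap_add ee_neg_add)
  qed (simp_all add: psi_ee_pur Tmap_pur)
next
  fix x v assume [simp]: "x \<in> car_e M" and v [simp]: "v \<in> car_e NK'"
  note ax = square_group_e[of NK'] square_group_ee[of NK'] square_group_ee[of L] square_group_e[of L]
  have q1: "quadratic (lvl_e NK') (lvl_ee L) (\<lambda>v. Hmap L (psi_e M N K x v))"
    and c1: "\<And>v w. v \<in> car_e NK' \<Longrightarrow> w \<in> car_e NK' \<Longrightarrow>
      cross_effect (lvl_e NK') (lvl_ee L) (\<lambda>v. Hmap L (psi_e M N K x v)) v w = crossH L (psi_e M N K x v) (psi_e M N K x w)"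
    using hom_quadratic_comp[OF quadratic_Hmap psi_e_hom[of x] ax(3,4,1)] by simp_all
  have d: "(\<lambda>v. psi_ee M N K (Hmap M x) (Delta NK' v)) \<in> hom (lvl_e NK') (lvl_ee L)"
    by (rule homI) (simp_all add: psi_add Delta_add)
  have q: "quadratic (lvl_e NK') (lvl_ee L) (\<lambda>v. psi_ee M N K (crossH M x x) (Hmap NK' v))"
    and c: "\<And>v w. v \<in> car_e NK' \<Longrightarrow> w \<in> car_e NK' \<Longrightarrow>
      cross_effect (lvl_e NK') (lvl_ee L) (\<lambda>v. psi_ee M N K (crossH M x x) (Hmap NK' v)) v w =
        psi_ee M N K (crossH M x x) (crossH NK' v w)"
    using quadratic_hom_comp[OF quadratic_Hmap psi_ee_hom[of "crossH M x x"] ax(2,3,1)] by simp_all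
  note q2 = quadratic_mult_hom[OF q d ax(1,3)]
  let ?S = "{ten N K y z |y z. y \<in> car_e N \<and> z \<in> car_e K} \<union> Pmap NK' ` {pur N K b c |b c. b \<in> car_ee N \<and> c \<in> car_ee K}"
  \<comment> \<open>Both sides are quadratic in \<open>v\<close> with equal cross-effects by
    \<open>crossH_psi\<close>, so generators suffice.\<close>
  show "Hmap L (psi_e M N K x v) = psi_ee M N K (crossH M x x) (Hmap NK' v) \<oplus>\<^bsub>L\<^esub> psi_ee M N K (Hmap M x) (Delta NK' v)"
  proof (rule quadratic_eqI[OF q1 q2(1) ax(1) ax(3) ten_gens_closed[OF sq(2,3)] _ _ _ v])
    show "generate (lvl_e NK') ?S = car_e NK'"
      using sg_generated_ten_full[OF sq(2,3)] by (simp add: sg_generated_def)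
    show "Hmap L (psi_e M N K x s) = psi_ee M N K (crossH M x x) (Hmap NK' s) \<oplus>\<^bsub>L\<^esub> psi_ee M N K (Hmap M x) (Delta NK' s)"
      if "s \<in> ?S" for s
      using that
    proof (elim UnE imageE CollectE exE conjE; hypsubst)
      fix y z assume [simp]: "y \<in> car_e N" "z \<in> car_e K"
      show "Hmap L (psi_e M N K x (ten N K y z)) = psi_ee M N K (crossH M x x) (Hmap NK' (ten N K y z)) \<oplus>\<^bsub>L\<^esub>
          psi_ee M N K (Hmap M x) (Delta NK' (ten N K y z))"
        by (simp add: psi_e_ten Hmap_ten crossH_ten Delta_ten psi_add psi_ee_pur pur_add ee_ac)
    next
      fix b c assume [simp]: "b \<in> car_ee N" "c \<in> car_ee K"
      show "Hmap L (psi_e M N K x (Pmap NK' (pur N K b c))) =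
          psi_ee M N K (crossH M x x) (Hmap NK' (Pmap NK' (pur N K b c))) \<oplus>\<^bsub>L\<^esub>
          psi_ee M N K (Hmap M x) (Delta NK' (Pmap NK' (pur N K b c)))"
        by (simp add: psi_e_P_pur HP_eq Tmap_pur[of MN K] Tmap_pur_crossH Tmap_pur[of N K] psi_add psi_ee_pur)
    qed
    show "cross_effect (lvl_e NK') (lvl_ee L) (\<lambda>v. Hmap L (psi_e M N K x v)) s t =
        cross_effect (lvl_e NK') (lvl_ee L)
          (\<lambda>v. psi_ee M N K (crossH M x x) (Hmap NK' v) \<oplus>\<^bsub>L\<^esub> psi_ee M N K (Hmap M x) (Delta NK' v)) s t"
      if "s \<in> ?S" "t \<in> ?S" for s t
    proof -
      have "s \<in> car_e NK'" "t \<in> car_e NK'" using that ten_gens_closed[OF sq(2,3)] by blast+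
      then show ?thesis by (simp add: c1 q2(2) c crossH_psi)
    qed
  qed simp_all
qed (simp_all add: psi_add psi_ee_add_left psi_e_add_left psi_e_P crossH_psi)

end

definition psi :: "'x sgU \<Rightarrow> 'x sgU \<Rightarrow> 'x sgU \<Rightarrow> 'x morU" where
  "psi M N K = lift M (SG_tensor N K) (SG_tensor (SG_tensor M N) K) (psi_e M N K) (psi_ee M N K)"

context sg_triple
begin

lemma psi_hom: "psi M N K \<in> sg_hom (SG_tensor M (SG_tensor N K)) (SG_tensor (SG_tensor M N) K)"
  unfolding psi_def by (rule lift_hom[OF sg_bimor_psi])

lemma psi_ten: "\<lbrakk>x \<in> car_e M; y \<in> car_e N; z \<in> car_e K\<rbrakk> \<Longrightarrow>
    map_e (psi M N K) (ten M (SG_tensor N K) x (ten N K y z)) = ten (SG_tensor M N) K (ten M N x y) z"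
  unfolding psi_def by (subst lift_ten[OF sg_bimor_psi]) (simp_all add: psi_e_ten)

lemma psi_pur: "\<lbrakk>a \<in> car_ee M; b \<in> car_ee N; c \<in> car_ee K\<rbrakk> \<Longrightarrow>
    map_ee (psi M N K) (pur M (SG_tensor N K) a (pur N K b c)) = pur (SG_tensor M N) K (pur M N a b) c"
  unfolding psi_def by (subst lift_pur[OF sg_bimor_psi]) (simp_all add: psi_ee_pur)

end

lemmas psi_hom = sg_triple.psi_hom[OF sg_triple.intro]
lemmas psi_ten = sg_triple.psi_ten[OF sg_triple.intro]
lemmas psi_pur = sg_triple.psi_pur[OF sg_triple.intro]

text \<open>Rules that evaluate composites of morphisms on generators: the source and target of a
  morphism are read off the morphism, so that the simplifier can discharge the side conditions.\<close>

lemma src_tgt_sg_comp: "src (sg_comp \<psi> \<phi>) = src \<phi>" "tgt (sg_comp \<psi> \<phi>) = tgt \<psi>"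
  by (simp_all add: sg_comp_def)

lemma src_tgt_sg_id: "src (sg_id M) = M" "tgt (sg_id M) = M"
  by (simp_all add: sg_id_def)

lemma sg_comp_hom': "\<phi> \<in> sg_hom L (tgt \<phi>) \<Longrightarrow> \<psi> \<in> sg_hom (tgt \<phi>) N \<Longrightarrow> square_group L \<Longrightarrow> sg_comp \<psi> \<phi> \<in> sg_hom L N"
  by (rule sg_comp_hom)

lemma map_tgt:
  assumes "\<phi> \<in> sg_hom S (tgt \<phi>)"
  shows "u \<in> car_e S \<Longrightarrow> v \<in> car_e S \<Longrightarrow> map_e \<phi> (u \<boxplus>\<^bsub>S\<^esub> v) = map_e \<phi> u \<boxplus>\<^bsub>tgt \<phi>\<^esub> map_e \<phi> v"
    and "w \<in> car_ee S \<Longrightarrow> map_e \<phi> (Pmap S w) = Pmap (tgt \<phi>) (map_ee \<phi> w)"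
    and "a \<in> car_ee S \<Longrightarrow> b \<in> car_ee S \<Longrightarrow> map_ee \<phi> (a \<oplus>\<^bsub>S\<^esub> b) = map_ee \<phi> a \<oplus>\<^bsub>tgt \<phi>\<^esub> map_ee \<phi> b"
  using sg_homD(8,11,12)[OF assms] by auto

lemma map_closed:
  "\<phi> \<in> sg_hom (src \<phi>) T \<Longrightarrow> x \<in> car_e (src \<phi>) \<Longrightarrow> map_e \<phi> x \<in> car_e T"
  "\<phi> \<in> sg_hom (src \<phi>) T \<Longrightarrow> a \<in> car_ee (src \<phi>) \<Longrightarrow> map_ee \<phi> a \<in> car_ee T"
  by (auto dest: sg_homD(9,10))

lemma SG_tensor_map_tgt:
  assumes "square_group M" "square_group (tgt f)" "square_group N" "square_group (tgt g)"
    and "f \<in> sg_hom M (tgt f)" "g \<in> sg_hom N (tgt g)"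
  shows "\<lbrakk>x \<in> car_e M; y \<in> car_e N\<rbrakk> \<Longrightarrow>
      map_e (SG_tensor_map f g) (ten M N x y) = ten (tgt f) (tgt g) (map_e f x) (map_e g y)"
    and "\<lbrakk>a \<in> car_ee M; b \<in> car_ee N\<rbrakk> \<Longrightarrow>
      map_ee (SG_tensor_map f g) (pur M N a b) = pur (tgt f) (tgt g) (map_ee f a) (map_ee g b)"
  using SG_tensor_map[OF assms] by auto

lemma src_tgt_SG_tensor_map:
  assumes "square_group (src f)" "square_group (tgt f)" "square_group (src g)" "square_group (tgt g)"
    and "f \<in> sg_hom (src f) (tgt f)" "g \<in> sg_hom (src g) (tgt g)"
  shows "src (SG_tensor_map f g) = SG_tensor (src f) (src g)" "tgt (SG_tensor_map f g) = SG_tensor (tgt f) (tgt g)"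
  using sg_homD(1,2)[OF SG_tensor_map(1)[OF assms]] by auto

lemma src_tgt_brd:
  assumes "square_group M" "square_group N"
  shows "src (brd M N) = SG_tensor M N" "tgt (brd M N) = SG_tensor N M"
  using sg_homD(1,2)[OF brd_hom[OF assms]] by auto

lemma src_tgt_psi:
  assumes "square_group M" "square_group N" "square_group K"
  shows "src (psi M N K) = SG_tensor M (SG_tensor N K)" "tgt (psi M N K) = SG_tensor (SG_tensor M N) K"
  using sg_homD(1,2)[OF psi_hom[OF assms]] by auto

lemma src_tgt_lun:
  assumes "square_group N"
  shows "src (lun N) = SG_tensor SG_unit N" "tgt (lun N) = N"
  using sg_homD(1,2)[OF lun_hom[OF assms]] by auto

lemmas mor_simps = src_tgt_sg_comp src_tgt_sg_id sg_comp_hom' map_tgt map_closed map_sg_comp sg_id_hom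
  SG_tensor_map(1) SG_tensor_map_tgt src_tgt_SG_tensor_map
  src_tgt_brd brd_hom brd_ten brd_pur src_tgt_lun lun_hom lun_ten lun_pur

text \<open>Reversing the three factors on both sides turns \<open>psi K N M\<close>, which goes
  from \<open>K \<circledcirc> (N \<circledcirc> M)\<close> to
  \<open>(K \<circledcirc> N) \<circledcirc> M\<close>, into a map in the opposite direction for
  \<open>M\<close>, \<open>N\<close>, \<open>K\<close>.\<close>

definition asc :: "'x sgU \<Rightarrow> 'x sgU \<Rightarrow> 'x sgU \<Rightarrow> 'x morU" where
  "asc M N K = sg_comp (SG_tensor_map (sg_id M) (brd K N)) (sg_comp (brd (SG_tensor K N) M)
     (sg_comp (psi K N M) (sg_comp (SG_tensor_map (sg_id K) (brd M N)) (brd (SG_tensor M N) K))))"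

context
  fixes M N K :: "'x sgU"
  assumes sq [simp]: "square_group M" "square_group N" "square_group K"
begin

lemma asc_hom: "asc M N K \<in> sg_hom (SG_tensor (SG_tensor M N) K) (SG_tensor M (SG_tensor N K))"
  by (simp add: asc_def mor_simps src_tgt_psi psi_hom)

lemma asc_pur:
  "\<lbrakk>a \<in> car_ee M; b \<in> car_ee N; c \<in> car_ee K\<rbrakk> \<Longrightarrow>
    map_ee (asc M N K) (pur (SG_tensor M N) K (pur M N a b) c) = pur M (SG_tensor N K) a (pur N K b c)"
  by (simp add: asc_def mor_simps src_tgt_psi psi_hom psi_pur)

text \<open>The correction terms of the four symmetries cancel in pairs modulo the relation
  \<open>P (a \<otimes> b) = - P (T a \<otimes> T b)\<close>.\<close>

lemma asc_ten:
  assumes [simp]: "x \<in> car_e M" "y \<in> car_e N" "z \<in> car_e K"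
  shows "map_e (asc M N K) (ten (SG_tensor M N) K (ten M N x y) z) = ten M (SG_tensor N K) x (ten N K y z)"
proof -
  let ?R = "SG_tensor M (SG_tensor N K)"
  let ?p = "\<lambda>a b c. pur M (SG_tensor N K) a (pur N K b c)"
  let ?hx = "Hmap M x" and ?hy = "Hmap N y" and ?hz = "Hmap K z"
  \<comment> \<open>The origin of the terms: \<open>?a\<close> comes from the symmetry of
    \<open>z \<circledcirc> y\<close> with \<open>x\<close>, \<open>?d\<close> from that of
    \<open>z\<close> with \<open>y\<close>, \<open>?c\<close> and the second half of
    \<open>?b\<close> from that of \<open>x \<circledcirc> y\<close> with \<open>z\<close>, and the
    first half of \<open>?b\<close> from that of \<open>x\<close> with \<open>y\<close>.\<close>
  let ?a = "?p (Tmap M ?hx) ?hy (crossH K z z) \<oplus>\<^bsub>?R\<^esub> ?p (Tmap M ?hx) (Delta N y) ?hz"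
  let ?b = "?p ?hx (Tmap N ?hy) (crossH K z z) \<oplus>\<^bsub>?R\<^esub> ?p ?hx (Delta N y) (Tmap K ?hz)"
  let ?c = "?p (crossH M x x) ?hy (Tmap K ?hz)"
  let ?d = "?p (crossH M x x) (Tmap N ?hy) ?hz"
  have "Pmap ?R ?a = Pmap ?R (\<ominus>\<^bsub>?R\<^esub> ?b)"
    by (simp add: Pmap_add P_pur_swap[of M "SG_tensor N K" "Tmap M ?hx"] Tmap_pur Tmap_crossH Tmap_Delta Pmap_neg ee_neg_add)
  moreover have "Pmap ?R ?c = Pmap ?R (\<ominus>\<^bsub>?R\<^esub> ?d)"
    by (subst P_pur_swap) (simp_all add: Tmap_pur Tmap_crossH)
  ultimately have 0: "Pmap ?R (?a \<oplus>\<^bsub>?R\<^esub> ?b \<oplus>\<^bsub>?R\<^esub> (?c \<oplus>\<^bsub>?R\<^esub> ?d)) = \<zero>\<^sub>e\<^bsub>?R\<^esub>"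
    by (simp add: Pmap_add[of ?R ?a ?b] Pmap_add[of ?R ?c ?d] Pmap_add[of ?R "?a \<oplus>\<^bsub>?R\<^esub> ?b"] Pmap_neg)
  have "map_e (asc M N K) (ten (SG_tensor M N) K (ten M N x y) z) =
      ten M (SG_tensor N K) x (ten N K y z) \<boxplus>\<^bsub>?R\<^esub> Pmap ?R (?a \<oplus>\<^bsub>?R\<^esub> ?b \<oplus>\<^bsub>?R\<^esub> (?c \<oplus>\<^bsub>?R\<^esub> ?d))"
    by (simp add: asc_def mor_simps src_tgt_psi psi_hom psi_ten psi_pur Hmap_ten ten_add_right ten_P_right pur_add P_collect)
      (simp add: ee_ac)
  then show ?thesis by (simp add: 0)
qed

text \<open>On generators \<open>asc M N K\<close> and \<open>psi M N K\<close> move the brackets in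
  opposite directions, so \<open>psi M N K\<close> itself is the inverse; the copy of
  \<open>psi\<close> inside \<open>asc\<close> has the factors reversed.\<close>

lemma asc_iso: "asc M N K \<in> sg_iso (SG_tensor (SG_tensor M N) K) (SG_tensor M (SG_tensor N K))"
proof (rule sg_isoI[OF asc_hom psi_hom])
  note full = sg_generated_carrier[OF sq(1)] sg_generated_carrier[OF sq(3)]
    sg_generated_ten_full[OF sq(1,2)] sg_generated_ten_full[OF sq(2,3)]
  show "sg_comp (psi M N K) (asc M N K) = sg_id (SG_tensor (SG_tensor M N) K)"
    by (rule SG_tensor_eqI[OF _ _ _ sg_comp_hom[OF asc_hom psi_hom] sg_id_hom full(3,2)])
      (auto simp: map_sg_comp_hom[OF asc_hom] asc_ten asc_pur psi_ten psi_pur)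
  show "sg_comp (asc M N K) (psi M N K) = sg_id (SG_tensor M (SG_tensor N K))"
    by (rule SG_tensor_eqI[OF _ _ _ sg_comp_hom[OF psi_hom asc_hom] sg_id_hom full(1,4)])
      (auto simp: map_sg_comp_hom[OF psi_hom] asc_ten asc_pur psi_ten psi_pur)
qed simp_all

end

section \<open>Coherence\<close>

lemma sg_iso_hom: "\<phi> \<in> sg_iso K L \<Longrightarrow> \<phi> \<in> sg_hom K L"
  by (simp add: sg_iso_def)

lemma sg_iso_comp:
  assumes \<phi>: "\<phi> \<in> sg_iso K L" and \<psi>: "\<psi> \<in> sg_iso L M"
    and sq: "square_group K" "square_group L" "square_group M"
  shows "sg_comp \<psi> \<phi> \<in> sg_iso K M"
proof -
  obtain \<phi>' where \<phi>': "\<phi>' \<in> sg_hom L K" "sg_comp \<phi>' \<phi> = sg_id K" "sg_comp \<phi> \<phi>' = sg_id L"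
    using \<phi> by (auto simp: sg_iso_def)
  obtain \<psi>' where \<psi>': "\<psi>' \<in> sg_hom M L" "sg_comp \<psi>' \<psi> = sg_id L" "sg_comp \<psi> \<psi>' = sg_id M"
    using \<psi> by (auto simp: sg_iso_def)
  note h = sg_iso_hom[OF \<phi>] sg_iso_hom[OF \<psi>] \<phi>'(1) \<psi>'(1)
  have "sg_comp (sg_comp \<phi>' \<psi>') (sg_comp \<psi> \<phi>) = sg_comp \<phi>' (sg_comp (sg_comp \<psi>' \<psi>) \<phi>)"
    using h sq by (simp add: sg_comp_assoc[of _ K M _ L _ K] sg_comp_assoc[of _ K L _ M _ L] sg_comp_hom)
  then have 1: "sg_comp (sg_comp \<phi>' \<psi>') (sg_comp \<psi> \<phi>) = sg_id K"
    using h sq by (simp add: \<phi>' \<psi>' sg_comp_id)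
  have "sg_comp (sg_comp \<psi> \<phi>) (sg_comp \<phi>' \<psi>') = sg_comp \<psi> (sg_comp (sg_comp \<phi> \<phi>') \<psi>')"
    using h sq by (simp add: sg_comp_assoc[of _ M K _ L _ M] sg_comp_assoc[of _ M L _ K _ L] sg_comp_hom)
  then have 2: "sg_comp (sg_comp \<psi> \<phi>) (sg_comp \<phi>' \<psi>') = sg_id M"
    using h sq by (simp add: \<phi>' \<psi>' sg_comp_id)
  show ?thesis
    using h sq 1 2 by (intro sg_isoI[where \<psi> = "sg_comp \<phi>' \<psi>'"]) (auto intro: sg_comp_hom)
qed

lemma brd_iso: "square_group M \<Longrightarrow> square_group N \<Longrightarrow> brd M N \<in> sg_iso (SG_tensor M N) (SG_tensor N M)"
  by (rule sg_isoI[OF brd_hom brd_hom brd_brd brd_brd])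

context
  fixes N :: "'x sgU"
  assumes sq [simp]: "square_group N"
begin

lemma run_iso: "run N \<in> sg_iso (SG_tensor N SG_unit) N"
  unfolding run_def by (rule sg_iso_comp[OF brd_iso lun_iso]) simp_all

lemma run_hom: "run N \<in> sg_hom (SG_tensor N SG_unit) N"
  by (rule sg_iso_hom[OF run_iso])

text \<open>\<open>H 1 = 0\<close> makes the correction term of the symmetry vanish.\<close>

lemma run_ten: "x \<in> car_e N \<Longrightarrow> map_e (run N) (ten N SG_unit x (Num 1)) = x"
  using pur_simps(1)[of SG_unit N] by (simp add: run_def mor_simps)

lemma run_pur: "a \<in> car_ee N \<Longrightarrow> map_ee (run N) (pur N SG_unit a (Num 1)) = a"
  by (simp add: run_def mor_simps)

lemma src_tgt_run: "src (run N) = SG_tensor N SG_unit" "tgt (run N) = N"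
  using sg_homD(1,2)[OF run_hom] by auto

end

lemma src_tgt_asc:
  assumes "square_group M" "square_group N" "square_group K"
  shows "src (asc M N K) = SG_tensor (SG_tensor M N) K" "tgt (asc M N K) = SG_tensor M (SG_tensor N K)"
  using sg_homD(1,2)[OF asc_hom[OF assms]] by auto

lemma map_tgt_pres:
  assumes "\<phi> \<in> sg_hom S (tgt \<phi>)" "square_group S" "square_group (tgt \<phi>)"
  shows "x \<in> car_e S \<Longrightarrow> map_ee \<phi> (Hmap S x) = Hmap (tgt \<phi>) (map_e \<phi> x)"
    and "a \<in> car_ee S \<Longrightarrow> map_ee \<phi> (Tmap S a) = Tmap (tgt \<phi>) (map_ee \<phi> a)"
  using sg_homD(7)[OF assms(1)] sg_hom_pres[OF assms] by auto

lemmas coh_simps = mor_simps src_tgt_asc asc_hom asc_ten asc_pur src_tgt_run run_hom run_ten run_pur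

lemma SG_tensor_map_id:
  assumes "square_group M" "square_group N"
  shows "SG_tensor_map (sg_id M) (sg_id N) = sg_id (SG_tensor M N)"
  by (rule SG_tensor_eqI[OF assms _ _ _ sg_generated_carrier[OF assms(1)] sg_generated_carrier[OF assms(2)],
        of "SG_tensor M N"])
    (use assms in \<open>simp_all add: coh_simps\<close>)

lemma SG_tensor_map_comp:
  assumes [simp]: "square_group X" "square_group X'" "square_group X''" "square_group Y" "square_group Y'" "square_group Y''"
    and f [simp]: "f \<in> sg_hom X X'" "f' \<in> sg_hom X' X''" "g \<in> sg_hom Y Y'" "g' \<in> sg_hom Y' Y''"
  shows "SG_tensor_map (sg_comp f' f) (sg_comp g' g) = sg_comp (SG_tensor_map f' g') (SG_tensor_map f g)"
proof -
  note [simp] = f[THEN sg_homD(1)] f[THEN sg_homD(2)]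
  show ?thesis
    by (rule SG_tensor_eqI[of X Y "SG_tensor X'' Y''" _ _ "car_e X" "car_ee X" "car_e Y" "car_ee Y"])
      (simp_all add: coh_simps sg_generated_carrier)
qed

lemma asc_natural:
  assumes [simp]: "square_group X" "square_group X'" "square_group Y" "square_group Y'" "square_group Z" "square_group Z'"
    and f [simp]: "f \<in> sg_hom X X'" "g \<in> sg_hom Y Y'" "h \<in> sg_hom Z Z'"
  shows "sg_comp (asc X' Y' Z') (SG_tensor_map (SG_tensor_map f g) h) =
    sg_comp (SG_tensor_map f (SG_tensor_map g h)) (asc X Y Z)"
proof -
  note [simp] = f[THEN sg_homD(1)] f[THEN sg_homD(2)]
  show ?thesis
    by (rule SG_tensor_eqI[OF _ _ _ _ _ sg_generated_ten_full[of X Y] sg_generated_carrier[of Z],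
          of "SG_tensor X' (SG_tensor Y' Z')"])
      (auto simp: coh_simps)
qed

lemma lun_natural:
  assumes [simp]: "square_group X" "square_group X'" and f [simp]: "f \<in> sg_hom X X'"
  shows "sg_comp (lun X') (SG_tensor_map (sg_id SG_unit) f) = sg_comp f (lun X)"
proof -
  note [simp] = sg_homD(1,2)[OF f]
  show ?thesis
    by (rule SG_tensor_eqI[OF _ _ _ _ _ sg_generated_SG_unit sg_generated_carrier[of X], of X'])
      (simp_all add: coh_simps)
qed

lemma run_natural:
  assumes [simp]: "square_group X" "square_group X'" and f [simp]: "f \<in> sg_hom X X'"
  shows "sg_comp (run X') (SG_tensor_map f (sg_id SG_unit)) = sg_comp f (run X)"
proof -
  note [simp] = sg_homD(1,2)[OF f]
  show ?thesis
    by (rule SG_tensor_eqI[OF _ _ _ _ _ sg_generated_carrier[of X] sg_generated_SG_unit, of X'])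
      (simp_all add: coh_simps)
qed

lemma brd_natural:
  assumes [simp]: "square_group X" "square_group X'" "square_group Y" "square_group Y'"
    and f [simp]: "f \<in> sg_hom X X'" "g \<in> sg_hom Y Y'"
  shows "sg_comp (brd X' Y') (SG_tensor_map f g) = sg_comp (SG_tensor_map g f) (brd X Y)"
proof -
  note [simp] = f[THEN sg_homD(1)] f[THEN sg_homD(2)]
  show ?thesis
    by (rule SG_tensor_eqI[OF _ _ _ _ _ sg_generated_carrier[of X] sg_generated_carrier[of Y], of "SG_tensor Y' X'"])
      (simp_all add: coh_simps map_tgt_pres)
qed

text \<open>On \<open>((w \<circledcirc> x) \<circledcirc> y) \<circledcirc> z\<close> every map
  only moves brackets, by \<open>asc_ten\<close>, so the two paths agree without terms in the image
  of \<open>P\<close>.\<close>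

lemma pentagon:
  assumes [simp]: "square_group W" "square_group X" "square_group Y" "square_group Z"
  shows "sg_comp (SG_tensor_map (sg_id W) (asc X Y Z))
      (sg_comp (asc W (SG_tensor X Y) Z) (SG_tensor_map (asc W X Y) (sg_id Z))) =
    sg_comp (asc W X (SG_tensor Y Z)) (asc (SG_tensor W X) Y Z)"
  by (rule SG_tensor_eqI[OF _ _ _ _ _ sg_generated_ten[OF _ _ sg_generated_ten_full[of W X] sg_generated_carrier[of Y]]
        sg_generated_carrier[of Z], of "SG_tensor W (SG_tensor X (SG_tensor Y Z))"])
    (auto simp: coh_simps)

text \<open>With \<open>Num 1\<close> as the middle factor, both unit constraints simply delete
  it.\<close>

lemma triangle:
  assumes [simp]: "square_group X" "square_group Y"
  shows "sg_comp (SG_tensor_map (sg_id X) (lun Y)) (asc X SG_unit Y) = SG_tensor_map (run X) (sg_id Y)"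
  by (rule SG_tensor_eqI[OF _ _ _ _ _ sg_generated_ten[OF _ _ sg_generated_carrier[of X] sg_generated_SG_unit]
        sg_generated_carrier[of Y], of "SG_tensor X Y"])
    (auto simp: coh_simps)

lemma hexagon:
  assumes [simp]: "square_group X" "square_group Y" "square_group Z"
  shows "sg_comp (asc Y Z X) (sg_comp (brd X (SG_tensor Y Z)) (asc X Y Z)) =
    sg_comp (SG_tensor_map (sg_id Y) (brd X Z)) (sg_comp (asc Y X Z) (SG_tensor_map (brd X Y) (sg_id Z)))"
proof (rule SG_tensor_eqI[OF _ _ _ _ _ sg_generated_ten_full[of X Y] sg_generated_carrier[of Z],
      of "SG_tensor Y (SG_tensor Z X)"])
  fix s z assume s: "s \<in> {ten X Y x y |x y. x \<in> car_e X \<and> y \<in> car_e Y}" and [simp]: "z \<in> car_e Z"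
  then obtain x y where [simp]: "x \<in> car_e X" "y \<in> car_e Y" "s = ten X Y x y" by blast
  show "map_e (sg_comp (asc Y Z X) (sg_comp (brd X (SG_tensor Y Z)) (asc X Y Z))) (ten (SG_tensor X Y) Z s z) =
    map_e (sg_comp (SG_tensor_map (sg_id Y) (brd X Z)) (sg_comp (asc Y X Z) (SG_tensor_map (brd X Y) (sg_id Z))))
      (ten (SG_tensor X Y) Z s z)"
    \<comment> \<open>Here corrections remain. The left path has \<open>P\<close> of
      \<open>T (H (y \<circledcirc> z)) \<otimes> H x\<close>, which expands to
      \<open>(y|y) \<otimes> T (H z) \<otimes> H x\<close> and
      \<open>T (H y) \<otimes> Delta z \<otimes> H x\<close>, as \<open>T\<close> changes the sign
      of \<open>(y|y)\<close> and of \<open>Delta z\<close>. The right path yields the first through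
      \<open>ten_P_right\<close> and the second through \<open>ten_P_left\<close>.\<close>
    by (simp add: coh_simps Hmap_ten Tmap_add Tmap_pur Tmap_crossH Tmap_Delta pur_add
        ten_add_left ten_add_right ten_P_left ten_P_right P_collect)
qed (auto simp: coh_simps)

lemma SG_simps:
  "Obj SG = {M. square_group M}" "Hom SG = sg_hom" "Id SG = sg_id" "Comp SG = sg_comp" "cat_iso SG = sg_iso"
  by (simp_all add: SG_def cat_iso_def sg_iso_def fun_eq_iff)

lemma symmetric_monoidal_category_SG:
  "symmetric_monoidal_category (SG :: ('x sgU, 'x morU) cat) SG_tensor SG_tensor_map SG_unit asc lun run brd"
proof (unfold_locales, unfold SG_simps mem_Collect_eq)
  fix X :: "'x sgU" assume [simp]: "square_group X"
  show "sg_id X \<in> sg_hom X X" by (simp add: sg_id_hom)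
  show "lun X \<in> sg_iso (SG_tensor SG_unit X) X" by (rule lun_iso) simp
  show "run X \<in> sg_iso (SG_tensor X SG_unit) X" by (rule run_iso) simp
  fix Y :: "'x sgU" assume [simp]: "square_group Y"
  show "sg_comp f (sg_id X) = f" "sg_comp (sg_id Y) f = f" if "f \<in> sg_hom X Y" for f
    using that by (simp_all add: sg_comp_id)
  show "square_group (SG_tensor X Y)" by simp
  show "SG_tensor_map (sg_id X) (sg_id Y) = sg_id (SG_tensor X Y)" by (simp add: SG_tensor_map_id)
  show "brd X Y \<in> sg_iso (SG_tensor X Y) (SG_tensor Y X)" by (simp add: brd_iso)
  show "sg_comp (SG_tensor_map (sg_id X) (lun Y)) (asc X SG_unit Y) = SG_tensor_map (run X) (sg_id Y)"
    by (simp add: triangle)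
  show "sg_comp (brd Y X) (brd X Y) = sg_id (SG_tensor X Y)" by (simp add: brd_brd)
  show "sg_comp (lun Y) (SG_tensor_map (sg_id SG_unit) f) = sg_comp f (lun X)"
    "sg_comp (run Y) (SG_tensor_map f (sg_id SG_unit)) = sg_comp f (run X)" if "f \<in> sg_hom X Y" for f
    using that by (simp_all add: lun_natural run_natural)
  fix Z :: "'x sgU" assume [simp]: "square_group Z"
  show "sg_comp g f \<in> sg_hom X Z" if "f \<in> sg_hom X Y" "g \<in> sg_hom Y Z" for f g
    using that by (rule sg_comp_hom) simp
  show "asc X Y Z \<in> sg_iso (SG_tensor (SG_tensor X Y) Z) (SG_tensor X (SG_tensor Y Z))" by (simp add: asc_iso)
  show "sg_comp (asc Y Z X) (sg_comp (brd X (SG_tensor Y Z)) (asc X Y Z)) =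
    sg_comp (SG_tensor_map (sg_id Y) (brd X Z)) (sg_comp (asc Y X Z) (SG_tensor_map (brd X Y) (sg_id Z)))"
    by (simp add: hexagon)
  fix W :: "'x sgU" assume [simp]: "square_group W"
  show "sg_comp (sg_comp h g) f = sg_comp h (sg_comp g f)"
    if "f \<in> sg_hom W X" "g \<in> sg_hom X Y" "h \<in> sg_hom Y Z" for f g h
    by (rule sg_comp_assoc[OF that]) simp_all
  show "SG_tensor_map f g \<in> sg_hom (SG_tensor W Y) (SG_tensor X Z)" if "f \<in> sg_hom W X" "g \<in> sg_hom Y Z" for f g
    using that by (intro SG_tensor_map(1)) simp_all
  show "sg_comp (brd X Z) (SG_tensor_map f g) = sg_comp (SG_tensor_map g f) (brd W Y)"
    if "f \<in> sg_hom W X" "g \<in> sg_hom Y Z" for f g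
    using that by (intro brd_natural) simp_all
  show "sg_comp (SG_tensor_map (sg_id W) (asc X Y Z)) (sg_comp (asc W (SG_tensor X Y) Z) (SG_tensor_map (asc W X Y) (sg_id Z))) =
    sg_comp (asc W X (SG_tensor Y Z)) (asc (SG_tensor W X) Y Z)"
    by (simp add: pentagon)
next
  fix X X' X'' Y Y' Y'' :: "'x sgU" and f f' g g'
  assume "square_group X" "square_group X'" "square_group X''" "square_group Y" "square_group Y'" "square_group Y''"
    "f \<in> sg_hom X X'" "f' \<in> sg_hom X' X''" "g \<in> sg_hom Y Y'" "g' \<in> sg_hom Y' Y''"
  then show "SG_tensor_map (sg_comp f' f) (sg_comp g' g) = sg_comp (SG_tensor_map f' g') (SG_tensor_map f g)"
    by (rule SG_tensor_map_comp)
next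
  fix X X' Y Y' Z Z' :: "'x sgU" and f g h
  assume "square_group X" "square_group X'" "square_group Y" "square_group Y'" "square_group Z" "square_group Z'"
    "f \<in> sg_hom X X'" "g \<in> sg_hom Y Y'" "h \<in> sg_hom Z Z'"
  then show "sg_comp (asc X' Y' Z') (SG_tensor_map (SG_tensor_map f g) h) =
      sg_comp (SG_tensor_map f (SG_tensor_map g h)) (asc X Y Z)"
    by (rule asc_natural)
qed simp

section \<open>Abelian groups\<close>

lemma sg_of_ab_simps:
  "lvl_e (sg_of_ab A) = A" "car_ee (sg_of_ab A) = UNIV" "Pmap (sg_of_ab A) a = \<one>\<^bsub>A\<^esub>"
  by (auto simp: sg_of_ab_def)

lemma square_group_sg_of_ab:
  assumes "comm_group A"
  shows "square_group (sg_of_ab A)"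
proof -
  interpret A: comm_group A by fact
  have ee: "comm_group (lvl_ee (sg_of_ab A))"
    by (rule comm_groupI) (auto simp: sg_of_ab_def)
  have "inv\<^bsub>A\<^esub> x \<otimes>\<^bsub>A\<^esub> inv\<^bsub>A\<^esub> y \<otimes>\<^bsub>A\<^esub> x \<otimes>\<^bsub>A\<^esub> y = \<one>\<^bsub>A\<^esub>" if "x \<in> carrier A" "y \<in> carrier A" for x y
    using that A.mult_inv_cancel(2)[of x y "\<one>\<^bsub>A\<^esub>"] by (simp add: A.m_ac)
  then show ?thesis
    using ee by (simp add: square_group_def sg_of_ab_simps quadratic_def hom_def A.group_axioms)
qed

lemma tensor_of_ab_iso:
  assumes A: "comm_group A" and B: "comm_group B"
  shows "\<exists>\<phi> \<in> sg_iso (sg_tensor (sg_of_ab A) (sg_of_ab B)) (sg_of_ab (ab_tensor A B)).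
    \<forall>x \<in> carrier A. \<forall>y \<in> carrier B. map_e \<phi> (circ (sg_of_ab A) (sg_of_ab B) x y) = ab_pure A B x y"
proof -
  let ?M = "sg_of_ab A" and ?N = "sg_of_ab B" and ?K = "sg_of_ab (ab_tensor A B)"
  interpret sg_pair ?M ?N using A B by (simp add: sg_pair_def square_group_sg_of_ab)
  interpret C: ab_groups A B using A B by (simp add: ab_groups_def)
  interpret AB: comm_group "ab_tensor A B" by (rule C.comm_group_ab_tensor)
  have K: "square_group ?K" by (rule square_group_sg_of_ab[OF AB.comm_group_axioms])
  have bimor: "sg_bimor ?M ?N ?K (ab_pure A B) (\<lambda>_ _. ())"
    by unfold_locales
      (simp_all add: K, simp_all add: sg_of_ab_simps C.ab_pure_add_left C.ab_pure_add_right)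
  then obtain \<phi> where \<phi>: "\<phi> \<in> sg_hom MN ?K" "\<And>x y. x \<in> carrier A \<Longrightarrow> y \<in> carrier B \<Longrightarrow> map_e \<phi> (cir x y) = ab_pure A B x y"
    using sg_tensor_univ[OF bimor] by (auto simp: sg_of_ab_simps)
  \<comment> \<open>The \<open>ee\<close>-level has type \<open>unit\<close>, so every
    \<open>a\<close> is its zero and \<open>pu_simps\<close> applies.\<close>
  have pu1: "pu a b = \<one>\<^bsub>TEE\<^esub>" for a b
    using pu_simps(1)[of b] by (simp add: sg_of_ab_simps)
  have br1: "br a b = \<one>\<^bsub>TE\<^esub>" for a b
    using hom_one[OF tens_P_props(1)] tens_P_props(2)[of a b]
    by (simp add: sg_of_ab_simps pu1 TE.group_axioms TEE.group_axioms)
  have TEE1: "w = \<one>\<^bsub>TEE\<^esub>" if "w \<in> carrier TEE" for w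
  proof -
    have "w \<in> generate TEE {pu a b |a b. a \<in> car_ee ?M \<and> b \<in> car_ee ?N}"
      using that by (simp only: tens_ee_generate)
    then show ?thesis by (induction rule: generate.induct) (auto simp: pu1)
  qed
  \<comment> \<open>Commutation of the generators is a relation of \<open>ab_tensor\<close>, whereas
    in \<open>tens_e\<close> it has to be derived: the commutator of two elements
    \<open>cir x y\<close> is an element \<open>br a b\<close>, and these vanish.\<close>
  have "\<exists>h \<in> hom (ab_tensor A B) TE. \<forall>x \<in> carrier A. \<forall>y \<in> carrier B. h (ab_pure A B x y) = cir x y"
  proof (rule C.ab_tensor_hom[OF TE.group_axioms])
    show "cir x y \<otimes>\<^bsub>TE\<^esub> cir x' y' = cir x' y' \<otimes>\<^bsub>TE\<^esub> cir x y"
      if "x \<in> carrier A" "x' \<in> carrier A" "y \<in> carrier B" "y' \<in> carrier B" for x x' y y'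
      using that cir_commutator[of x' x y y'] by (simp add: sg_of_ab_simps br1)
  qed (use cir_closed cir_add_left cir_add_right in \<open>auto simp: sg_of_ab_simps br1\<close>)
  then obtain h where h: "h \<in> hom (ab_tensor A B) TE"
    "\<And>x y. x \<in> carrier A \<Longrightarrow> y \<in> carrier B \<Longrightarrow> h (ab_pure A B x y) = cir x y" by blast
  define \<psi> where "\<psi> = \<lparr>src = ?K, tgt = MN, map_e = restrict h (carrier (ab_tensor A B)), map_ee = (\<lambda>_ :: unit. \<one>\<^bsub>TEE\<^esub>)\<rparr>"
  have \<psi>: "\<psi> \<in> sg_hom ?K MN"
  proof -
    have "tens_H M' N' u = \<one>\<^bsub>TEE\<^esub>" if "u \<in> carrier TE" "M' = ?M" "N' = ?N" for u M' N'
      using TEE1[of "tens_H ?M ?N u"] tens_H_props(1) that by (auto simp: quadratic_def)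
    moreover have "restrict h (carrier (ab_tensor A B)) \<in> hom (ab_tensor A B) TE"
      by (rule AB.hom_eq[OF h(1)]) simp
    moreover have "h u \<in> carrier TE" if "u \<in> carrier (ab_tensor A B)" for u
      using h(1) that by (auto simp: hom_def)
    ultimately show ?thesis
      using hom_one[OF tens_P_props(1)] hom_one[OF h(1)]
      by (simp add: sg_hom_def \<psi>_def sg_of_ab_simps sg_tensor_simps hom_def TE.group_axioms TEE.group_axioms
          AB.group_axioms)
  qed
  have "sg_comp \<psi> \<phi> = sg_id MN"
  proof (rule sg_hom_eqI[OF sg_comp_hom[OF \<phi>(1) \<psi>] sg_id_hom _ _ sg_tensor_generated])
    show "map_e (sg_comp \<psi> \<phi>) s = map_e (sg_id MN) s" if "s \<in> {cir x y |x y. x \<in> car_e ?M \<and> y \<in> car_e ?N}" for s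
      using that by (auto simp: map_sg_comp_hom[OF \<phi>(1)] sg_of_ab_simps \<phi>(2) \<psi>_def h(2) sg_id_def sg_tensor_simps)
    show "map_ee (sg_comp \<psi> \<phi>) s = map_ee (sg_id MN) s" if "s \<in> {pu a b |a b. a \<in> car_ee ?M \<and> b \<in> car_ee ?N}" for s
      using that by (auto simp: map_sg_comp_hom[OF \<phi>(1)] sg_of_ab_simps \<psi>_def pu1 sg_id_def sg_tensor_simps)
  qed (simp_all add: square_group_sg_tensor)
  moreover have "sg_comp \<phi> \<psi> = sg_id ?K"
  proof (rule sg_hom_ext[OF sg_comp_hom[OF \<psi> \<phi>(1)] sg_id_hom])
    fix u assume "u \<in> car_e ?K"
    then have u: "u \<in> carrier (ab_tensor A B)" by (simp add: sg_of_ab_simps)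
    have hom: "(\<lambda>u. map_e \<phi> (h u)) \<in> hom (ab_tensor A B) (ab_tensor A B)" "(\<lambda>u. u) \<in> hom (ab_tensor A B) (ab_tensor A B)"
      using hom_compose[OF h(1), of "map_e \<phi>" "ab_tensor A B"] sg_homD(3)[OF \<phi>(1)]
      by (simp_all add: sg_of_ab_simps sg_tensor_simps comp_def hom_def)
    have "map_e \<phi> (h u) = u"
      by (rule hom_eq_on_generate[OF AB.group_axioms AB.group_axioms hom, where S = "{ab_pure A B a b |a b. a \<in> carrier A \<and> b \<in> carrier B}"])
        (use u in \<open>auto simp: C.ab_tensor_generate h(2) \<phi>(2)\<close>)
    then show "map_e (sg_comp \<phi> \<psi>) u = map_e (sg_id ?K) u"
      using u by (simp add: map_sg_comp_hom[OF \<psi>] sg_of_ab_simps) (simp add: \<psi>_def sg_id_def sg_of_ab_simps)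
  qed (simp_all add: K)
  ultimately have "\<phi> \<in> sg_iso MN ?K" by (rule sg_isoI[OF \<phi>(1) \<psi>])
  then show ?thesis using \<phi>(2) by blast
qed

theorem mainTheorem1:
  fixes A :: "'a monoid" and B :: "'b monoid"
  shows
    "(\<exists>asc lun run brd.
        symmetric_monoidal_category (SG :: ('x sgU, 'x morU) cat) SG_tensor SG_tensor_map SG_unit
          asc lun run brd) \<and>
     (comm_group A \<and> comm_group B \<longrightarrow>
        (\<exists>\<phi> \<in> sg_iso (sg_tensor (sg_of_ab A) (sg_of_ab B)) (sg_of_ab (ab_tensor A B)).
           \<forall>x \<in> carrier A. \<forall>y \<in> carrier B.
             map_e \<phi> (circ (sg_of_ab A) (sg_of_ab B) x y) = ab_pure A B x y))"
  using symmetric_monoidal_category_SG tensor_of_ab_iso by blast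

end
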